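(* Let $N\in\{1,2,3\}$, let $P\subsetneq\{1,\dots,d\}$ be a proper subset with $\#P\ge2$, and let $\lambda_i,\mu_i>0$ $(1\le i\le d)$ and $b_{ij}=b_{ji}>0$ $(i\neq j,\ (i,j)\notin P^2)$ be given. There exists a constant $B$, depending only on $(\lambda_i,\mu_i)_{1\le i\le d}$ and on $(b_{ij})_{i\ne j,\,(i,j)\notin P^2}$ (besides $N$, $d$ and $P$), such that for every choice of the remaining coefficients $b_{ij}=b_{ji}>0$, $(i,j)\in P^2$, $i\neq j$, with $$\min_{(i,j)\in P^2,\ i\ne j}b_{ij}>B,$$ any ground state $\mathbf{u}=(u_1,\ldots,u_d)$ of the system $$-\Delta u_i+\lambda_i u_i=\mu_i u_i^3+u_i\sum_{j\ne i}b_{ij}u_j^2,\qquad u_i\in H^1(\mathbb{R}^N;\mathbb{R}),\quad i=1,\ldots,d,$$ satisfies $u_{i_0}\equiv0$ for every $i_0\notin P$. In particular, $G^*=\emptyset$.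
   Context: Let $1\le N\le 3$, $\lambda_i,\mu_i>0$ for $i=1,\dots,d$, and $b_{ij}=b_{ji}>0$ for $i\neq j$. Consider the system $-\Delta u_i+\lambda_i u_i=\mu_i u_i^3+u_i\sum_{j\neq i}b_{ij}u_j^2$ in $\mathbb{R}^N$, $u_i\in H^1(\mathbb{R}^N;\mathbb{R})$, $i=1,\dots,d$. Its solutions are the critical points of the $C^2$ functional $I_d:(H^1(\mathbb{R}^N))^d\to\mathbb{R}$, $$I_d(\mathbf{u})=\frac12\sum_{i=1}^d\int(|\nabla u_i|^2+\lambda_i u_i^2)-\frac14\sum_{i=1}^d\mu_i\int u_i^4-\frac12\sum_{i<j}b_{ij}\int u_i^2u_j^2 .$$ The ground state level is $c=\inf\{I_d(\mathbf{u}):\mathbf{u}\ne\mathbf{0},\ I_d'(\mathbf{u})=0\}$, and a ground state is an element of $G=\{\mathbf{u}:\mathbf{u}\neq\mathbf{0},\ I_d'(\mathbf{u})=0,\ I_d(\mathbf{u})=c\}$. $G^*=\{\mathbf{u}\in G: u_i\not\equiv0\text{ for every } i=1,\dots,d\}$ is the set of fully nontrivial ground states. *)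

theory Defs
  imports "HOL-Analysis.Analysis"
begin

primrec Ck :: "nat \<Rightarrow> (real^'n \<Rightarrow> real) \<Rightarrow> bool" where
  "Ck 0 f \<longleftrightarrow> continuous_on UNIV f"
| "Ck (Suc k) f \<longleftrightarrow> (\<forall>x. f differentiable at x) \<and>
     (\<forall>i. Ck k (\<lambda>x. frechet_derivative f (at x) (axis i 1)))"

definition test_function :: "(real^'n \<Rightarrow> real) \<Rightarrow> bool" where
  "test_function \<phi> \<longleftrightarrow> (\<forall>k. Ck k \<phi>) \<and> compact (closure {x. \<phi> x \<noteq> 0})"

text \<open>
  Elements of Lebesgue and Sobolev spaces are represented by Borel functions, not by equivalence
  classes: every class modulo null sets has a Borel representative, and identity of classes
  (in particular \<open>u \<equiv> 0\<close>) is expressed by \<open>AE x in lborel\<close>.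
\<close>

definition L2 :: "(real^'n \<Rightarrow> 'b::euclidean_space) set" where
  "L2 = {f. f \<in> borel_measurable lborel \<and> integrable lborel (\<lambda>x. (norm (f x))\<^sup>2)}"

definition weak_gradient :: "(real^'n \<Rightarrow> real) \<Rightarrow> (real^'n \<Rightarrow> real^'n) \<Rightarrow> bool" where
  "weak_gradient u g \<longleftrightarrow> g \<in> L2 \<and>
     (\<forall>\<phi> i. test_function \<phi> \<longrightarrow>
        (LINT x|lborel. u x * frechet_derivative \<phi> (at x) (axis i 1))
          = - (LINT x|lborel. g x $ i * \<phi> x))"

definition H1 :: "(real^'n \<Rightarrow> real) set" where
  "H1 = {u. u \<in> L2 \<and> (\<exists>g. weak_gradient u g)}"

text \<open>For \<open>u \<in> H1\<close> the weak gradient is unique up to null sets, so the choice is immaterial.\<close>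

definition wgrad :: "(real^'n \<Rightarrow> real) \<Rightarrow> real^'n \<Rightarrow> real^'n" where
  "wgrad u = (SOME g. weak_gradient u g)"

text \<open>
  A vector \<open>(u\<^sub>1, \<dots>, u\<^sub>d)\<close> is a function on \<open>nat\<close> of which only the values on \<open>{1..d}\<close> matter;
  the others are unconstrained and never used.
\<close>

definition H1_vec :: "nat \<Rightarrow> (nat \<Rightarrow> real^'n \<Rightarrow> real) set" where
  "H1_vec d = {u. \<forall>i\<in>{1..d}. u i \<in> H1}"

definition H1_vec_norm :: "nat \<Rightarrow> (nat \<Rightarrow> real^'n \<Rightarrow> real) \<Rightarrow> real" where
  "H1_vec_norm d u =
     sqrt (\<Sum>i\<in>{1..d}. LINT x|lborel. (norm (wgrad (u i) x))\<^sup>2 + (u i x)\<^sup>2)"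

text \<open>
  Frechet differentiability at \<open>u\<close>, with derivative \<open>L\<close>, of a real functional on \<open>(H1)\<^sup>d\<close>.
  This is the content of \<open>has_derivative\<close>, which cannot be used directly because \<open>(H1)\<^sup>d\<close> is a
  set of functions and not a normed type.
\<close>

definition has_H1_derivative ::
  "nat \<Rightarrow> ((nat \<Rightarrow> real^'n \<Rightarrow> real) \<Rightarrow> real) \<Rightarrow> ((nat \<Rightarrow> real^'n \<Rightarrow> real) \<Rightarrow> real)
     \<Rightarrow> (nat \<Rightarrow> real^'n \<Rightarrow> real) \<Rightarrow> bool" where
  "has_H1_derivative d F L u \<longleftrightarrow>
     (\<forall>v\<in>H1_vec d. \<forall>w\<in>H1_vec d. L (\<lambda>i x. v i x + w i x) = L v + L w) \<and>
     (\<forall>v\<in>H1_vec d. \<forall>r. L (\<lambda>i x. r * v i x) = r * L v) \<and>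
     (\<exists>K. \<forall>v\<in>H1_vec d. \<bar>L v\<bar> \<le> K * H1_vec_norm d v) \<and>
     (\<forall>\<epsilon>>0. \<exists>\<delta>>0. \<forall>h\<in>H1_vec d. H1_vec_norm d h < \<delta> \<longrightarrow>
        \<bar>F (\<lambda>i x. u i x + h i x) - F u - L h\<bar> \<le> \<epsilon> * H1_vec_norm d h)"

definition energy :: "nat \<Rightarrow> (nat \<Rightarrow> real) \<Rightarrow> (nat \<Rightarrow> real) \<Rightarrow> (nat \<Rightarrow> nat \<Rightarrow> real)
    \<Rightarrow> (nat \<Rightarrow> real^'n \<Rightarrow> real) \<Rightarrow> real" where
  "energy d lam mu b u =
     1/2 * (\<Sum>i\<in>{1..d}. LINT x|lborel. (norm (wgrad (u i) x))\<^sup>2 + lam i * (u i x)\<^sup>2)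
     - 1/4 * (\<Sum>i\<in>{1..d}. mu i * (LINT x|lborel. (u i x)^4))
     - 1/2 * (\<Sum>i\<in>{1..d}. \<Sum>j\<in>{i<..d}. b i j * (LINT x|lborel. (u i x)\<^sup>2 * (u j x)\<^sup>2))"

text \<open>
  The nonzero solutions of the system
  \<open>-\<Delta>u\<^sub>i + \<lambda>\<^sub>iu\<^sub>i = \<mu>\<^sub>iu\<^sub>i\<^sup>3 + u\<^sub>i \<Sum>\<^bsub>j\<noteq>i\<^esub> b\<^sub>i\<^sub>ju\<^sub>j\<^sup>2\<close>, i.e. the nonzero critical points of the energy.
\<close>

definition nontrivial_solutions :: "nat \<Rightarrow> (nat \<Rightarrow> real) \<Rightarrow> (nat \<Rightarrow> real) \<Rightarrow> (nat \<Rightarrow> nat \<Rightarrow> real)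
    \<Rightarrow> (nat \<Rightarrow> real^'n \<Rightarrow> real) set" where
  "nontrivial_solutions d lam mu b =
     {u \<in> H1_vec d. \<not> (\<forall>i\<in>{1..d}. AE x in lborel. u i x = 0) \<and>
        has_H1_derivative d (energy d lam mu b) (\<lambda>h. 0) u}"

definition ground_states :: "nat \<Rightarrow> (nat \<Rightarrow> real) \<Rightarrow> (nat \<Rightarrow> real) \<Rightarrow> (nat \<Rightarrow> nat \<Rightarrow> real)
    \<Rightarrow> (nat \<Rightarrow> real^'n \<Rightarrow> real) set" where
  "ground_states d lam mu b =
     {u \<in> nontrivial_solutions d lam mu b.
        energy d lam mu b u
          = Inf (energy d lam mu b ` (nontrivial_solutions d lam mu b :: (nat \<Rightarrow> real^'n \<Rightarrow> real) set))}"

definition fully_nontrivial_ground_states ::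
  "nat \<Rightarrow> (nat \<Rightarrow> real) \<Rightarrow> (nat \<Rightarrow> real) \<Rightarrow> (nat \<Rightarrow> nat \<Rightarrow> real)
    \<Rightarrow> (nat \<Rightarrow> real^'n \<Rightarrow> real) set" where
  "fully_nontrivial_ground_states d lam mu b =
     {u \<in> ground_states d lam mu b. \<forall>i\<in>{1..d}. \<not> (AE x in lborel. u i x = 0)}"

end

theory Submission
  imports Defs "HOL-Probability.Probability_Measure" "HOL-Library.Diagonal_Subsequence"
begin

text \<open>
  Testing the equation of a component \<open>u\<^sub>i\<close>, \<open>i \<notin> P\<close>, with \<open>u\<^sub>i\<close> itself and using
  \<open>H\<^sup>1 \<subseteq> L\<^sup>4\<close> shows that a solution with \<open>u\<^sub>i \<noteq> 0\<close> has energy bounded below in terms of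
  the coefficients \<open>b\<^sub>i\<^sub>j\<close>, which are fixed for such \<open>i\<close>. On the other hand the ground state level
  tends to \<open>0\<close> when the couplings inside \<open>P\<close> tend to infinity, because a maximizer of the
  quartic part \<open>F\<close> of the energy on the unit sphere of the quadratic part can be rescaled to a
  solution of energy \<open>1 / (4 max F)\<close>. Maximizers exist by weak compactness up to translations.
  The Sobolev inequality and the non-vanishing of maximizing sequences are both obtained by
  telescoping iterated averages over cubes of side \<open>2\<^sup>-\<^sup>k\<close>, whose increments are small in
  \<open>L\<^sup>2\<close> and in the supremum norm.
\<close>

section \<open>Test functions and the fundamental lemma\<close>

lemma frechet_derivative_eqI:
  "(f has_derivative f') (at x) \<Longrightarrow> frechet_derivative f (at x) = f'"
  using frechet_derivative_at by metis

lemma Ck_SucD: "Ck (Suc k) f \<Longrightarrow> Ck k f"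
proof (induction k arbitrary: f)
  case 0
  then show ?case
    by (auto intro!: differentiable_imp_continuous_on simp: differentiable_on_def)
next
  case (Suc k)
  then show ?case by (metis Ck.simps(2))
qed

lemma Ck_continuous: "Ck k f \<Longrightarrow> continuous_on UNIV f"
  by (induction k) (auto dest: Ck_SucD simp del: Ck.simps(2))

lemma Ck_const: "Ck k (\<lambda>x. c)"
  by (induction k arbitrary: c) (auto simp: frechet_derivative_const)

lemma Ck_add: "Ck k f \<Longrightarrow> Ck k g \<Longrightarrow> Ck k (\<lambda>x. f x + g x)"
proof (induction k arbitrary: f g)
  case (Suc k)
  then have "frechet_derivative (\<lambda>x. f x + g x) (at x) =
      (\<lambda>h. frechet_derivative f (at x) h + frechet_derivative g (at x) h)" for x
    by (intro frechet_derivative_eqI derivative_intros) (auto simp: frechet_derivative_works[symmetric])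
  with Suc show ?case by auto
qed (auto intro: continuous_intros)

lemma Ck_mult: "Ck k f \<Longrightarrow> Ck k g \<Longrightarrow> Ck k (\<lambda>x. f x * g x)"
proof (induction k arbitrary: f g)
  case (Suc k)
  then have "frechet_derivative (\<lambda>x. f x * g x) (at x) =
      (\<lambda>h. f x * frechet_derivative g (at x) h + frechet_derivative f (at x) h * g x)" for x
    by (intro frechet_derivative_eqI derivative_intros) (auto simp: frechet_derivative_works[symmetric])
  moreover have "Ck k f" "Ck k g" using Suc.prems by (blast dest: Ck_SucD)+
  ultimately show ?case using Suc by (auto intro!: Ck_add)
qed (auto intro: continuous_intros)

lemma Ck_prod: "(\<And>i. i \<in> I \<Longrightarrow> Ck k (f i)) \<Longrightarrow> Ck k (\<lambda>x. \<Prod>i\<in>I. f i x)"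
  by (induction I rule: infinite_finite_induct) (auto intro: Ck_const Ck_mult)

lemma Ck_shift: "Ck k f \<Longrightarrow> Ck k (\<lambda>x. f (x - a))"
proof (induction k arbitrary: f)
  case 0
  then show ?case by (auto intro!: continuous_on_compose2[of UNIV f] continuous_intros)
next
  case (Suc k)
  have *: "((\<lambda>x. f (x - a)) has_derivative frechet_derivative f (at (x - a))) (at x)" for x
  proof -
    have "(f has_derivative frechet_derivative f (at (x - a))) (at (x - a))"
      using Suc.prems by (auto simp: frechet_derivative_works[symmetric])
    moreover have "((\<lambda>x. x - a) has_derivative (\<lambda>h. h)) (at x)"
      by (auto intro!: derivative_eq_intros)
    ultimately show ?thesis
      using has_derivative_compose[of "\<lambda>x. x - a" "\<lambda>h. h" x UNIV f] by (simp add: o_def)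
  qed
  have "frechet_derivative (\<lambda>x. f (x - a)) (at x) = frechet_derivative f (at (x - a))" for x
    by (intro frechet_derivative_eqI *)
  moreover have "Ck k (\<lambda>x. frechet_derivative f (at (x - a)) (axis i 1))" for i
    using Suc.IH[of "\<lambda>x. frechet_derivative f (at x) (axis i 1)"] Suc.prems by simp
  moreover have "(\<lambda>x. f (x - a)) differentiable at x" for x
    using * by (auto simp: differentiable_def)
  ultimately show ?case by simp
qed

lemma test_function_shift: "test_function \<phi> \<Longrightarrow> test_function (\<lambda>x. \<phi> (x - a))"
proof -
  assume t: "test_function \<phi>"
  have "{x. \<phi> (x - a) \<noteq> 0} = (\<lambda>x. x + a) ` {x. \<phi> x \<noteq> 0}"
    by (force simp: image_iff intro: exI[of _ "_ - a"])
  moreover have "(\<lambda>x. x + a) ` {x. \<phi> x \<noteq> 0} = (+) a ` {x. \<phi> x \<noteq> 0}"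
    by (simp add: add.commute)
  ultimately have "bounded {x. \<phi> (x - a) \<noteq> 0}"
    using t by (simp add: test_function_def bounded_translation)
  then show ?thesis
    using t by (simp add: test_function_def Ck_shift)
qed

definition flat :: "real poly \<Rightarrow> real \<Rightarrow> real" where
  "flat p t = (if t > 0 then poly p (1 / t) * exp (- (1 / t)) else 0)"

lemma poly_exp_tendsto_0: "((\<lambda>s::real. s ^ k * poly p s * exp (- s)) \<longlongrightarrow> 0) at_top"
proof (induction p arbitrary: k rule: pCons_induct)
  case (pCons a p)
  have 1: "((\<lambda>s::real. s ^ k * exp (- s)) \<longlongrightarrow> 0) at_top"
    using tendsto_power_div_exp_0[of k] by (simp add: exp_minus divide_inverse)
  have "((\<lambda>s. a * (s ^ k * exp (- s)) + s ^ Suc k * poly p s * exp (- s)) \<longlongrightarrow> a * 0 + 0) at_top"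
    by (intro tendsto_intros 1 pCons.IH)
  then show ?case by (simp add: algebra_simps)
qed simp

lemma has_real_derivative_flat:
  "(flat p has_real_derivative flat ([:0, 0, 1:] * (p - pderiv p)) t) (at t)"
proof -
  consider "t > 0" | "t < 0" | "t = 0" by linarith
  then show ?thesis
  proof cases
    case 1
    have "((\<lambda>t. poly p (1 / t) * exp (- (1 / t))) has_real_derivative
        flat ([:0, 0, 1:] * (p - pderiv p)) t) (at t)"
      using 1 by (auto intro!: derivative_eq_intros simp: flat_def field_simps power2_eq_square)
    moreover have "\<forall>\<^sub>F s in nhds t. flat p s = poly p (1 / s) * exp (- (1 / s))"
      using eventually_nhds_in_open[of "{0<..}" t] 1 by (auto elim!: eventually_mono simp: flat_def)
    ultimately show ?thesis by (subst DERIV_cong_ev[OF refl _ refl]) auto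
  next
    case 2
    have "\<forall>\<^sub>F s in nhds t. flat p s = 0"
      using eventually_nhds_in_open[of "{..<0}" t] 2 by (auto elim!: eventually_mono simp: flat_def)
    moreover have "((\<lambda>t. 0) has_real_derivative flat ([:0, 0, 1:] * (p - pderiv p)) t) (at t)"
      using 2 by (simp add: flat_def)
    ultimately show ?thesis by (subst DERIV_cong_ev[OF refl _ refl]) auto
  next
    case 3
    have "((\<lambda>h. flat p h / h) \<longlongrightarrow> 0) (at_left 0)"
      by (rule tendsto_eventually) (auto simp: eventually_at_filter flat_def)
    moreover have "((\<lambda>h. flat p h / h) \<longlongrightarrow> 0) (at_right 0)"
    proof (rule Lim_transform_eventually)
      show "((\<lambda>h::real. (1/h) ^ 1 * poly p (1/h) * exp (- (1/h))) \<longlongrightarrow> 0) (at_right 0)"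
        by (rule filterlim_compose[OF poly_exp_tendsto_0])
          (simp add: filterlim_inverse_at_top_right flip: inverse_eq_divide)
      show "\<forall>\<^sub>F h in at_right 0. (1/h) ^ 1 * poly p (1/h) * exp (- (1/h)) = flat p h / h"
        by (auto simp: eventually_at_filter flat_def)
    qed
    ultimately have "((\<lambda>h. flat p h / h) \<longlongrightarrow> 0) (at 0)"
      by (simp add: filterlim_split_at)
    then show ?thesis using 3 by (simp add: DERIV_def flat_def)
  qed
qed

lemma Ck_flat_affine: "Ck k (\<lambda>x::real^'n. flat p (s * x $ i + r))"
proof -
  define q where "q p = [:0, 0, 1:] * (p - pderiv p)" for p :: "real poly"
  have d: "((\<lambda>x::real^'n. flat p (s * x $ i + r)) has_derivative
      (\<lambda>h. flat (q p) (s * x $ i + r) * (s * h $ i))) (at x)" for x p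
  proof -
    have 1: "(flat p has_derivative (\<lambda>h. flat (q p) (s * x $ i + r) * h)) (at (s * x $ i + r))"
      using has_real_derivative_flat[of p "s * x $ i + r"]
      by (simp add: has_field_derivative_def q_def)
    have "((\<lambda>x::real^'n. x $ i) has_derivative (\<lambda>h. h $ i)) (at x)"
      by (simp add: bounded_linear_vec_nth bounded_linear_imp_has_derivative)
    then have 2: "((\<lambda>x::real^'n. s * x $ i + r) has_derivative (\<lambda>h. s * h $ i)) (at x)"
      by (auto intro!: derivative_eq_intros)
    show ?thesis using has_derivative_compose[OF 2 1] .
  qed
  have "Ck k (\<lambda>x::real^'n. flat p (s * x $ i + r))" for p
  proof (induction k arbitrary: p)
    case 0
    then show ?case
      using has_derivative_continuous_on[OF has_derivative_at_withinI[OF d]] by simp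
  next
    case (Suc k)
    have "frechet_derivative (\<lambda>x::real^'n. flat p (s * x $ i + r)) (at x) =
        (\<lambda>h. flat (q p) (s * x $ i + r) * (s * h $ i))" for x
      by (intro frechet_derivative_eqI d)
    moreover have "(\<lambda>x::real^'n. flat p (s * x $ i + r)) differentiable at x" for x
      using d unfolding differentiable_def by blast
    ultimately show ?case using Suc.IH by (simp add: Ck_mult Ck_const)
  qed
  then show ?thesis .
qed

definition bump :: "real^'n \<Rightarrow> real^'n \<Rightarrow> nat \<Rightarrow> real^'n \<Rightarrow> real" where
  "bump a b m x = (\<Prod>i\<in>UNIV. flat 1 (real (Suc m) * (x $ i - a $ i)) * flat 1 (real (Suc m) * (b $ i - x $ i)))"

lemma flat_1_bounds: "0 \<le> flat 1 t" "flat 1 t \<le> 1"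
  by (auto simp: flat_def)

lemma bump_bounds: "0 \<le> bump a b m x" "bump a b m x \<le> 1"
  unfolding bump_def
  by (intro prod_nonneg prod_le_1 conjI ballI mult_nonneg_nonneg mult_le_one flat_1_bounds)+

lemma bump_outside: "x \<notin> box a b \<Longrightarrow> bump a b m x = 0"
proof -
  assume "x \<notin> box a b"
  then obtain i where "\<not> (a $ i < x $ i \<and> x $ i < b $ i)" by (auto simp: mem_box_cart)
  then have "flat 1 (real (Suc m) * (x $ i - a $ i)) * flat 1 (real (Suc m) * (b $ i - x $ i)) = 0"
    by (auto simp: flat_def zero_less_mult_iff)
  then show ?thesis by (auto simp: bump_def intro!: prod_zero)
qed

lemma test_function_bump: "test_function (bump a b m :: real^'n \<Rightarrow> real)"
proof -
  have "bump a b m = (\<lambda>x::real^'n. \<Prod>i\<in>UNIV. flat 1 (real (Suc m) * x $ i + (- real (Suc m) * a $ i))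
     * flat 1 (- real (Suc m) * x $ i + real (Suc m) * b $ i))"
    by (auto simp: bump_def algebra_simps)
  then have "Ck k (bump a b m)" for k
    by (simp only:) (intro Ck_prod Ck_mult Ck_flat_affine)
  moreover have "bounded {x. bump a b m x \<noteq> 0}"
    by (rule bounded_subset[OF bounded_box[of a b]]) (use bump_outside in blast)
  ultimately show ?thesis by (simp add: test_function_def)
qed

lemma bump_tendsto: "(\<lambda>m. bump a b m x) \<longlonglongrightarrow> indicator (box a b) (x :: real^'n)"
proof (cases "x \<in> box a b")
  case True
  have *: "(\<lambda>m. flat 1 (real (Suc m) * t)) \<longlonglongrightarrow> 1" if "t > 0" for t
  proof -
    have "(\<lambda>m. exp (- (inverse (real (Suc m)) * inverse t))) \<longlonglongrightarrow> exp (- (0 * inverse t))"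
      by (intro tendsto_intros LIMSEQ_inverse_real_of_nat)
    then have "(\<lambda>m. exp (- (1 / (real (Suc m) * t)))) \<longlonglongrightarrow> 1"
      by (simp add: divide_inverse del: of_nat_Suc)
    then show ?thesis using that by (simp add: flat_def del: of_nat_Suc)
  qed
  have "(\<lambda>m. bump a b m x) \<longlonglongrightarrow> (\<Prod>i\<in>(UNIV::'n set). 1 * 1)"
    unfolding bump_def using True by (intro tendsto_intros *) (auto simp: mem_box_cart)
  then show ?thesis using True by simp
qed (simp add: bump_outside)

lemma AE_zero_if_box_integrals_zero:
  fixes f :: "'a::euclidean_space \<Rightarrow> real"
  assumes int: "\<And>a b. set_integrable lborel (box a b) f"
    and zero: "\<And>a b. (LINT x:box a b|lborel. f x) = 0"
  shows "AE x in lborel. f x = 0"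
proof -
  have "AE x in lborel. x \<in> box (- real n *\<^sub>R One) (real n *\<^sub>R One) \<longrightarrow> f x = 0" for n
  proof -
    define E where "E = box (- real n *\<^sub>R One) (real n *\<^sub>R One :: 'a)"
    define g where "g x = indicator E x * f x" for x
    have g: "integrable lborel g"
      using int[of "- real n *\<^sub>R One" "real n *\<^sub>R One"] by (simp add: g_def[abs_def] E_def set_integrable_def)
    have si: "set_integrable lborel A g" if "A \<in> sets borel" for A
      unfolding set_integrable_def using g that by (intro integrable_mult_indicator) auto
    have boxg: "(LINT x:box a b|lborel. g x) = 0" for a b
    proof -
      have "box a b \<inter> E = box (\<Sum>i\<in>Basis. max (a \<bullet> i) (- real n) *\<^sub>R i) (\<Sum>i\<in>Basis. min (b \<bullet> i) (real n) *\<^sub>R i)"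
        by (auto simp: E_def box_def)
      then have "(LINT x:box a b \<inter> E|lborel. f x) = 0" using zero by metis
      then show ?thesis
        by (simp add: g_def set_lebesgue_integral_def indicator_inter_arith mult.assoc)
    qed
    have gE: "(LINT x|lborel. g x) = 0"
      using zero[of "- real n *\<^sub>R One" "real n *\<^sub>R One"]
      by (simp add: g_def[abs_def] E_def set_lebesgue_integral_def)
    have A: "(LINT x:A|lborel. g x) = 0" if "A \<in> sets borel" for A
    proof -
      have *: "Int_stable (range (\<lambda>(a, b). box a b :: 'a set))"
          "range (\<lambda>(a, b). box a b :: 'a set) \<subseteq> Pow UNIV"
        by (auto simp: Int_stable_def box_Int_box)
      have "A \<in> sigma_sets UNIV (range (\<lambda>(a, b). box a b :: 'a set))"
        using that by (simp add: borel_eq_box)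
      with * show ?thesis
      proof (induction rule: sigma_sets_induct_disjoint)
        case (union A)
        then have "A i \<in> sets borel" for i by (auto simp: borel_eq_box)
        then have "(LINT x:\<Union>(range A)|lborel. g x) = (\<Sum>i. LINT x:A i|lborel. g x)"
          using union by (intro lebesgue_integral_countable_add si)
            (auto simp: disjoint_family_on_def)
        then show ?case using union by simp
      next
        case (compl A)
        then have "A \<in> sets borel" by (auto simp: borel_eq_box)
        then have "integrable lborel (\<lambda>x. indicator A x *\<^sub>R g x)"
          using si by (simp add: set_integrable_def)
        moreover have "indicator (UNIV - A) x *\<^sub>R g x = g x - indicator A x *\<^sub>R g x" for x
          by (simp split: split_indicator)
        ultimately have "(LINT x:UNIV - A|lborel. g x) = (LINT x|lborel. g x) - (LINT x:A|lborel. g x)"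
          using g unfolding set_lebesgue_integral_def by (simp del: real_scaleR_def)
        then show ?case using compl gE by simp
      qed (auto simp: boxg set_lebesgue_integral_def[of _ "{}"])
    qed
    have gm: "g \<in> borel_measurable borel" using g by (simp add: borel_measurable_integrable)
    have pos: "AE x in lborel. indicator {x. s * g x > 0} x * (s * g x) = 0" if "s = 1 \<or> s = -1" for s
    proof -
      have m: "{x. s * g x > 0} \<in> sets borel" using gm by measurable
      have "integrable lborel (\<lambda>x. indicator {x. s * g x > 0} x * (s * g x))"
        using si[OF m] by (simp add: set_integrable_def mult.left_commute)
      moreover have "(LINT x|lborel. indicator {x. s * g x > 0} x * (s * g x)) = 0"
        using A[OF m] by (simp add: set_lebesgue_integral_def mult.left_commute)
      ultimately show ?thesis
        by (subst (asm) integral_nonneg_eq_0_iff_AE) (auto simp: indicator_def)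
    qed
    show ?thesis
      using pos[OF disjI1[OF refl]] pos[OF disjI2[OF refl]]
      by eventually_elim (auto simp: g_def E_def indicator_def split: if_splits)
  qed
  then have "AE x in lborel. \<forall>n::nat. x \<in> box (- real n *\<^sub>R One) (real n *\<^sub>R One) \<longrightarrow> f x = 0"
    unfolding AE_all_countable by blast
  then show ?thesis
  proof eventually_elim
    case (elim x)
    obtain n :: nat where n: "norm x < real n" using reals_Archimedean2 by blast
    then have "x \<in> box (- real n *\<^sub>R One) (real n *\<^sub>R One)"
      using Basis_le_norm[of _ x] by (force simp: box_def)
    then show ?case using elim by blast
  qed
qed

lemma AE_zero_if_test_integrals_zero:
  fixes f :: "real^'n \<Rightarrow> real"
  assumes int: "\<And>a b. set_integrable lborel (box a b) f"
    and zero: "\<And>\<phi>. test_function \<phi> \<Longrightarrow> (LINT x|lborel. f x * \<phi> x) = 0"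
  shows "AE x in lborel. f x = 0"
proof (rule AE_zero_if_box_integrals_zero[OF int])
  fix a b :: "real^'n"
  have i: "integrable lborel (\<lambda>x. indicator (box a b) x * f x)"
    using int by (simp add: set_integrable_def)
  have cont: "continuous_on UNIV (bump a b m :: real^'n \<Rightarrow> real)" for m
    using test_function_bump[of a b m] Ck_continuous unfolding test_function_def by blast
  have eq: "f x * bump a b m x = (indicator (box a b) x * f x) * bump a b m x" for m x
    by (cases "x \<in> box a b") (auto simp: bump_outside)
  have "(\<lambda>m. LINT x|lborel. (indicator (box a b) x * f x) * bump a b m x) \<longlonglongrightarrow>
      (LINT x|lborel. (indicator (box a b) x * f x) * indicator (box a b) x)"
  proof (rule integral_dominated_convergence[where w = "\<lambda>x. \<bar>indicator (box a b) x * f x\<bar>"])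
    show "AE x in lborel. norm (indicator (box a b) x * f x * bump a b m x) \<le> \<bar>indicator (box a b) x * f x\<bar>" for m
      by (rule AE_I2) (auto simp: abs_mult bump_bounds intro!: mult_right_le_one_le)
    show "(\<lambda>x. indicator (box a b) x * f x * bump a b m x) \<in> borel_measurable lborel" for m
      using i borel_measurable_continuous_onI[OF cont[of m]] by (auto dest: borel_measurable_integrable)
  qed (use i in \<open>auto intro!: tendsto_mult bump_tendsto\<close>)
  then have "(LINT x|lborel. (indicator (box a b) x * f x) * indicator (box a b) x) = 0"
    using zero[OF test_function_bump] by (simp add: eq[symmetric] LIMSEQ_const_iff)
  then show "(LINT x:box a b|lborel. f x) = 0"
    by (simp add: set_lebesgue_integral_def mult.commute mult.left_commute flip: indicator_inter_arith)
qed

section \<open>Weak gradients\<close>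

lemma integrable_shift:
  fixes f :: "'a::euclidean_space \<Rightarrow> 'b::{banach, second_countable_topology}"
  assumes "integrable lborel f" shows "integrable lborel (\<lambda>x. f (x + a))"
proof -
  have "integrable (distr lborel borel ((+) a)) f" using assms by (simp add: lborel_distr_plus)
  then show ?thesis by (subst (asm) integrable_distr_eq) (auto simp: add.commute assms[THEN borel_measurable_integrable, simplified])
qed

lemma integral_shift:
  fixes f :: "'a::euclidean_space \<Rightarrow> 'b::{banach, second_countable_topology}"
  assumes "f \<in> borel_measurable borel"
  shows "(LINT x|lborel. f (x + a)) = (LINT x|lborel. f x)"
proof -
  have "(LINT x|lborel. f x) = (LINT x|distr lborel borel ((+) a). f x)" by (simp add: lborel_distr_plus)
  also have "\<dots> = (LINT x|lborel. f (a + x))" using assms by (subst integral_distr) auto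
  finally show ?thesis by (simp add: add.commute)
qed

lemma nn_integral_shift:
  fixes f :: "'a::euclidean_space \<Rightarrow> ennreal"
  assumes "f \<in> borel_measurable borel"
  shows "(\<integral>\<^sup>+x. f (x + a) \<partial>lborel) = (\<integral>\<^sup>+x. f x \<partial>lborel)"
proof -
  have "(\<integral>\<^sup>+x. f x \<partial>lborel) = (\<integral>\<^sup>+x. f x \<partial>distr lborel borel ((+) a))" by (simp add: lborel_distr_plus)
  also have "\<dots> = (\<integral>\<^sup>+x. f (a + x) \<partial>lborel)" using assms by (subst nn_integral_distr) auto
  finally show ?thesis by (simp add: add.commute)
qed

lemma integrable_if_nn_integral_le:
  fixes f :: "'a \<Rightarrow> real"
  assumes "f \<in> borel_measurable M" "\<And>x. 0 \<le> f x" "0 \<le> C" "(\<integral>\<^sup>+x. ennreal (f x) \<partial>M) \<le> ennreal C"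
  shows "integrable M f" "(LINT x|M. f x) \<le> C"
proof -
  show i: "integrable M f"
    using assms by (intro integrableI_nonneg) (auto intro: le_less_trans[OF _ ennreal_less_top])
  show "(LINT x|M. f x) \<le> C"
    using assms nn_integral_eq_integral[OF i] by simp
qed

lemma Cauchy_Schwarz_integral:
  fixes f g :: "'a \<Rightarrow> real"
  assumes [measurable]: "f \<in> borel_measurable M" "g \<in> borel_measurable M"
    and f: "integrable M (\<lambda>x. (f x)\<^sup>2)" and g: "integrable M (\<lambda>x. (g x)\<^sup>2)"
  shows "integrable M (\<lambda>x. f x * g x)"
    and "(LINT x|M. f x * g x)\<^sup>2 \<le> (LINT x|M. (f x)\<^sup>2) * (LINT x|M. (g x)\<^sup>2)"
proof -
  show fg: "integrable M (\<lambda>x. f x * g x)"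
  proof (rule Bochner_Integration.integrable_bound[of M "\<lambda>x. (f x)\<^sup>2 + (g x)\<^sup>2"])
    show "AE x in M. norm (f x * g x) \<le> norm ((f x)\<^sup>2 + (g x)\<^sup>2)"
    proof (rule AE_I2)
      fix x
      have "2 * (\<bar>f x\<bar> * \<bar>g x\<bar>) \<le> (f x)\<^sup>2 + (g x)\<^sup>2" "0 \<le> \<bar>f x\<bar> * \<bar>g x\<bar>"
        using sum_squares_bound[of "\<bar>f x\<bar>" "\<bar>g x\<bar>"] by auto
      then have "\<bar>f x\<bar> * \<bar>g x\<bar> \<le> (f x)\<^sup>2 + (g x)\<^sup>2" by linarith
      then show "norm (f x * g x) \<le> norm ((f x)\<^sup>2 + (g x)\<^sup>2)"
        by (simp add: abs_mult)
    qed
  qed (use f g in auto)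
  have "0 \<le> (LINT x|M. (f x)\<^sup>2) * t\<^sup>2 + 2 * (LINT x|M. f x * g x) * t + (LINT x|M. (g x)\<^sup>2)" for t
  proof -
    have "0 \<le> (LINT x|M. (t * f x + g x)\<^sup>2)" by simp
    also have "\<dots> = (LINT x|M. t\<^sup>2 * (f x)\<^sup>2 + 2 * t * (f x * g x) + (g x)\<^sup>2)"
      by (intro Bochner_Integration.integral_cong) (auto simp: power2_eq_square algebra_simps)
    also have "\<dots> = t\<^sup>2 * (LINT x|M. (f x)\<^sup>2) + 2 * t * (LINT x|M. f x * g x) + (LINT x|M. (g x)\<^sup>2)"
      using f g fg by simp
    finally show ?thesis by (simp add: mult_ac)
  qed
  note q = this
  let ?A = "LINT x|M. (f x)\<^sup>2" and ?B = "LINT x|M. f x * g x" and ?C = "LINT x|M. (g x)\<^sup>2"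
  show "?B\<^sup>2 \<le> ?A * ?C"
  proof (cases "?A = 0")
    case True
    have "?B = 0"
    proof (rule ccontr)
      assume "?B \<noteq> 0"
      with q[of "- (?C + 1) / (2 * ?B)"] True show False by simp
    qed
    then show ?thesis by (simp add: True)
  next
    case False
    moreover have "0 \<le> ?A" by simp
    ultimately have A: "?A > 0" by linarith
    have "0 \<le> ?A * (?A * (- ?B / ?A)\<^sup>2 + 2 * ?B * (- ?B / ?A) + ?C)"
      using q[of "- ?B / ?A"] A by (intro mult_nonneg_nonneg) auto
    also have "\<dots> = ?A * ?C - ?B\<^sup>2" using A by (simp add: field_simps power2_eq_square)
    finally show ?thesis by simp
  qed
qed

lemma (in prob_space) expectation_square_le:
  fixes h :: "'a \<Rightarrow> real"
  assumes [measurable]: "h \<in> borel_measurable M"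
  shows "ennreal ((expectation h)\<^sup>2) \<le> (\<integral>\<^sup>+x. ennreal ((h x)\<^sup>2) \<partial>M)"
proof (cases "integrable M (\<lambda>x. (h x)\<^sup>2)")
  case True
  then show ?thesis
    using Cauchy_Schwarz_integral(2)[of h M "\<lambda>_. 1"]
    by (subst nn_integral_eq_integral) (auto simp: prob_space)
next
  case False
  then have "(\<integral>\<^sup>+x. ennreal ((h x)\<^sup>2) \<partial>M) = \<infinity>"
    by (subst (asm) integrable_iff_bounded) (auto simp: less_top[symmetric])
  then show ?thesis by simp
qed

lemma nn_integral_average_square:
  fixes k :: "'a \<times> 'b \<Rightarrow> real"
  assumes "prob_space \<mu>" "sigma_finite_measure M"
    and [measurable]: "k \<in> borel_measurable (M \<Otimes>\<^sub>M \<mu>)"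
    and C: "\<And>y. y \<in> space \<mu> \<Longrightarrow> (\<integral>\<^sup>+x. ennreal ((k (x, y))\<^sup>2) \<partial>M) \<le> ennreal C"
  shows "(\<integral>\<^sup>+x. ennreal ((LINT y|\<mu>. k (x, y))\<^sup>2) \<partial>M) \<le> ennreal C"
proof -
  interpret \<mu>: prob_space \<mu> by fact
  interpret pair_sigma_finite M \<mu>
    using assms(2) \<mu>.sigma_finite_measure_axioms by (simp add: pair_sigma_finite_def)
  have "(\<integral>\<^sup>+x. ennreal ((LINT y|\<mu>. k (x, y))\<^sup>2) \<partial>M) \<le> (\<integral>\<^sup>+x. \<integral>\<^sup>+y. ennreal ((k (x, y))\<^sup>2) \<partial>\<mu> \<partial>M)"
    by (intro nn_integral_mono \<mu>.expectation_square_le) simp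
  also have "\<dots> = (\<integral>\<^sup>+y. \<integral>\<^sup>+x. ennreal ((k (x, y))\<^sup>2) \<partial>M \<partial>\<mu>)"
    by (subst Fubini'[symmetric]) auto
  also have "\<dots> \<le> (\<integral>\<^sup>+y. ennreal C \<partial>\<mu>)"
    by (intro nn_integral_mono C)
  also have "\<dots> = ennreal C" by (simp add: \<mu>.emeasure_space_1)
  finally show ?thesis .
qed

lemma integrable_pair_if_slices_bounded:
  fixes k :: "'a \<times> 'b \<Rightarrow> real"
  assumes "prob_space \<mu>" "sigma_finite_measure M"
    and [measurable]: "k \<in> borel_measurable (\<mu> \<Otimes>\<^sub>M M)"
    and i: "\<And>y. y \<in> space \<mu> \<Longrightarrow> integrable M (\<lambda>x. k (y, x))"
    and C: "\<And>y. y \<in> space \<mu> \<Longrightarrow> (LINT x|M. \<bar>k (y, x)\<bar>) \<le> C"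
  shows "integrable (\<mu> \<Otimes>\<^sub>M M) k"
proof -
  interpret \<mu>: prob_space \<mu> by fact
  interpret pair_sigma_finite \<mu> M
    using assms(2) \<mu>.sigma_finite_measure_axioms by (simp add: pair_sigma_finite_def)
  show ?thesis
  proof (rule Fubini_integrable)
    show "integrable \<mu> (\<lambda>x. LINT y|M. norm (k (x, y)))"
      by (rule \<mu>.integrable_const_bound[of _ C]) (use C in auto)
  qed (use i in auto)
qed

lemma L2_measurable [measurable_dest]: "f \<in> L2 \<Longrightarrow> f \<in> borel_measurable borel"
  by (simp add: L2_def)

lemma L2_integrable: "f \<in> L2 \<Longrightarrow> integrable lborel (\<lambda>x. (norm (f x))\<^sup>2)"
  by (simp add: L2_def)

lemma L2_integrable_real: "(f :: real^'n \<Rightarrow> real) \<in> L2 \<Longrightarrow> integrable lborel (\<lambda>x. (f x)\<^sup>2)"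
  by (simp add: L2_def)

lemma L2_add: 
  assumes f: "f \<in> L2" and g: "g \<in> L2" shows "(\<lambda>x. f x + g x) \<in> L2"
proof -
  have "integrable lborel (\<lambda>x. (norm (f x + g x))\<^sup>2)"
  proof (rule Bochner_Integration.integrable_bound[of _ "\<lambda>x. 2 * (norm (f x))\<^sup>2 + 2 * (norm (g x))\<^sup>2"])
    show "AE x in lborel. norm ((norm (f x + g x))\<^sup>2) \<le> norm (2 * (norm (f x))\<^sup>2 + 2 * (norm (g x))\<^sup>2)"
    proof (rule AE_I2)
      fix x
      have "(norm (f x + g x))\<^sup>2 \<le> (norm (f x) + norm (g x))\<^sup>2"
        by (intro power_mono norm_triangle_ineq) auto
      then show "norm ((norm (f x + g x))\<^sup>2) \<le> norm (2 * (norm (f x))\<^sup>2 + 2 * (norm (g x))\<^sup>2)"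
        using sum_squares_bound[of "norm (f x)" "norm (g x)"] by (simp add: power2_sum)
    qed
  qed (use f g in \<open>auto simp: L2_def\<close>)
  then show ?thesis using f g by (auto simp: L2_def)
qed

lemma L2_scaleR: "f \<in> L2 \<Longrightarrow> (\<lambda>x. c *\<^sub>R f x) \<in> L2"
  by (auto simp: L2_def power_mult_distrib)

lemma L2_cmult: "(f :: real^'n \<Rightarrow> real) \<in> L2 \<Longrightarrow> (\<lambda>x. c * f x) \<in> L2"
  using L2_scaleR[of f c] by simp

lemma L2_diff: "f \<in> L2 \<Longrightarrow> g \<in> L2 \<Longrightarrow> (\<lambda>x. f x - g x) \<in> L2"
  using L2_add[of f "\<lambda>x. (-1) *\<^sub>R g x"] L2_scaleR[of g "-1"] by simp

lemma L2_zero [simp]: "(\<lambda>x. 0) \<in> L2"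
  by (simp add: L2_def)

lemma L2_shift: "f \<in> L2 \<Longrightarrow> (\<lambda>x. f (x + a)) \<in> L2"
  using integrable_shift[of "\<lambda>x. (norm (f x))\<^sup>2" a] by (auto simp: L2_def)

lemma L2_inner_integrable:
  assumes f: "f \<in> L2" and g: "g \<in> L2" shows "integrable lborel (\<lambda>x. f x \<bullet> g x)"
proof (rule Bochner_Integration.integrable_bound)
  show "integrable lborel (\<lambda>x. (norm (f x))\<^sup>2 + (norm (g x))\<^sup>2)"
    using f g by (auto simp: L2_def)
  show "AE x in lborel. norm (f x \<bullet> g x) \<le> norm ((norm (f x))\<^sup>2 + (norm (g x))\<^sup>2)"
  proof (rule AE_I2)
    fix x
    have "\<bar>f x \<bullet> g x\<bar> \<le> norm (f x) * norm (g x)" by (rule Cauchy_Schwarz_ineq2)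
    also have "\<dots> \<le> (norm (f x))\<^sup>2 + (norm (g x))\<^sup>2"
      using sum_squares_bound[of "norm (f x)" "norm (g x)"]
        mult_nonneg_nonneg[OF norm_ge_zero[of "f x"] norm_ge_zero[of "g x"]] by linarith
    finally show "norm (f x \<bullet> g x) \<le> norm ((norm (f x))\<^sup>2 + (norm (g x))\<^sup>2)" by simp
  qed
qed (use f g in measurable)

lemma L2_mult_integrable:
  "(f :: real^'n \<Rightarrow> real) \<in> L2 \<Longrightarrow> g \<in> L2 \<Longrightarrow> integrable lborel (\<lambda>x. f x * g x)"
  using L2_inner_integrable[of f g] by simp

lemma L2_inner_const: "f \<in> L2 \<Longrightarrow> (\<lambda>x. f x \<bullet> c) \<in> L2"
proof -
  assume f: "f \<in> L2"
  have "integrable lborel (\<lambda>x. (norm (f x \<bullet> c))\<^sup>2)"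
  proof (rule Bochner_Integration.integrable_bound)
    show "integrable lborel (\<lambda>x. (norm c)\<^sup>2 * (norm (f x))\<^sup>2)" using f by (simp add: L2_def)
    show "AE x in lborel. norm ((norm (f x \<bullet> c))\<^sup>2) \<le> norm ((norm c)\<^sup>2 * (norm (f x))\<^sup>2)"
    proof (rule AE_I2)
      fix x
      have "\<bar>f x \<bullet> c\<bar>\<^sup>2 \<le> (norm (f x) * norm c)\<^sup>2"
        by (intro power_mono Cauchy_Schwarz_ineq2) auto
      then show "norm ((norm (f x \<bullet> c))\<^sup>2) \<le> norm ((norm c)\<^sup>2 * (norm (f x))\<^sup>2)"
        by (simp add: power_mult_distrib mult.commute)
    qed
  qed (use f in measurable)
  then show ?thesis using f by (auto simp: L2_def)
qed

lemma L2_nth: "(f :: real^'n \<Rightarrow> real^'m) \<in> L2 \<Longrightarrow> (\<lambda>x. f x $ i) \<in> L2"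
  using L2_inner_const[of f "axis i 1"] by (simp add: cart_eq_inner_axis)

lemma L2_bounded_support:
  fixes f :: "real^'n \<Rightarrow> real"
  assumes [measurable]: "f \<in> borel_measurable borel" and b: "\<And>x. \<bar>f x\<bar> \<le> C"
    and S: "bounded S" "\<And>x. x \<notin> S \<Longrightarrow> f x = 0"
  shows "f \<in> L2"
proof -
  obtain a where a: "S \<subseteq> cbox (-a) a" using S(1) bounded_subset_cbox_symmetric by blast
  have "integrable lborel (\<lambda>x. (f x)\<^sup>2)"
  proof (rule Bochner_Integration.integrable_bound)
    show "integrable lborel (\<lambda>x. C\<^sup>2 * indicator (cbox (-a) a) x :: real)"
      by (intro integrable_mult_right integrable_real_indicator) (auto simp: emeasure_lborel_cbox_finite[unfolded infinity_ennreal_def])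
    have "(f x)\<^sup>2 \<le> C\<^sup>2 * indicator (cbox (-a) a) x" for x
      using power_mono[OF b[of x] abs_ge_zero, of 2] S(2)[of x] a by (auto simp: indicator_def)
    then show "AE x in lborel. norm ((f x)\<^sup>2) \<le> norm (C\<^sup>2 * indicator (cbox (-a) a) x :: real)"
      by (auto simp: abs_mult)
  qed simp
  then show ?thesis by (simp add: L2_def)
qed

lemma L2_set_integrable_box:
  assumes "(f :: real^'n \<Rightarrow> real) \<in> L2" shows "set_integrable lborel (box a b) f"
proof -
  have "indicator (box a b) \<in> (L2 :: (real^'n \<Rightarrow> real) set)"
    by (rule L2_bounded_support[where C = 1 and S = "box a b"]) auto
  from L2_mult_integrable[OF this assms] show ?thesis by (simp add: set_integrable_def)
qed

lemma test_function_cont: "test_function \<phi> \<Longrightarrow> continuous_on UNIV \<phi>"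
  using Ck_continuous unfolding test_function_def by blast

lemma test_function_measurable: "test_function \<phi> \<Longrightarrow> \<phi> \<in> borel_measurable borel"
  by (intro borel_measurable_continuous_onI test_function_cont)

lemma test_function_bounded: 
  assumes "test_function \<phi>" obtains C where "\<And>x. \<bar>\<phi> x\<bar> \<le> C"
proof -
  have "compact (\<phi> ` closure {x. \<phi> x \<noteq> 0})"
    using assms test_function_cont[OF assms]
    by (intro compact_continuous_image) (auto simp: test_function_def intro: continuous_on_subset)
  then obtain C where C: "\<And>x. x \<in> closure {x. \<phi> x \<noteq> 0} \<Longrightarrow> \<bar>\<phi> x\<bar> \<le> C"
    using compact_imp_bounded bounded_real by (metis imageI)
  have "\<bar>\<phi> x\<bar> \<le> max 0 C" for x
    using C[of x] closure_subset[of "{x. \<phi> x \<noteq> 0}"] by (cases "\<phi> x = 0") fastforce+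
  then show ?thesis using that by blast
qed

lemma test_function_L2: "test_function \<phi> \<Longrightarrow> \<phi> \<in> L2"
proof -
  assume t: "test_function \<phi>"
  obtain C where "\<And>x. \<bar>\<phi> x\<bar> \<le> C" using test_function_bounded[OF t] by blast
  then show "\<phi> \<in> L2"
    by (rule L2_bounded_support[OF test_function_measurable[OF t], where S = "{x. \<phi> x \<noteq> 0}"])
      (use t in \<open>auto simp: test_function_def\<close>)
qed

lemma test_function_differentiable: "test_function \<phi> \<Longrightarrow> \<phi> differentiable at x"
  unfolding test_function_def using Ck.simps(2)[of 0 \<phi>] by metis

lemma test_function_partial:
  assumes "test_function \<phi>"
  shows "test_function (\<lambda>x. frechet_derivative \<phi> (at x) (axis i 1))"
proof -
  let ?d = "\<lambda>x. frechet_derivative \<phi> (at x) (axis i 1)"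
  have "Ck k ?d" for k using assms Ck.simps(2)[of k \<phi>] by (simp add: test_function_def)
  moreover have "{x. ?d x \<noteq> 0} \<subseteq> closure {x. \<phi> x \<noteq> 0}"
  proof (rule subsetI, rule ccontr)
    fix x assume x: "x \<in> {x. ?d x \<noteq> 0}" "x \<notin> closure {x. \<phi> x \<noteq> 0}"
    have "\<forall>\<^sub>F z in nhds x. \<phi> z = 0"
    proof (rule eventually_mono[OF eventually_nhds_in_open])
      show "open (- closure {x. \<phi> x \<noteq> 0})" by (simp add: open_Compl)
    qed (use x(2) closure_subset[of "{x. \<phi> x \<noteq> 0}"] in auto)
    then have "\<forall>\<^sub>F z in at x. 0 = \<phi> z" "\<phi> x = 0"
      by (auto simp: eventually_at_filter elim: eventually_mono dest: eventually_nhds_x_imp_x)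
    then have "(\<phi> has_derivative (\<lambda>h. 0)) (at x)"
      using has_derivative_transform_eventually[of "\<lambda>z. 0" "\<lambda>h. 0" x UNIV \<phi>] by simp
    then have "frechet_derivative \<phi> (at x) = (\<lambda>h. 0)" by (rule frechet_derivative_eqI)
    then show False using x by simp
  qed
  then have "bounded {x. ?d x \<noteq> 0}"
    using assms bounded_subset compact_imp_bounded unfolding test_function_def by blast
  ultimately show ?thesis by (simp add: test_function_def)
qed

lemma test_function_derivative_sum:
  fixes \<phi> :: "real^'n \<Rightarrow> real"
  assumes "test_function \<phi>"
  shows "frechet_derivative \<phi> (at x) y = (\<Sum>i\<in>UNIV. y $ i * frechet_derivative \<phi> (at x) (axis i 1))"
proof -
  have l: "linear (frechet_derivative \<phi> (at x))"
    using test_function_differentiable[OF assms] by (rule linear_frechet_derivative)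
  have "frechet_derivative \<phi> (at x) y = frechet_derivative \<phi> (at x) (\<Sum>i\<in>UNIV. y $ i *\<^sub>R axis i 1)"
    using basis_expansion[of y] by (simp add: scalar_mult_eq_scaleR)
  also have "\<dots> = (\<Sum>i\<in>UNIV. y $ i * frechet_derivative \<phi> (at x) (axis i 1))"
    by (simp add: linear_sum[OF l] linear_scale[OF l])
  finally show ?thesis .
qed

lemma frechet_derivative_shift:
  assumes "test_function \<phi>"
  shows "frechet_derivative (\<lambda>x. \<phi> (x - a)) (at x) = frechet_derivative \<phi> (at (x - a))"
proof (rule frechet_derivative_eqI)
  have 1: "(\<phi> has_derivative frechet_derivative \<phi> (at (x - a))) (at (x - a))"
    using test_function_differentiable[OF assms] by (simp add: frechet_derivative_works[symmetric])
  have 2: "((\<lambda>x. x - a) has_derivative (\<lambda>h. h)) (at x)"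
    by (auto intro!: derivative_eq_intros)
  show "((\<lambda>x. \<phi> (x - a)) has_derivative frechet_derivative \<phi> (at (x - a))) (at x)"
    using has_derivative_compose[OF 2 1] .
qed

lemma weak_gradientD:
  "weak_gradient u g \<Longrightarrow> test_function \<phi> \<Longrightarrow>
    (LINT x|lborel. u x * frechet_derivative \<phi> (at x) (axis i 1)) = - (LINT x|lborel. g x $ i * \<phi> x)"
  by (simp add: weak_gradient_def)

lemma weak_gradient_L2: "weak_gradient u g \<Longrightarrow> g \<in> L2"
  by (simp add: weak_gradient_def)

lemma weak_gradient_add:
  fixes u :: "real^'n \<Rightarrow> real"
  assumes u: "u \<in> L2" "weak_gradient u g" and v: "v \<in> L2" "weak_gradient v k"
  shows "weak_gradient (\<lambda>x. u x + v x) (\<lambda>x. g x + k x)"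
  unfolding weak_gradient_def
proof (intro conjI allI impI)
  show "(\<lambda>x. g x + k x) \<in> L2" using u v by (auto intro: L2_add weak_gradient_L2)
  fix \<phi> :: "real^'n \<Rightarrow> real" and i assume t: "test_function \<phi>"
  note L = weak_gradient_L2[OF u(2)] weak_gradient_L2[OF v(2)] test_function_L2[OF t]
    test_function_L2[OF test_function_partial[OF t]]
  show "(LINT x|lborel. (u x + v x) * frechet_derivative \<phi> (at x) (axis i 1)) =
      - (LINT x|lborel. (g x + k x) $ i * \<phi> x)"
    using u v L weak_gradientD[OF u(2) t, of i] weak_gradientD[OF v(2) t, of i]
    by (simp add: distrib_right L2_mult_integrable L2_nth)
qed

lemma weak_gradient_scale:
  assumes u: "weak_gradient u g"
  shows "weak_gradient (\<lambda>x. c * u x) (\<lambda>x. c *\<^sub>R g x)"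
  using assms by (auto simp: weak_gradient_def L2_scaleR mult.assoc)

lemma weak_gradient_zero: "weak_gradient (\<lambda>x. 0) (\<lambda>x. 0)"
  by (simp add: weak_gradient_def)

lemma weak_gradient_shift:
  fixes u :: "real^'n \<Rightarrow> real"
  assumes u: "u \<in> L2" "weak_gradient u g"
  shows "weak_gradient (\<lambda>x. u (x + a)) (\<lambda>x. g (x + a))"
  unfolding weak_gradient_def
proof (intro conjI allI impI)
  show "(\<lambda>x. g (x + a)) \<in> L2" using u by (auto intro: L2_shift weak_gradient_L2)
  fix \<phi> :: "real^'n \<Rightarrow> real" and i assume t: "test_function \<phi>"
  have [measurable]: "u \<in> borel_measurable borel" "(\<lambda>x. g x $ i) \<in> borel_measurable borel"
    "\<phi> \<in> borel_measurable borel" "(\<lambda>x. frechet_derivative \<phi> (at x) (axis i 1)) \<in> borel_measurable borel"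
    using u weak_gradient_L2[OF u(2)] t test_function_partial[OF t]
    by (auto intro: test_function_measurable L2_measurable L2_nth)
  have "(LINT x|lborel. u (x + a) * frechet_derivative \<phi> (at x) (axis i 1)) =
     (LINT x|lborel. u (x + a) * frechet_derivative (\<lambda>x. \<phi> (x - a)) (at (x + a)) (axis i 1))"
    by (simp add: frechet_derivative_shift[OF t])
  also have "\<dots> = (LINT x|lborel. u x * frechet_derivative (\<lambda>x. \<phi> (x - a)) (at x) (axis i 1))"
    by (rule integral_shift) (simp add: frechet_derivative_shift[OF t])
  also have "\<dots> = - (LINT x|lborel. g x $ i * \<phi> (x - a))"
    by (rule weak_gradientD[OF u(2) test_function_shift[OF t]])
  also have "(LINT x|lborel. g x $ i * \<phi> (x - a)) = (LINT x|lborel. g (x + a) $ i * \<phi> x)"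
    using integral_shift[of "\<lambda>x. g x $ i * \<phi> (x - a)" a] by simp
  finally show "(LINT x|lborel. u (x + a) * frechet_derivative \<phi> (at x) (axis i 1)) =
      - (LINT x|lborel. g (x + a) $ i * \<phi> x)" .
qed

lemma weak_gradient_unique:
  fixes u :: "real^'n \<Rightarrow> real"
  assumes g: "weak_gradient u g" and k: "weak_gradient u k"
  shows "AE x in lborel. g x = k x"
proof -
  have "AE x in lborel. g x $ i - k x $ i = 0" for i
  proof (rule AE_zero_if_test_integrals_zero)
    show "set_integrable lborel (box a b) (\<lambda>x. g x $ i - k x $ i)" for a b
      using g k by (intro L2_set_integrable_box L2_diff L2_nth weak_gradient_L2)
    fix \<phi> :: "real^'n \<Rightarrow> real" assume t: "test_function \<phi>"
    note L = weak_gradient_L2[OF g] weak_gradient_L2[OF k] test_function_L2[OF t]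
    show "(LINT x|lborel. (g x $ i - k x $ i) * \<phi> x) = 0"
      using L weak_gradientD[OF g t, of i] weak_gradientD[OF k t, of i]
      by (simp add: left_diff_distrib L2_mult_integrable L2_nth)
  qed
  then have "AE x in lborel. \<forall>i. g x $ i - k x $ i = 0"
    by (simp add: AE_all_countable)
  then show ?thesis by eventually_elim (simp add: vec_eq_iff)
qed

lemma H1_L2: "u \<in> H1 \<Longrightarrow> u \<in> L2"
  by (simp add: H1_def)

lemma H1_wgrad: "u \<in> H1 \<Longrightarrow> weak_gradient u (wgrad u)"
  using someI_ex[of "weak_gradient u"] by (simp add: H1_def wgrad_def)

lemma wgrad_L2: "u \<in> H1 \<Longrightarrow> wgrad u \<in> L2"
  by (rule weak_gradient_L2[OF H1_wgrad])

lemma H1I: "u \<in> L2 \<Longrightarrow> weak_gradient u g \<Longrightarrow> u \<in> H1"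
  by (auto simp: H1_def)

lemma wgrad_AE: "u \<in> L2 \<Longrightarrow> weak_gradient u g \<Longrightarrow> AE x in lborel. wgrad u x = g x"
  by (rule weak_gradient_unique[OF H1_wgrad]) (auto intro: H1I)

lemma H1_zero: "(\<lambda>x. 0) \<in> H1"
  by (rule H1I[OF _ weak_gradient_zero]) simp

lemma H1_add: "u \<in> H1 \<Longrightarrow> v \<in> H1 \<Longrightarrow> (\<lambda>x. u x + v x) \<in> H1"
  by (rule H1I[OF _ weak_gradient_add]) (auto intro: L2_add H1_L2 H1_wgrad)

lemma H1_cmult: "u \<in> H1 \<Longrightarrow> (\<lambda>x. c * u x) \<in> H1"
  by (rule H1I[OF _ weak_gradient_scale]) (auto intro: L2_cmult H1_L2 H1_wgrad)

lemma H1_diff: "u \<in> H1 \<Longrightarrow> v \<in> H1 \<Longrightarrow> (\<lambda>x. u x - v x) \<in> H1"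
  using H1_add[of u "\<lambda>x. (-1) * v x"] H1_cmult[of v "-1"] by simp

lemma H1_shift: "u \<in> H1 \<Longrightarrow> (\<lambda>x. u (x + a)) \<in> H1"
  by (rule H1I[OF _ weak_gradient_shift]) (auto intro: L2_shift H1_L2 H1_wgrad)

lemma wgrad_add: "u \<in> H1 \<Longrightarrow> v \<in> H1 \<Longrightarrow>
    AE x in lborel. wgrad (\<lambda>x. u x + v x) x = wgrad u x + wgrad v x"
  by (rule wgrad_AE[OF _ weak_gradient_add]) (auto intro: L2_add H1_L2 H1_wgrad)

lemma wgrad_cmult: "u \<in> H1 \<Longrightarrow> AE x in lborel. wgrad (\<lambda>x. c * u x) x = c *\<^sub>R wgrad u x"
  by (rule wgrad_AE[OF _ weak_gradient_scale]) (auto intro: L2_cmult H1_L2 H1_wgrad)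

lemma wgrad_shift: "u \<in> H1 \<Longrightarrow> AE x in lborel. wgrad (\<lambda>x. u (x + a)) x = wgrad u (x + a)"
  by (rule wgrad_AE[OF _ weak_gradient_shift]) (auto intro: L2_shift H1_L2 H1_wgrad)

section \<open>Difference quotients\<close>

definition unit_measure :: "'a::euclidean_space measure" where
  "unit_measure = density lborel (indicator (cbox 0 One))"

lemma sets_unit_measure [simp, measurable_cong]: "sets unit_measure = sets borel"
  by (simp add: unit_measure_def)

lemma space_unit_measure [simp]: "space unit_measure = UNIV"
  by (simp add: unit_measure_def)

lemma prob_space_unit_measure: "prob_space (unit_measure :: 'a::euclidean_space measure)"
proof
  have "emeasure unit_measure (space (unit_measure :: 'a measure)) = emeasure lborel (cbox 0 One :: 'a set)"
    by (simp add: unit_measure_def emeasure_density)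
  also have "\<dots> = 1" by (subst emeasure_lborel_cbox) auto
  finally show "emeasure unit_measure (space (unit_measure :: 'a measure)) = 1" .
qed

interpretation unit_measure: prob_space unit_measure
  by (rule prob_space_unit_measure)

lemma AE_unit_measure: "AE y in unit_measure. y \<in> cbox 0 One"
  unfolding unit_measure_def by (subst AE_density) (auto split: split_indicator_asm)

lemma integral_unit_measure:
  "(h :: 'a::euclidean_space \<Rightarrow> real) \<in> borel_measurable borel \<Longrightarrow>
    (LINT y|unit_measure. h y) = (LINT y|lborel. indicator (cbox 0 One) y * h y)"
proof -
  assume [measurable]: "h \<in> borel_measurable borel"
  have eq: "unit_measure = density lborel (\<lambda>y::'a. ennreal (indicator (cbox 0 One) y))"
    unfolding unit_measure_def by (intro density_cong) (auto simp: indicator_def)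
  show ?thesis unfolding eq by (subst integral_density) auto
qed

lemma test_function_difference:
  fixes \<phi> :: "real^'n \<Rightarrow> real"
  assumes t: "test_function \<phi>"
  shows "\<phi> (x - y) - \<phi> x = - (LINT s|unit_measure. frechet_derivative \<phi> (at (x - s *\<^sub>R y)) y)"
proof -
  let ?d = "\<lambda>s. frechet_derivative \<phi> (at (x - s *\<^sub>R y)) y"
  have "continuous_on UNIV (\<lambda>x. frechet_derivative \<phi> (at x) y)"
    by (subst test_function_derivative_sum[OF t])
      (intro continuous_intros test_function_cont[OF test_function_partial[OF t]])
  then have c: "continuous_on UNIV ?d"
    by (rule continuous_on_compose2) (auto intro!: continuous_intros)
  have d: "((\<lambda>s. \<phi> (x - s *\<^sub>R y)) has_real_derivative - ?d s) (at s)" for s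
  proof -
    have 1: "(\<phi> has_derivative frechet_derivative \<phi> (at (x - s *\<^sub>R y))) (at (x - s *\<^sub>R y))"
      using test_function_differentiable[OF t] by (simp add: frechet_derivative_works[symmetric])
    have 2: "((\<lambda>s. x - s *\<^sub>R y) has_derivative (\<lambda>h. - h *\<^sub>R y)) (at s)"
      by (auto intro!: derivative_eq_intros)
    have l: "linear (frechet_derivative \<phi> (at (x - s *\<^sub>R y)))"
      using test_function_differentiable[OF t] by (rule linear_frechet_derivative)
    have "frechet_derivative \<phi> (at (x - s *\<^sub>R y)) (- h *\<^sub>R y) = - ?d s * h" for h
      using linear_scale[OF l, of "- h" y] by simp
    then have "(\<lambda>h. frechet_derivative \<phi> (at (x - s *\<^sub>R y)) (- h *\<^sub>R y)) = (*) (- ?d s)" by (rule ext)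
    then show ?thesis
      using has_derivative_compose[OF 2 1] by (simp only: has_field_derivative_def)
  qed
  have "(LBINT s. - ?d s * indicator {0..1} s) = \<phi> (x - 1 *\<^sub>R y) - \<phi> (x - 0 *\<^sub>R y)"
    using c by (intro integral_FTC_Icc_real d)
      (auto intro!: continuous_intros simp: continuous_on_eq_continuous_at)
  moreover have "(LBINT s. - ?d s * indicator {0..1} s) = - (LINT s|unit_measure. ?d s)"
    using borel_measurable_continuous_onI[OF c]
    by (subst integral_unit_measure) (auto simp: mult.commute)
  ultimately show ?thesis by simp
qed

lemma H1_difference_AE:
  fixes u :: "real^'n \<Rightarrow> real"
  assumes u: "u \<in> L2" and g: "weak_gradient u g"
  shows "AE x in lborel. u (x + y) - u x = (LINT s|unit_measure. g (x + (s::real) *\<^sub>R y) \<bullet> y)"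
    and "(LINT x|lborel. (u (x + y) - u x)\<^sup>2) \<le> (norm y)\<^sup>2 * (LINT x|lborel. (norm (g x))\<^sup>2)"
proof -
  have gL: "g \<in> L2" using g by (rule weak_gradient_L2)
  have [measurable]: "u \<in> borel_measurable borel" "g \<in> borel_measurable borel"
    using u gL by (auto intro: L2_measurable)
  define C where "C = (norm y)\<^sup>2 * (LINT x|lborel. (norm (g x))\<^sup>2)"
  have C0: "0 \<le> C" by (simp add: C_def)
  define k where "k = (\<lambda>(x, s::real). g (x + s *\<^sub>R y) \<bullet> y)"
  have k[measurable]: "k \<in> borel_measurable (lborel \<Otimes>\<^sub>M unit_measure)"
    unfolding k_def by measurable
  have gy: "(\<lambda>x. g x \<bullet> y) \<in> L2" using gL by (rule L2_inner_const)
  have gyC: "(LINT x|lborel. (g x \<bullet> y)\<^sup>2) \<le> C"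
  proof -
    have "(LINT x|lborel. (g x \<bullet> y)\<^sup>2) \<le> (LINT x|lborel. (norm y)\<^sup>2 * (norm (g x))\<^sup>2)"
    proof (intro integral_mono)
      fix x
      have "\<bar>g x \<bullet> y\<bar>\<^sup>2 \<le> (norm (g x) * norm y)\<^sup>2"
        by (intro power_mono Cauchy_Schwarz_ineq2) auto
      then show "(g x \<bullet> y)\<^sup>2 \<le> (norm y)\<^sup>2 * (norm (g x))\<^sup>2"
        by (simp add: power_mult_distrib mult.commute)
    qed (use L2_integrable_real[OF gy] L2_integrable[OF gL] in auto)
    then show ?thesis by (simp add: C_def)
  qed
  have "(\<integral>\<^sup>+x. ennreal ((LINT s|unit_measure. k (x, s))\<^sup>2) \<partial>lborel) \<le> ennreal C"
  proof (rule nn_integral_average_square)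
    fix s :: real
    have "(\<integral>\<^sup>+x. ennreal ((k (x, s))\<^sup>2) \<partial>lborel) = (\<integral>\<^sup>+x. ennreal ((g x \<bullet> y)\<^sup>2) \<partial>lborel)"
      using nn_integral_shift[of "\<lambda>x. ennreal ((g x \<bullet> y)\<^sup>2)" "s *\<^sub>R y"] by (simp add: k_def)
    also have "\<dots> = ennreal (LINT x|lborel. (g x \<bullet> y)\<^sup>2)"
      using L2_integrable_real[OF gy] by (intro nn_integral_eq_integral) auto
    also have "\<dots> \<le> ennreal C" using gyC by (intro ennreal_leI)
    finally show "(\<integral>\<^sup>+x. ennreal ((k (x, s))\<^sup>2) \<partial>lborel) \<le> ennreal C" .
  qed (use k in \<open>auto simp: prob_space_unit_measure sigma_finite_lborel\<close>)
  then have G: "integrable lborel (\<lambda>x. (LINT s|unit_measure. k (x, s))\<^sup>2)"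
    "(LINT x|lborel. (LINT s|unit_measure. k (x, s))\<^sup>2) \<le> C"
    by (rule integrable_if_nn_integral_le[rotated 3]; use C0 in simp)+
  then have GL: "(\<lambda>x. LINT s|unit_measure. k (x, s)) \<in> L2"
    by (auto simp: L2_def)
  have "AE x in lborel. (u (x + y) - u x) - (LINT s|unit_measure. k (x, s)) = 0"
  proof (rule AE_zero_if_test_integrals_zero)
    show "set_integrable lborel (box a b) (\<lambda>x. (u (x + y) - u x) - (LINT s|unit_measure. k (x, s)))" for a b
      using u GL by (intro L2_set_integrable_box L2_diff L2_shift)
    fix \<phi> :: "real^'n \<Rightarrow> real" assume t: "test_function \<phi>"
    define \<psi> where "\<psi> x = frechet_derivative \<phi> (at x) y" for x
    have \<psi>s: "\<psi> x = (\<Sum>i\<in>UNIV. y $ i * frechet_derivative \<phi> (at x) (axis i 1))" for x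
      unfolding \<psi>_def by (rule test_function_derivative_sum[OF t])
    have L2_sum: "(\<lambda>x. \<Sum>i\<in>I. f i x) \<in> L2" if "\<And>i. f i \<in> L2" for I :: "'n set" and f :: "'n \<Rightarrow> real^'n \<Rightarrow> real"
      using that by (induction I rule: infinite_finite_induct) (auto intro: L2_add)
    have \<psi>L: "\<psi> \<in> L2" unfolding \<psi>s
      by (intro L2_sum L2_cmult test_function_L2 test_function_partial t)
    note \<phi>L = test_function_L2[OF t]
    have [measurable]: "\<psi> \<in> borel_measurable borel" "\<phi> \<in> borel_measurable borel"
      using \<psi>L \<phi>L by (auto intro: L2_measurable)
    have pair1: "pair_sigma_finite (unit_measure :: real measure) (lborel :: (real^'n) measure)"
      by (simp add: pair_sigma_finite_def sigma_finite_lborel unit_measure.sigma_finite_measure_axioms)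
    have bound: "(LINT x|lborel. \<bar>f x * h x\<bar>) \<le> (LINT x|lborel. (f x)\<^sup>2) + (LINT x|lborel. (h x)\<^sup>2)"
      if "f \<in> L2" "h \<in> L2" for f h :: "real^'n \<Rightarrow> real"
    proof -
      have "(LINT x|lborel. \<bar>f x * h x\<bar>) \<le> (LINT x|lborel. (f x)\<^sup>2 + (h x)\<^sup>2)"
      proof (intro integral_mono)
        fix x
        have "2 * (\<bar>f x\<bar> * \<bar>h x\<bar>) \<le> (f x)\<^sup>2 + (h x)\<^sup>2" "0 \<le> \<bar>f x\<bar> * \<bar>h x\<bar>"
          using sum_squares_bound[of "\<bar>f x\<bar>" "\<bar>h x\<bar>"] by auto
        then show "\<bar>f x * h x\<bar> \<le> (f x)\<^sup>2 + (h x)\<^sup>2" unfolding abs_mult by linarith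
      qed (use that in \<open>auto intro: L2_mult_integrable L2_integrable_real\<close>)
      then show ?thesis using that by (simp add: L2_integrable_real)
    qed
    have sqshift: "(LINT x|lborel. (f (x + a))\<^sup>2) = (LINT x|lborel. (f x)\<^sup>2)"
      if "f \<in> L2" for f :: "real^'n \<Rightarrow> real" and a
      using that by (intro integral_shift) (auto dest: L2_measurable)
    have "(LINT x|lborel. (u (x + y) - u x) * \<phi> x) = (LINT x|lborel. u (x + y) * \<phi> x) - (LINT x|lborel. u x * \<phi> x)"
      using u \<phi>L by (simp add: left_diff_distrib L2_mult_integrable L2_shift)
    also have "(LINT x|lborel. u (x + y) * \<phi> x) = (LINT x|lborel. u x * \<phi> (x - y))"
      using integral_shift[of "\<lambda>x. u x * \<phi> (x - y)" y] by simp
    also have "(LINT x|lborel. u x * \<phi> (x - y)) - (LINT x|lborel. u x * \<phi> x) =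
        (LINT x|lborel. u x * (\<phi> (x - y) - \<phi> x))"
      using u \<phi>L L2_shift[OF \<phi>L, of "-y"] by (simp add: right_diff_distrib L2_mult_integrable)
    also have "\<dots> = - (LINT x|lborel. LINT s|unit_measure. u x * \<psi> (x - s *\<^sub>R y))"
      by (subst test_function_difference[OF t]) (simp add: \<psi>_def)
    also have "(LINT x|lborel. LINT s|unit_measure. u x * \<psi> (x - s *\<^sub>R y)) =
        (LINT s|unit_measure. LINT x|lborel. u x * \<psi> (x - s *\<^sub>R y))"
    proof (subst pair_sigma_finite.Fubini_integral[OF pair1, symmetric])
      show "integrable (unit_measure \<Otimes>\<^sub>M lborel) (\<lambda>(s, x). u x * \<psi> (x - s *\<^sub>R y))"
      proof (rule integrable_pair_if_slices_bounded)
        fix s :: real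
        have *: "(\<lambda>x. \<psi> (x - s *\<^sub>R y)) \<in> L2" using L2_shift[OF \<psi>L, of "- s *\<^sub>R y"] by simp
        then show "integrable lborel (\<lambda>x. case (s, x) of (s, x) \<Rightarrow> u x * \<psi> (x - s *\<^sub>R y))"
          using u by (simp add: L2_mult_integrable)
        show "(LINT x|lborel. \<bar>case (s, x) of (s, x) \<Rightarrow> u x * \<psi> (x - s *\<^sub>R y)\<bar>)
            \<le> (LINT x|lborel. (u x)\<^sup>2) + (LINT x|lborel. (\<psi> x)\<^sup>2)"
          using bound[OF u *] sqshift[OF \<psi>L, of "- s *\<^sub>R y"] by simp
      qed (auto simp: prob_space_unit_measure sigma_finite_lborel)
    qed simp
    also have "\<dots> = - (LINT s|unit_measure. LINT x|lborel. k (x, s) * \<phi> x)"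
    proof -
      have "(LINT x|lborel. u x * \<psi> (x - s *\<^sub>R y)) = - (LINT x|lborel. k (x, s) * \<phi> x)" for s
      proof -
        let ?\<phi> = "\<lambda>x. \<phi> (x - s *\<^sub>R y)"
        note t' = test_function_shift[OF t, of "s *\<^sub>R y"]
        note L = test_function_L2[OF test_function_partial[OF t']] test_function_L2[OF t']
        have "(LINT x|lborel. u x * \<psi> (x - s *\<^sub>R y)) =
            (LINT x|lborel. (\<Sum>i\<in>UNIV. y $ i * (u x * frechet_derivative ?\<phi> (at x) (axis i 1))))"
          by (simp add: \<psi>s frechet_derivative_shift[OF t] sum_distrib_left mult_ac)
        also have "\<dots> = (\<Sum>i\<in>UNIV. y $ i * (LINT x|lborel. u x * frechet_derivative ?\<phi> (at x) (axis i 1)))"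
          using L u by (subst Bochner_Integration.integral_sum) (auto intro: L2_mult_integrable)
        also have "\<dots> = - (\<Sum>i\<in>UNIV. y $ i * (LINT x|lborel. g x $ i * ?\<phi> x))"
          by (simp add: weak_gradientD[OF g t'] sum_negf)
        also have "(\<Sum>i\<in>UNIV. y $ i * (LINT x|lborel. g x $ i * ?\<phi> x)) =
            (LINT x|lborel. (\<Sum>i\<in>UNIV. y $ i * (g x $ i * ?\<phi> x)))"
          using L gL by (subst Bochner_Integration.integral_sum) (auto intro: L2_mult_integrable L2_nth)
        also have "\<dots> = (LINT x|lborel. (g x \<bullet> y) * ?\<phi> x)"
          by (simp add: inner_vec_def sum_distrib_right sum_distrib_left mult_ac)
        also have "\<dots> = (LINT x|lborel. k (x, s) * \<phi> x)"
          using integral_shift[of "\<lambda>x. (g x \<bullet> y) * ?\<phi> x" "s *\<^sub>R y"] by (simp add: k_def)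
        finally show ?thesis .
      qed
      then show ?thesis by simp
    qed
    also have "(LINT s|unit_measure. LINT x|lborel. k (x, s) * \<phi> x) =
        (LINT x|lborel. LINT s|unit_measure. k (x, s) * \<phi> x)"
    proof (subst pair_sigma_finite.Fubini_integral[OF pair1])
      show "integrable (unit_measure \<Otimes>\<^sub>M lborel) (\<lambda>(s, x). k (x, s) * \<phi> x)"
      proof (rule integrable_pair_if_slices_bounded)
        fix s :: real
        have *: "(\<lambda>x. k (x, s)) \<in> L2" using L2_shift[OF gy, of "s *\<^sub>R y"] by (simp add: k_def)
        then show "integrable lborel (\<lambda>x. case (s, x) of (s, x) \<Rightarrow> k (x, s) * \<phi> x)"
          using \<phi>L by (simp add: L2_mult_integrable)
        show "(LINT x|lborel. \<bar>case (s, x) of (s, x) \<Rightarrow> k (x, s) * \<phi> x\<bar>)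
            \<le> (LINT x|lborel. (g x \<bullet> y)\<^sup>2) + (LINT x|lborel. (\<phi> x)\<^sup>2)"
          using bound[OF * \<phi>L] sqshift[OF gy, of "s *\<^sub>R y"] by (simp add: k_def)
        show "(\<lambda>(s, x). k (x, s) * \<phi> x) \<in> borel_measurable (unit_measure \<Otimes>\<^sub>M lborel)"
          unfolding k_def by measurable
      qed (auto simp: prob_space_unit_measure sigma_finite_lborel)
    qed simp
    finally have "(LINT x|lborel. (u (x + y) - u x) * \<phi> x) =
        (LINT x|lborel. (LINT s|unit_measure. k (x, s)) * \<phi> x)" by simp
    then show "(LINT x|lborel. ((u (x + y) - u x) - (LINT s|unit_measure. k (x, s))) * \<phi> x) = 0"
      using L2_diff[OF L2_shift[OF u, of y] u] GL \<phi>L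
      by (subst left_diff_distrib) (simp add: L2_mult_integrable)
  qed
  then have ae: "AE x in lborel. u (x + y) - u x = (LINT s|unit_measure. k (x, s))"
    by eventually_elim simp
  then show "AE x in lborel. u (x + y) - u x = (LINT s|unit_measure. g (x + (s::real) *\<^sub>R y) \<bullet> y)"
    by (simp add: k_def)
  have "(LINT x|lborel. (u (x + y) - u x)\<^sup>2) = (LINT x|lborel. (LINT s|unit_measure. k (x, s))\<^sup>2)"
    using ae by (intro integral_cong_AE) auto
  then show "(LINT x|lborel. (u (x + y) - u x)\<^sup>2) \<le> (norm y)\<^sup>2 * (LINT x|lborel. (norm (g x))\<^sup>2)"
    using G(2) by (simp add: C_def)
qed

section \<open>Averages over cubes\<close>

definition cube_average :: "real \<Rightarrow> (real^'n \<Rightarrow> real) \<Rightarrow> real^'n \<Rightarrow> real" where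
  "cube_average r f x = (LINT y|unit_measure. f (x + r *\<^sub>R y))"

lemma cube_average_measurable [measurable]:
  assumes [measurable]: "f \<in> borel_measurable borel"
  shows "cube_average r f \<in> borel_measurable borel"
proof -
  have "(\<lambda>x. LINT y|unit_measure. f (x + r *\<^sub>R y)) \<in> borel_measurable borel"
    by (rule unit_measure.borel_measurable_lebesgue_integral) measurable
  then show ?thesis by (simp add: cube_average_def[abs_def])
qed

lemma nn_integral_unit_measure_le:
  fixes F :: "real^'n \<Rightarrow> ennreal"
  assumes [measurable]: "F \<in> borel_measurable borel" and r: "r > 0"
  shows "(\<integral>\<^sup>+y. F (x + r *\<^sub>R y) \<partial>unit_measure) \<le> ennreal ((1 / r) ^ CARD('n)) * (\<integral>\<^sup>+y. F y \<partial>lborel)"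
proof -
  have "(\<integral>\<^sup>+y. F (x + r *\<^sub>R y) \<partial>unit_measure) = (\<integral>\<^sup>+y. indicator (cbox 0 One) y * F (x + r *\<^sub>R y) \<partial>lborel)"
    unfolding unit_measure_def by (subst nn_integral_density) auto
  also have "\<dots> \<le> (\<integral>\<^sup>+y. F (x + r *\<^sub>R y) \<partial>lborel)"
    by (intro nn_integral_mono) (auto split: split_indicator)
  also have "\<dots> = ennreal ((1 / r) ^ CARD('n)) * (ennreal (r ^ CARD('n)) * (\<integral>\<^sup>+y. F (x + r *\<^sub>R y) \<partial>lborel))"
    using r by (simp add: mult.assoc[symmetric] ennreal_mult[symmetric] power_mult_distrib[symmetric])
  also have "ennreal (r ^ CARD('n)) * (\<integral>\<^sup>+y. F (x + r *\<^sub>R y) \<partial>lborel) = (\<integral>\<^sup>+y. F y \<partial>lborel)"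
  proof -
    have "(\<integral>\<^sup>+y. F y \<partial>lborel) = (\<integral>\<^sup>+y. F y \<partial>density (distr lborel borel (\<lambda>y. x + r *\<^sub>R y)) (\<lambda>_. \<bar>r\<bar> ^ DIM(real^'n)))"
      using r by (subst lborel_affine[of r x]) auto
    also have "\<dots> = ennreal (r ^ CARD('n)) * (\<integral>\<^sup>+y. F (x + r *\<^sub>R y) \<partial>lborel)"
      using r by (simp add: nn_integral_density nn_integral_distr nn_integral_cmult)
    finally show ?thesis ..
  qed
  finally show ?thesis .
qed

lemma
  fixes f :: "real^'n \<Rightarrow> real"
  assumes f: "f \<in> L2" and r: "r > 0"
  shows cube_slice_integrable: "integrable unit_measure (\<lambda>y. f (x + r *\<^sub>R y))"
    and cube_slice_abs_le: "(LINT y|unit_measure. \<bar>f (x + r *\<^sub>R y)\<bar>) \<le> 1 + (1 / r) ^ CARD('n) * (LINT x|lborel. (f x)\<^sup>2)"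
    and cube_average_square_le: "(cube_average r f x)\<^sup>2 \<le> (1 / r) ^ CARD('n) * (LINT x|lborel. (f x)\<^sup>2)"
proof -
  have [measurable]: "f \<in> borel_measurable borel" using f by (rule L2_measurable)
  have "(\<integral>\<^sup>+y. ennreal ((f (x + r *\<^sub>R y))\<^sup>2) \<partial>unit_measure) \<le>
      ennreal ((1 / r) ^ CARD('n)) * (\<integral>\<^sup>+y. ennreal ((f y)\<^sup>2) \<partial>lborel)"
    using r by (intro nn_integral_unit_measure_le) auto
  also have "\<dots> = ennreal ((1 / r) ^ CARD('n) * (LINT x|lborel. (f x)\<^sup>2))"
    using r L2_integrable_real[OF f] by (subst nn_integral_eq_integral) (auto simp: ennreal_mult)
  finally have *: "(\<integral>\<^sup>+y. ennreal ((f (x + r *\<^sub>R y))\<^sup>2) \<partial>unit_measure) \<le>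
    ennreal ((1 / r) ^ CARD('n) * (LINT x|lborel. (f x)\<^sup>2))" .
  have 1: "integrable unit_measure (\<lambda>y. (f (x + r *\<^sub>R y))\<^sup>2)"
    and 2: "(LINT y|unit_measure. (f (x + r *\<^sub>R y))\<^sup>2) \<le> (1 / r) ^ CARD('n) * (LINT x|lborel. (f x)\<^sup>2)"
    by (rule integrable_if_nn_integral_le[OF _ _ _ *]; use r in simp)+
  show 3: "integrable unit_measure (\<lambda>y. f (x + r *\<^sub>R y))"
    using Cauchy_Schwarz_integral(1)[of "\<lambda>y. f (x + r *\<^sub>R y)" unit_measure "\<lambda>_. 1"] 1 by simp
  have "(LINT y|unit_measure. \<bar>f (x + r *\<^sub>R y)\<bar>) \<le> (LINT y|unit_measure. 1 + (f (x + r *\<^sub>R y))\<^sup>2)"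
  proof (intro integral_mono)
    fix y
    have "0 \<le> (\<bar>f (x + r *\<^sub>R y)\<bar> - 1)\<^sup>2" by simp
    then have "2 * \<bar>f (x + r *\<^sub>R y)\<bar> \<le> 1 + (f (x + r *\<^sub>R y))\<^sup>2" by (simp add: power2_diff)
    then show "\<bar>f (x + r *\<^sub>R y)\<bar> \<le> 1 + (f (x + r *\<^sub>R y))\<^sup>2" by linarith
  qed (use 1 3 in auto)
  then show "(LINT y|unit_measure. \<bar>f (x + r *\<^sub>R y)\<bar>) \<le> 1 + (1 / r) ^ CARD('n) * (LINT x|lborel. (f x)\<^sup>2)"
    using 1 2 by (simp add: unit_measure.prob_space[simplified])
  have "(cube_average r f x)\<^sup>2 \<le> (LINT y|unit_measure. (f (x + r *\<^sub>R y))\<^sup>2)"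
    using Cauchy_Schwarz_integral(2)[of "\<lambda>y. f (x + r *\<^sub>R y)" unit_measure "\<lambda>_. 1"] 1
    by (simp add: cube_average_def unit_measure.prob_space[simplified])
  then show "(cube_average r f x)\<^sup>2 \<le> (1 / r) ^ CARD('n) * (LINT x|lborel. (f x)\<^sup>2)"
    using 2 by linarith
qed

lemma cube_average_diff:
  assumes "f \<in> L2" "h \<in> L2" "r > 0"
  shows "cube_average r (\<lambda>x. f x - h x) x = cube_average r f x - cube_average r h x"
  using cube_slice_integrable[OF assms(1,3)] cube_slice_integrable[OF assms(2,3)]
  by (simp add: cube_average_def)

lemma cube_average_bound:
  assumes f: "f \<in> borel_measurable borel" "\<And>x. \<bar>f x\<bar> \<le> c"
  shows "\<bar>cube_average r f x\<bar> \<le> c"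
proof -
  have [measurable]: "f \<in> borel_measurable borel" by fact
  have i: "integrable unit_measure (\<lambda>y. f (x + r *\<^sub>R y))"
    using f(2) by (intro unit_measure.integrable_const_bound[of _ c]) auto
  have "\<bar>cube_average r f x\<bar> \<le> (LINT y|unit_measure. \<bar>f (x + r *\<^sub>R y)\<bar>)"
    using integral_norm_bound[of unit_measure "\<lambda>y. f (x + r *\<^sub>R y)"] by (simp add: cube_average_def)
  also have "\<dots> \<le> (LINT y|(unit_measure :: (real^'a) measure). c)"
    using i f(2) by (intro integral_mono) auto
  finally show ?thesis by (simp add: unit_measure.prob_space[simplified])
qed

lemma cube_average_commute:
  fixes f :: "real^'n \<Rightarrow> real"
  assumes f: "f \<in> L2" and r: "r > 0" and s: "s > 0"
  shows "cube_average r (cube_average s f) x = cube_average s (cube_average r f) x"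
proof -
  have [measurable]: "f \<in> borel_measurable borel" using f by (rule L2_measurable)
  have pair: "pair_sigma_finite (unit_measure :: (real^'n) measure) (unit_measure :: (real^'n) measure)"
    by (simp add: pair_sigma_finite_def unit_measure.sigma_finite_measure_axioms)
  have "integrable (unit_measure \<Otimes>\<^sub>M unit_measure) (\<lambda>(y, z). f (x + r *\<^sub>R y + s *\<^sub>R z))"
    by (rule integrable_pair_if_slices_bounded[where C = "1 + (1 / s) ^ CARD('n) * (LINT x|lborel. (f x)\<^sup>2)"])
      (use cube_slice_integrable[OF f s] cube_slice_abs_le[OF f s] in
        \<open>auto simp: prob_space_unit_measure unit_measure.sigma_finite_measure_axioms\<close>)
  from pair_sigma_finite.Fubini_integral[OF pair this] show ?thesis
    by (simp add: cube_average_def add_ac)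
qed

lemma cube_average_L2:
  fixes f :: "real^'n \<Rightarrow> real"
  assumes f: "f \<in> L2"
  shows "cube_average r f \<in> L2" "(LINT x|lborel. (cube_average r f x)\<^sup>2) \<le> (LINT x|lborel. (f x)\<^sup>2)"
proof -
  have [measurable]: "f \<in> borel_measurable borel" using f by (rule L2_measurable)
  have "(\<integral>\<^sup>+x. ennreal ((LINT y|unit_measure. (\<lambda>(x, y). f (x + r *\<^sub>R y)) (x, y))\<^sup>2) \<partial>lborel) \<le> ennreal (LINT x|lborel. (f x)\<^sup>2)"
  proof (rule nn_integral_average_square)
    fix y
    have "(\<integral>\<^sup>+x. ennreal ((case (x, y) of (x, y) \<Rightarrow> f (x + r *\<^sub>R y))\<^sup>2) \<partial>lborel) = (\<integral>\<^sup>+x. ennreal ((f x)\<^sup>2) \<partial>lborel)"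
      using nn_integral_shift[of "\<lambda>x. ennreal ((f x)\<^sup>2)" "r *\<^sub>R y"] by simp
    then show "(\<integral>\<^sup>+x. ennreal ((case (x, y) of (x, y) \<Rightarrow> f (x + r *\<^sub>R y))\<^sup>2) \<partial>lborel) \<le> ennreal (LINT x|lborel. (f x)\<^sup>2)"
      using L2_integrable_real[OF f] by (simp add: nn_integral_eq_integral)
  qed (auto simp: prob_space_unit_measure sigma_finite_lborel)
  then have *: "(\<integral>\<^sup>+x. ennreal ((cube_average r f x)\<^sup>2) \<partial>lborel) \<le> ennreal (LINT x|lborel. (f x)\<^sup>2)"
    by (simp add: cube_average_def)
  have "integrable lborel (\<lambda>x. (cube_average r f x)\<^sup>2)"
    and "(LINT x|lborel. (cube_average r f x)\<^sup>2) \<le> (LINT x|lborel. (f x)\<^sup>2)"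
    by (rule integrable_if_nn_integral_le[OF _ _ _ *]; simp)+
  then show "cube_average r f \<in> L2" "(LINT x|lborel. (cube_average r f x)\<^sup>2) \<le> (LINT x|lborel. (f x)\<^sup>2)"
    by (auto simp: L2_def)
qed

lemma cube_average_error:
  fixes u :: "real^'n \<Rightarrow> real"
  assumes u: "u \<in> L2" and g: "weak_gradient u g" and r: "r > 0"
  shows "(LINT x|lborel. (cube_average r u x - u x)\<^sup>2) \<le> r\<^sup>2 * CARD('n) * (LINT x|lborel. (norm (g x))\<^sup>2)"
proof -
  have [measurable]: "u \<in> borel_measurable borel" using u by (rule L2_measurable)
  let ?G = "LINT x|lborel. (norm (g x))\<^sup>2"
  define k where "k = (\<lambda>(x, y :: real^'n). indicator (cbox 0 One) y * (u (x + r *\<^sub>R y) - u x))"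
  have "(\<integral>\<^sup>+x. ennreal ((LINT y|unit_measure. k (x, y))\<^sup>2) \<partial>lborel) \<le> ennreal (r\<^sup>2 * CARD('n) * ?G)"
  proof (rule nn_integral_average_square)
    show "k \<in> borel_measurable (lborel \<Otimes>\<^sub>M unit_measure)" unfolding k_def by measurable
    fix y :: "real^'n"
    show "(\<integral>\<^sup>+x. ennreal ((k (x, y))\<^sup>2) \<partial>lborel) \<le> ennreal (r\<^sup>2 * CARD('n) * ?G)"
    proof (cases "y \<in> cbox 0 One")
      case True
      have "(norm y)\<^sup>2 = (\<Sum>i\<in>UNIV. (y $ i)\<^sup>2)"
        by (simp add: norm_vec_def L2_set_def sum_nonneg)
      also have "\<dots> \<le> (\<Sum>i\<in>(UNIV::'n set). 1)"
      proof (rule sum_mono)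
        fix i
        have "axis i 1 \<in> (Basis :: (real^'n) set)" by (simp add: axis_in_Basis_iff)
        then have "0 \<le> y $ i" "y $ i \<le> 1" using True by (auto simp: mem_box cart_eq_inner_axis)
        then show "(y $ i)\<^sup>2 \<le> 1" by (simp add: power_le_one)
      qed
      finally have y: "(norm y)\<^sup>2 \<le> CARD('n)" by simp
      have L: "(\<lambda>x. u (x + r *\<^sub>R y) - u x) \<in> L2" using u by (intro L2_diff L2_shift)
      have "(\<integral>\<^sup>+x. ennreal ((k (x, y))\<^sup>2) \<partial>lborel) = ennreal (LINT x|lborel. (u (x + r *\<^sub>R y) - u x)\<^sup>2)"
        using True L2_integrable_real[OF L] by (simp add: k_def nn_integral_eq_integral)
      also have "\<dots> \<le> ennreal ((norm (r *\<^sub>R y))\<^sup>2 * ?G)"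
        by (intro ennreal_leI H1_difference_AE(2)[OF u g])
      also have "\<dots> \<le> ennreal (r\<^sup>2 * CARD('n) * ?G)"
        using y by (intro ennreal_leI mult_right_mono) (auto simp: power_mult_distrib intro!: mult_left_mono)
      finally show ?thesis .
    qed (simp add: k_def)
  qed (auto simp: prob_space_unit_measure sigma_finite_lborel)
  moreover have "(LINT y|unit_measure. k (x, y)) = cube_average r u x - u x" for x
  proof -
    have "(LINT y|unit_measure. k (x, y)) = (LINT y|unit_measure. u (x + r *\<^sub>R y) - u x)"
      unfolding k_def using AE_unit_measure[where 'a = "real^'n"]
      by (intro integral_cong_AE) (auto elim: eventually_mono)
    then show ?thesis
      using cube_slice_integrable[OF u r] by (simp add: cube_average_def unit_measure.prob_space[simplified])
  qed
  ultimately have *: "(\<integral>\<^sup>+x. ennreal ((cube_average r u x - u x)\<^sup>2) \<partial>lborel) \<le> ennreal (r\<^sup>2 * CARD('n) * ?G)"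
    by simp
  show ?thesis
    by (rule integrable_if_nn_integral_le(2)[OF _ _ _ *]) auto
qed

lemma L2_bounded_pow4:
  fixes f :: "real^'n \<Rightarrow> real"
  assumes f: "f \<in> L2" and c: "\<And>x. (f x)\<^sup>2 \<le> c"
  shows "integrable lborel (\<lambda>x. (f x)^4)" "(LINT x|lborel. (f x)^4) \<le> c * (LINT x|lborel. (f x)\<^sup>2)"
proof -
  have [measurable]: "f \<in> borel_measurable borel" using f by (rule L2_measurable)
  have le: "(f x)^4 \<le> c * (f x)\<^sup>2" for x
    using mult_right_mono[OF c[of x], of "(f x)\<^sup>2"] by (simp add: power2_eq_square power4_eq_xxxx mult_ac)
  show i: "integrable lborel (\<lambda>x. (f x)^4)"
  proof (rule Bochner_Integration.integrable_bound)
    show "integrable lborel (\<lambda>x. c * (f x)\<^sup>2)" using f by (simp add: L2_integrable_real)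
    show "AE x in lborel. norm ((f x)^4) \<le> norm (c * (f x)\<^sup>2)"
      using le by (auto intro: order_trans[OF _ abs_ge_self])
  qed simp
  show "(LINT x|lborel. (f x)^4) \<le> c * (LINT x|lborel. (f x)\<^sup>2)"
    using integral_mono[OF i _ le] f by (simp add: L2_integrable_real)
qed

lemma pow4_add_le: "(a + b :: real)^4 \<le> 8 * a^4 + 8 * b^4"
proof -
  have "(a + b)\<^sup>2 \<le> 2 * a\<^sup>2 + 2 * b\<^sup>2"
    using zero_le_power2[of "a - b"] by (simp add: power2_eq_square algebra_simps)
  then have "((a + b)\<^sup>2)\<^sup>2 \<le> (2 * a\<^sup>2 + 2 * b\<^sup>2)\<^sup>2" by (intro power_mono) auto
  also have "\<dots> \<le> 8 * (a\<^sup>2)\<^sup>2 + 8 * (b\<^sup>2)\<^sup>2"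
    using zero_le_power2[of "a\<^sup>2 - b\<^sup>2"] by (simp add: power2_eq_square algebra_simps)
  finally show ?thesis by (simp flip: power_mult)
qed

lemma pow4_add_le_weighted: "(a + b :: real)^4 \<le> 729 * a^4 + 3/2 * b^4"
proof -
  have "(a + b)\<^sup>2 \<le> 9 * a\<^sup>2 + 9/8 * b\<^sup>2"
    using zero_le_power2[of "8 * a - b"] by (simp add: power2_eq_square algebra_simps)
  then have "((a + b)\<^sup>2)\<^sup>2 \<le> (9 * a\<^sup>2 + 9/8 * b\<^sup>2)\<^sup>2" by (intro power_mono) auto
  also have "\<dots> \<le> 729 * (a\<^sup>2)\<^sup>2 + 729/512 * (b\<^sup>2)\<^sup>2"
    using zero_le_power2[of "64 * a\<^sup>2 - b\<^sup>2"] by (simp add: power2_eq_square algebra_simps)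
  also have "\<dots> \<le> 729 * (a\<^sup>2)\<^sup>2 + 3/2 * (b\<^sup>2)\<^sup>2" by simp
  finally show ?thesis by (simp flip: power_mult)
qed

lemma integrable_pow4_add:
  fixes f h :: "'a \<Rightarrow> real"
  assumes [measurable]: "f \<in> borel_measurable M" "h \<in> borel_measurable M"
    and "integrable M (\<lambda>x. (f x)^4)" "integrable M (\<lambda>x. (h x)^4)"
  shows "integrable M (\<lambda>x. (f x + h x)^4)"
proof (rule Bochner_Integration.integrable_bound)
  show "integrable M (\<lambda>x. 8 * (f x)^4 + 8 * (h x)^4)" using assms by auto
  show "AE x in M. norm ((f x + h x)^4) \<le> norm (8 * (f x)^4 + 8 * (h x)^4)"
    using pow4_add_le by (auto intro: order_trans[OF _ abs_ge_self])
qed simp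

definition smooth_average :: "nat \<Rightarrow> (real^'n \<Rightarrow> real) \<Rightarrow> real^'n \<Rightarrow> real" where
  "smooth_average k f = cube_average ((1/2)^k) (cube_average ((1/2)^k) f)"

lemma smooth_average_L2:
  fixes f :: "real^'n \<Rightarrow> real"
  assumes "f \<in> L2"
  shows "smooth_average k f \<in> L2" "(LINT x|lborel. (smooth_average k f x)\<^sup>2) \<le> (LINT x|lborel. (f x)\<^sup>2)"
  unfolding smooth_average_def
  using cube_average_L2(1)[OF cube_average_L2(1)[OF assms]]
    order_trans[OF cube_average_L2(2)[OF cube_average_L2(1)[OF assms]] cube_average_L2(2)[OF assms]]
  by auto

lemma smooth_average_pow4:
  fixes f :: "real^'n \<Rightarrow> real"
  assumes f: "f \<in> L2" and c: "\<And>x. \<bar>cube_average ((1/2)^k) f x\<bar> \<le> c"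
  shows "integrable lborel (\<lambda>x. (smooth_average k f x)^4)"
    "(LINT x|lborel. (smooth_average k f x)^4) \<le> c\<^sup>2 * (LINT x|lborel. (f x)\<^sup>2)"
proof -
  have b: "(smooth_average k f x)\<^sup>2 \<le> c\<^sup>2" for x
    using cube_average_bound[OF L2_measurable[OF cube_average_L2(1)[OF f]] c]
    unfolding smooth_average_def by (simp add: abs_le_square_iff[symmetric] order_trans[OF _ abs_ge_self])
  show "integrable lborel (\<lambda>x. (smooth_average k f x)^4)"
    by (rule L2_bounded_pow4[OF smooth_average_L2(1)[OF f] b])
  have "(LINT x|lborel. (smooth_average k f x)^4) \<le> c\<^sup>2 * (LINT x|lborel. (smooth_average k f x)\<^sup>2)"
    by (rule L2_bounded_pow4[OF smooth_average_L2(1)[OF f] b])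
  also have "\<dots> \<le> c\<^sup>2 * (LINT x|lborel. (f x)\<^sup>2)"
    by (intro mult_left_mono smooth_average_L2 f) auto
  finally show "(LINT x|lborel. (smooth_average k f x)^4) \<le> c\<^sup>2 * (LINT x|lborel. (f x)\<^sup>2)" .
qed

lemma smooth_average_pow4_integrable:
  fixes f :: "real^'n \<Rightarrow> real"
  assumes f: "f \<in> L2"
  shows "integrable lborel (\<lambda>x. (smooth_average k f x)^4)"
proof (rule smooth_average_pow4(1)[OF f])
  fix x
  have "(cube_average ((1/2)^k) f x)\<^sup>2 \<le> (1 / (1/2)^k) ^ CARD('n) * (LINT x|lborel. (f x)\<^sup>2)"
    by (rule cube_average_square_le[OF f]) simp
  then show "\<bar>cube_average ((1/2)^k) f x\<bar> \<le> sqrt ((1 / (1/2)^k) ^ CARD('n) * (LINT x|lborel. (f x)\<^sup>2))"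
    by (simp add: real_le_rsqrt)
qed

section \<open>The Sobolev inequality\<close>

lemma square_add_le: "(a + b :: real)\<^sup>2 \<le> 2 * a\<^sup>2 + 2 * b\<^sup>2"
  using zero_le_power2[of "a - b"] by (simp add: power2_eq_square algebra_simps)

lemma integral_square_add_le:
  fixes f h :: "real^'n \<Rightarrow> real"
  assumes "f \<in> L2" "h \<in> L2"
  shows "(LINT x|lborel. (f x + h x)\<^sup>2) \<le> 2 * (LINT x|lborel. (f x)\<^sup>2) + 2 * (LINT x|lborel. (h x)\<^sup>2)"
proof -
  have "(LINT x|lborel. (f x + h x)\<^sup>2) \<le> (LINT x|lborel. 2 * (f x)\<^sup>2 + 2 * (h x)\<^sup>2)"
    using assms
    by (intro integral_mono square_add_le Bochner_Integration.integrable_add integrable_mult_right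
        L2_integrable_real L2_add)
  then show ?thesis using assms by (simp add: L2_integrable_real)
qed

lemma integral_square_diff_le:
  fixes f h :: "real^'n \<Rightarrow> real"
  assumes "f \<in> L2" "h \<in> L2"
  shows "(LINT x|lborel. (f x - h x)\<^sup>2) \<le> 2 * (LINT x|lborel. (f x)\<^sup>2) + 2 * (LINT x|lborel. (h x)\<^sup>2)"
  using integral_square_add_le[OF assms(1) L2_cmult[OF assms(2), of "-1"]] by simp

definition step_const :: "'n::finite itself \<Rightarrow> real" where
  "step_const _ = 256 * (real CARD('n))\<^sup>2 * 2 ^ CARD('n)"

text \<open>
  Commuting the averages turns the increment into an average of the \<open>L\<^sup>2\<close>-small function \<open>w\<close>,
  which is also small in the supremum norm. The dimension restriction enters through
  \<open>r\<^sup>-\<^sup>N r\<^sup>4 \<le> r\<close>.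
\<close>
lemma smooth_average_step:
  fixes u :: "real^'n \<Rightarrow> real"
  assumes N: "CARD('n) \<le> 3" and u: "u \<in> L2" and g: "weak_gradient u g"
  shows "(LINT x|lborel. (smooth_average (Suc k) u x - smooth_average k u x)^4)
    \<le> step_const TYPE('n) * (1/2)^k * (LINT x|lborel. (norm (g x))\<^sup>2)\<^sup>2"
proof -
  let ?G = "LINT x|lborel. (norm (g x))\<^sup>2" and ?N = "CARD('n)"
  define r :: real where "r = (1/2)^k"
  have r: "0 < r" "r \<le> 1" "0 < r / 2" by (auto simp: r_def power_le_one)
  have G: "0 \<le> ?G" by simp
  define A where "A = cube_average r u"
  define A' where "A' = cube_average (r / 2) u"
  define w where "w x = A' x - A x" for x
  define W where "W = 4 * r\<^sup>2 * ?N * ?G"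
  have A: "A \<in> L2" "A' \<in> L2" using u by (auto simp: A_def A'_def cube_average_L2)
  have w: "w \<in> L2" unfolding w_def using A by (intro L2_diff)
  have wW: "(LINT x|lborel. (w x)\<^sup>2) \<le> W"
  proof -
    have "(LINT x|lborel. (w x)\<^sup>2) = (LINT x|lborel. ((A' x - u x) - (A x - u x))\<^sup>2)" by (simp add: w_def)
    also have "\<dots> \<le> 2 * (LINT x|lborel. (A' x - u x)\<^sup>2) + 2 * (LINT x|lborel. (A x - u x)\<^sup>2)"
      using A u by (intro integral_square_diff_le L2_diff)
    also have "\<dots> \<le> 2 * ((r/2)\<^sup>2 * ?N * ?G) + 2 * (r\<^sup>2 * ?N * ?G)"
      using cube_average_error[OF u g r(3)] cube_average_error[OF u g r(1)]
      by (intro add_mono mult_left_mono) (auto simp: A_def A'_def)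
    also have "\<dots> = 5/2 * (r\<^sup>2 * ?N * ?G)" by (simp add: power_divide)
    also have "\<dots> \<le> 4 * (r\<^sup>2 * ?N * ?G)" using G by (intro mult_right_mono) auto
    finally show ?thesis by (simp add: W_def mult_ac)
  qed
  have W0: "0 \<le> W" using G by (simp add: W_def)
  let ?a = "cube_average (r/2) w" and ?b = "cube_average r w"
  have D: "smooth_average (Suc k) u x - smooth_average k u x = ?a x + ?b x" for x
  proof -
    have "?a x = cube_average (r/2) A' x - cube_average (r/2) A x"
      unfolding w_def using A r by (intro cube_average_diff)
    moreover have "?b x = cube_average r A' x - cube_average r A x"
      unfolding w_def using A r by (intro cube_average_diff)
    moreover have "cube_average r A' x = cube_average (r/2) A x"
      unfolding A_def A'_def using u r by (intro cube_average_commute)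
    ultimately show ?thesis by (simp add: smooth_average_def A_def A'_def r_def)
  qed
  have ab: "?a \<in> L2" "?b \<in> L2" using w by (auto intro: cube_average_L2)
  have sup: "(?a x + ?b x)\<^sup>2 \<le> 4 * (2 / r)^?N * W" for x
  proof -
    have "(?a x)\<^sup>2 \<le> (2 / r)^?N * W"
      using cube_average_square_le[OF w r(3), of x] r wW by (auto elim!: order_trans intro!: mult_left_mono)
    moreover have "(?b x)\<^sup>2 \<le> (2 / r)^?N * W"
    proof -
      have "(?b x)\<^sup>2 \<le> (1 / r)^?N * (LINT x|lborel. (w x)\<^sup>2)" by (rule cube_average_square_le[OF w r(1)])
      also have "\<dots> \<le> (2 / r)^?N * W"
        using r wW by (intro mult_mono power_mono) (auto simp: divide_right_mono)
      finally show ?thesis .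
    qed
    ultimately show ?thesis using square_add_le[of "?a x" "?b x"] by simp
  qed
  have i2: "(LINT x|lborel. (?a x + ?b x)\<^sup>2) \<le> 4 * W"
    using integral_square_add_le[OF ab] cube_average_L2(2)[OF w, of "r/2"] cube_average_L2(2)[OF w, of r] wW
    by linarith
  have "(LINT x|lborel. (?a x + ?b x)^4) \<le> 4 * (2 / r)^?N * W * (LINT x|lborel. (?a x + ?b x)\<^sup>2)"
    by (rule L2_bounded_pow4(2)[OF L2_add[OF ab] sup])
  also have "\<dots> \<le> 4 * (2 / r)^?N * W * (4 * W)"
    using i2 W0 r by (intro mult_left_mono) auto
  also have "\<dots> = step_const TYPE('n) * ((1 / r)^?N * r^4) * ?G\<^sup>2"
    by (simp add: W_def step_const_def power2_eq_square power4_eq_xxxx power_divide)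
  also have "\<dots> \<le> step_const TYPE('n) * r * ?G\<^sup>2"
  proof (intro mult_right_mono mult_left_mono)
    have "r^4 = r^?N * r^(4 - ?N)" using N by (simp flip: power_add)
    then have "(1 / r)^?N * r^4 = r^(4 - ?N)" using r by (simp add: power_divide)
    also have "\<dots> \<le> r^1" using r N by (intro power_decreasing) auto
    finally show "(1 / r)^?N * r^4 \<le> r" by simp
  qed (auto simp: step_const_def)
  finally show ?thesis by (simp add: D r_def)
qed

lemma smooth_average_diff:
  fixes u :: "real^'n \<Rightarrow> real"
  assumes N: "CARD('n) \<le> 3" and u: "u \<in> L2" and g: "weak_gradient u g" and "k \<le> m"
  shows "(LINT x|lborel. (smooth_average m u x - smooth_average k u x)^4)
    \<le> 2916 * step_const TYPE('n) * (1/2)^k * (LINT x|lborel. (norm (g x))\<^sup>2)\<^sup>2"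
  using \<open>k \<le> m\<close>
proof (induction k rule: inc_induct)
  case base
  then show ?case by (simp add: step_const_def)
next
  case (step k)
  let ?S = "\<lambda>k. smooth_average k u" and ?c = "step_const TYPE('n)" and ?G = "LINT x|lborel. (norm (g x))\<^sup>2"
  have [measurable]: "?S k \<in> borel_measurable borel" for k
    using smooth_average_L2(1)[OF u] by (rule L2_measurable)
  have i: "integrable lborel (\<lambda>x. (?S i x - ?S j x)^4)" for i j
    using integrable_pow4_add[of "?S i" lborel "\<lambda>x. - ?S j x"] smooth_average_pow4_integrable[OF u] by simp
  have "(LINT x|lborel. (?S m x - ?S k x)^4) =
      (LINT x|lborel. ((?S (Suc k) x - ?S k x) + (?S m x - ?S (Suc k) x))^4)" by simp
  also have "\<dots> \<le> (LINT x|lborel. 729 * (?S (Suc k) x - ?S k x)^4 + 3/2 * (?S m x - ?S (Suc k) x)^4)"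
    using i[of m k] i[of "Suc k" k] i[of m "Suc k"] by (intro integral_mono pow4_add_le_weighted) auto
  also have "\<dots> = 729 * (LINT x|lborel. (?S (Suc k) x - ?S k x)^4) + 3/2 * (LINT x|lborel. (?S m x - ?S (Suc k) x)^4)"
    using i by simp
  also have "\<dots> \<le> 729 * (?c * (1/2)^k * ?G\<^sup>2) + 3/2 * (2916 * ?c * (1/2)^Suc k * ?G\<^sup>2)"
    by (intro add_mono mult_left_mono smooth_average_step[OF N u g] step.IH) auto
  also have "\<dots> = 2916 * ?c * (1/2)^k * ?G\<^sup>2" by simp
  finally show ?case .
qed

lemma smooth_average_tendsto:
  fixes u :: "real^'n \<Rightarrow> real"
  assumes u: "u \<in> L2" and g: "weak_gradient u g"
  shows "(\<lambda>k. LINT x|lborel. (smooth_average k u x - u x)\<^sup>2) \<longlonglongrightarrow> 0"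
proof (rule tendsto_sandwich[of "\<lambda>_. 0", OF _ _ tendsto_const])
  let ?G = "LINT x|lborel. (norm (g x))\<^sup>2"
  have "(LINT x|lborel. (smooth_average k u x - u x)\<^sup>2) \<le> (1/2)^k * (4 * CARD('n) * ?G)" for k
  proof -
    define r :: real where "r = (1/2)^k"
    have r: "0 < r" "r \<le> 1" by (auto simp: r_def power_le_one)
    let ?A = "cube_average r u"
    have A: "?A \<in> L2" using u by (rule cube_average_L2)
    have e: "(\<lambda>x. ?A x - u x) \<in> L2" using A u by (rule L2_diff)
    have "(LINT x|lborel. (smooth_average k u x - u x)\<^sup>2) =
        (LINT x|lborel. (cube_average r (\<lambda>x. ?A x - u x) x + (?A x - u x))\<^sup>2)"
      using cube_average_diff[OF A u r(1)] by (simp add: smooth_average_def r_def)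
    also have "\<dots> \<le> 2 * (LINT x|lborel. (cube_average r (\<lambda>x. ?A x - u x) x)\<^sup>2) + 2 * (LINT x|lborel. (?A x - u x)\<^sup>2)"
      by (intro integral_square_add_le cube_average_L2 e)
    also have "\<dots> \<le> 4 * (LINT x|lborel. (?A x - u x)\<^sup>2)"
      using cube_average_L2(2)[OF e, of r] by simp
    also have "\<dots> \<le> 4 * (r\<^sup>2 * CARD('n) * ?G)"
      by (intro mult_left_mono cube_average_error u g r) auto
    also have "\<dots> \<le> 4 * (r * CARD('n) * ?G)"
      using r by (intro mult_left_mono mult_right_mono) (auto simp: power2_eq_square mult_left_le)
    finally show ?thesis by (simp add: r_def mult_ac)
  qed
  then show "\<forall>\<^sub>F k in sequentially. (LINT x|lborel. (smooth_average k u x - u x)\<^sup>2) \<le> (1/2)^k * (4 * CARD('n) * ?G)"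
    by simp
  have "(\<lambda>k. (1/2)^k * (4 * CARD('n) * ?G)) \<longlonglongrightarrow> 0 * (4 * CARD('n) * ?G)"
    by (intro tendsto_intros LIMSEQ_power_zero) auto
  then show "(\<lambda>k. (1/2)^k * (4 * CARD('n) * ?G)) \<longlonglongrightarrow> 0" by simp
qed simp

lemma smooth_average_error:
  fixes u :: "real^'n \<Rightarrow> real"
  assumes N: "CARD('n) \<le> 3" and u: "u \<in> L2" and g: "weak_gradient u g"
  shows "integrable lborel (\<lambda>x. (u x - smooth_average k u x)^4)"
    and "(LINT x|lborel. (u x - smooth_average k u x)^4)
      \<le> 2916 * step_const TYPE('n) * (1/2)^k * (LINT x|lborel. (norm (g x))\<^sup>2)\<^sup>2" (is "_ \<le> ?B")
proof -
  let ?S = "\<lambda>k. smooth_average k u"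
  have SL: "?S k \<in> L2" for k by (rule smooth_average_L2(1)[OF u])
  have [measurable]: "?S k \<in> borel_measurable borel" "u \<in> borel_measurable borel" for k
    using SL u by (auto intro: L2_measurable)
  have i: "integrable lborel (\<lambda>x. (?S i x - ?S j x)^4)" for i j
    using integrable_pow4_add[of "?S i" lborel "\<lambda>x. - ?S j x"] smooth_average_pow4_integrable[OF u] by simp
  obtain r where r: "strict_mono r" and ae: "AE x in lborel. (\<lambda>n. (?S (r n) x - u x)\<^sup>2) \<longlonglongrightarrow> 0"
    using tendsto_L1_AE_subseq[of lborel "\<lambda>n x. (?S n x - u x)\<^sup>2"] smooth_average_tendsto[OF u g]
      L2_integrable_real[OF L2_diff[OF SL u]]
    by (auto simp: real_norm_def)
  have ae': "AE x in lborel. (\<lambda>n. ennreal ((?S (r n) x - ?S k x)^4)) \<longlonglongrightarrow> ennreal ((u x - ?S k x)^4)"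
    using ae
  proof eventually_elim
    case (elim x)
    have "(\<lambda>n. sqrt ((?S (r n) x - u x)\<^sup>2)) \<longlonglongrightarrow> sqrt 0" by (intro tendsto_intros elim)
    then have "(\<lambda>n. ?S (r n) x - u x) \<longlonglongrightarrow> 0" by (simp add: tendsto_rabs_zero_iff)
    then have "(\<lambda>n. ?S (r n) x) \<longlonglongrightarrow> u x" by (simp add: LIM_zero_iff)
    then show ?case by (intro tendsto_intros)
  qed
  have B0: "0 \<le> ?B" by (simp add: step_const_def)
  have "(\<integral>\<^sup>+x. ennreal ((u x - ?S k x)^4) \<partial>lborel) = (\<integral>\<^sup>+x. liminf (\<lambda>n. ennreal ((?S (r n) x - ?S k x)^4)) \<partial>lborel)"
  proof (rule nn_integral_cong_AE, use ae' in eventually_elim)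
    case (elim x)
    then show ?case by (intro lim_imp_Liminf[symmetric]) auto
  qed
  also have "\<dots> \<le> liminf (\<lambda>n. \<integral>\<^sup>+x. ennreal ((?S (r n) x - ?S k x)^4) \<partial>lborel)"
    by (intro nn_integral_liminf) simp
  also have "\<dots> \<le> ennreal ?B"
  proof (rule Liminf_le)
    show "\<forall>\<^sub>F n in sequentially. (\<integral>\<^sup>+x. ennreal ((?S (r n) x - ?S k x)^4) \<partial>lborel) \<le> ennreal ?B"
      using eventually_ge_at_top[of k]
    proof eventually_elim
      case (elim n)
      then have "k \<le> r n" using seq_suble[OF r, of n] by simp
      then show ?case
        using i smooth_average_diff[OF N u g] by (subst nn_integral_eq_integral) (auto intro: ennreal_leI)
    qed
  qed simp
  finally have *: "(\<integral>\<^sup>+x. ennreal ((u x - ?S k x)^4) \<partial>lborel) \<le> ennreal ?B" .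
  show "integrable lborel (\<lambda>x. (u x - smooth_average k u x)^4)"
    and "(LINT x|lborel. (u x - smooth_average k u x)^4) \<le> ?B"
    by (rule integrable_if_nn_integral_le[OF _ _ B0 *]; simp)+
qed

definition sobolev_const :: "'n::finite itself \<Rightarrow> real" where
  "sobolev_const t = 8 + 8 * 2916 * step_const t"

lemma sobolev_const_pos: "sobolev_const t > 0"
  by (simp add: sobolev_const_def step_const_def add_pos_nonneg)

lemma H1_pow4:
  fixes u :: "real^'n \<Rightarrow> real"
  assumes N: "CARD('n) \<le> 3" and u: "u \<in> L2" and g: "weak_gradient u g"
    and c: "\<And>x. \<bar>cube_average ((1/2)^k) u x\<bar> \<le> c"
  shows "integrable lborel (\<lambda>x. (u x)^4)"
    and "(LINT x|lborel. (u x)^4) \<le> 8 * c\<^sup>2 * (LINT x|lborel. (u x)\<^sup>2)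
      + sobolev_const TYPE('n) * (1/2)^k * (LINT x|lborel. (norm (g x))\<^sup>2)\<^sup>2"
proof -
  let ?S = "smooth_average k u" and ?G = "LINT x|lborel. (norm (g x))\<^sup>2"
  have [measurable]: "?S \<in> borel_measurable borel" "u \<in> borel_measurable borel"
    using smooth_average_L2(1)[OF u] u by (auto intro: L2_measurable)
  note S = smooth_average_pow4[OF u c] and e = smooth_average_error[OF N u g, of k]
  show i: "integrable lborel (\<lambda>x. (u x)^4)"
    using integrable_pow4_add[of ?S lborel "\<lambda>x. u x - ?S x"] S(1) e(1) by simp
  have "(LINT x|lborel. (u x)^4) \<le> (LINT x|lborel. 8 * (?S x)^4 + 8 * (u x - ?S x)^4)"
    using i S(1) e(1) pow4_add_le[of "?S x" "u x - ?S x" for x] by (intro integral_mono) auto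
  also have "\<dots> = 8 * (LINT x|lborel. (?S x)^4) + 8 * (LINT x|lborel. (u x - ?S x)^4)"
    using S(1) e(1) by simp
  also have "\<dots> \<le> 8 * (c\<^sup>2 * (LINT x|lborel. (u x)\<^sup>2)) + 8 * (2916 * step_const TYPE('n) * (1/2)^k * ?G\<^sup>2)"
    by (intro add_mono mult_left_mono S e) auto
  also have "\<dots> \<le> 8 * c\<^sup>2 * (LINT x|lborel. (u x)\<^sup>2) + sobolev_const TYPE('n) * (1/2)^k * ?G\<^sup>2"
    by (simp add: sobolev_const_def algebra_simps)
  finally show "(LINT x|lborel. (u x)^4) \<le> 8 * c\<^sup>2 * (LINT x|lborel. (u x)\<^sup>2)
      + sobolev_const TYPE('n) * (1/2)^k * ?G\<^sup>2" .
qed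

lemma H1_sobolev:
  fixes u :: "real^'n \<Rightarrow> real"
  assumes N: "CARD('n) \<le> 3" and u: "u \<in> L2" and g: "weak_gradient u g"
  shows "integrable lborel (\<lambda>x. (u x)^4)"
    and "(LINT x|lborel. (u x)^4) \<le> 
      sobolev_const TYPE('n) * ((LINT x|lborel. (u x)\<^sup>2) + (LINT x|lborel. (norm (g x))\<^sup>2))\<^sup>2"
proof -
  let ?G = "LINT x|lborel. (norm (g x))\<^sup>2" and ?U = "LINT x|lborel. (u x)\<^sup>2"
  have c: "\<bar>cube_average ((1/2)^0) u x\<bar> \<le> sqrt ?U" for x
    using cube_average_square_le[OF u, of 1 x] by (simp add: real_le_rsqrt)
  note * = H1_pow4[OF N u g c]
  show "integrable lborel (\<lambda>x. (u x)^4)" by (rule *)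
  have 0: "0 \<le> ?G" "0 \<le> ?U" by auto
  have "(LINT x|lborel. (u x)^4) \<le> 8 * ?U\<^sup>2 + sobolev_const TYPE('n) * ?G\<^sup>2"
    using *(2) by (simp add: power2_eq_square)
  also have "\<dots> \<le> sobolev_const TYPE('n) * ?U\<^sup>2 + sobolev_const TYPE('n) * ?G\<^sup>2"
    by (intro add_mono mult_right_mono) (auto simp: sobolev_const_def step_const_def)
  also have "\<dots> = sobolev_const TYPE('n) * (?U\<^sup>2 + ?G\<^sup>2)" by (simp add: algebra_simps)
  also have "\<dots> \<le> sobolev_const TYPE('n) * (?U + ?G)\<^sup>2"
    using 0 sobolev_const_pos[of "TYPE('n)"] by (intro mult_left_mono) (auto simp: power2_sum)
  finally show "(LINT x|lborel. (u x)^4) \<le> sobolev_const TYPE('n) * (?U + ?G)\<^sup>2" .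
qed

section \<open>Weak sequential compactness\<close>

lemma tendsto_if_subseq_limits:
  fixes x :: "nat \<Rightarrow> real"
  assumes bd: "\<And>n. \<bar>x n\<bar> \<le> K"
    and sub: "\<And>s l. strict_mono s \<Longrightarrow> (x \<circ> s) \<longlonglongrightarrow> l \<Longrightarrow> l = L"
  shows "x \<longlonglongrightarrow> L"
proof (rule ccontr)
  assume "\<not> x \<longlonglongrightarrow> L"
  then obtain e where e: "e > 0" "\<And>N. \<exists>n\<ge>N. \<not> dist (x n) L < e"
    unfolding lim_sequentially by auto
  then have "infinite {n. \<not> dist (x n) L < e}"
    by (auto simp: infinite_nat_iff_unbounded_le)
  from infinite_enumerate[OF this] obtain s :: "nat \<Rightarrow> nat"
    where s: "strict_mono s" "\<And>n. \<not> dist (x (s n)) L < e" by auto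
  have "bounded (range (x \<circ> s))" using bd by (auto simp: bounded_iff)
  then obtain l t where t: "strict_mono t" "((x \<circ> s) \<circ> t) \<longlonglongrightarrow> l"
    using bounded_imp_convergent_subsequence by blast
  have "l = L" using sub[OF strict_mono_o[OF s(1) t(1)]] t(2) by (simp add: o_assoc)
  then have "\<forall>\<^sub>F n in sequentially. dist (((x \<circ> s) \<circ> t) n) L < e"
    using tendstoD[OF t(2) e(1)] by simp
  then show False using s(2) by (auto simp: eventually_sequentially)
qed

text \<open>Elements of almost minimal norm in the convex hulls of the tails form a Cauchy sequence.\<close>
lemma weak_limit_candidate:
  fixes w :: "nat \<Rightarrow> 'a::{real_inner, complete_space}"
  assumes K: "\<And>n. norm (w n) \<le> K"
  shows "\<exists>v. \<forall>h l. (\<lambda>n. w n \<bullet> h) \<longlonglongrightarrow> l \<longrightarrow> v \<bullet> h = l"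
proof -
  define C where "C k = convex hull (w ` {k..})" for k
  define d where "d k = Inf (norm ` C k)" for k
  have ne: "C k \<noteq> {}" for k by (auto simp: C_def)
  have wC: "w k \<in> C k" for k by (auto simp: C_def intro: hull_inc)
  have bdd: "bdd_below (norm ` C k)" for k by (intro bdd_belowI[of _ 0]) auto
  have mono: "C j \<subseteq> C k" if "k \<le> j" for j k unfolding C_def using that by (intro hull_mono) auto
  have d_le: "d k \<le> norm x" if "x \<in> C k" for k x
    unfolding d_def using that bdd by (intro cInf_lower) auto
  have d0: "0 \<le> d k" for k unfolding d_def using ne by (intro cInf_greatest) auto
  have "incseq d"
  proof (rule incseq_SucI)
    fix k show "d k \<le> d (Suc k)"
      unfolding d_def[of "Suc k"] using ne mono[of k "Suc k"] by (intro cInf_greatest) (auto intro!: d_le)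
  qed
  moreover have "d k \<le> K" for k using d_le[OF wC] K order_trans by blast
  ultimately obtain D where D: "d \<longlonglongrightarrow> D" using incseq_convergent[of d K] by blast
  have "\<exists>x\<in>C k. norm x < d k + inverse (real (Suc k))" for k
  proof -
    have "Inf (norm ` C k) < d k + inverse (real (Suc k))" by (simp add: d_def)
    then show ?thesis using ne bdd by (subst (asm) cInf_less_iff) auto
  qed
  then obtain v where v: "\<And>k. v k \<in> C k" "\<And>k. norm (v k) < d k + inverse (real (Suc k))" by metis
  define a where "a k = (d k + inverse (real (Suc k)))\<^sup>2" for k
  have "a \<longlonglongrightarrow> (D + 0)\<^sup>2"
    unfolding a_def by (intro tendsto_intros D LIMSEQ_inverse_real_of_nat)
  then have a: "a \<longlonglongrightarrow> D\<^sup>2" by simp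
  have d2: "(\<lambda>k. (d k)\<^sup>2) \<longlonglongrightarrow> D\<^sup>2" by (intro tendsto_intros D)
  have diff: "(norm (v k - v j))\<^sup>2 \<le> 2 * a j + 2 * a k - 4 * (d k)\<^sup>2" if "k \<le> j" for j k
  proof -
    have "(1/2) *\<^sub>R v k + (1/2) *\<^sub>R v j \<in> C k"
      using v(1)[of k] v(1)[of j] mono[OF that] by (intro convexD) (auto simp: C_def)
    then have "d k \<le> norm ((1/2) *\<^sub>R v k + (1/2) *\<^sub>R v j)" by (rule d_le)
    also have "\<dots> = norm (v k + v j) / 2" by (simp flip: scaleR_add_right)
    finally have "(2 * d k)\<^sup>2 \<le> (norm (v k + v j))\<^sup>2" using d0 by (intro power_mono) auto
    moreover have "(norm (v i))\<^sup>2 \<le> a i" for i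
      unfolding a_def using v(2)[of i] by (intro power_mono) auto
    from this[of j] this[of k]
    have "2 * (norm (v j))\<^sup>2 + 2 * (norm (v k))\<^sup>2 \<le> 2 * a j + 2 * a k" by simp
    moreover have "(norm (v k - v j))\<^sup>2 + (norm (v k + v j))\<^sup>2 = 2 * (norm (v j))\<^sup>2 + 2 * (norm (v k))\<^sup>2"
      by (simp add: power2_norm_eq_inner inner_diff inner_add inner_commute)
    ultimately show ?thesis by (simp add: power_mult_distrib)
  qed
  have "Cauchy v"
  proof (rule CauchyI')
    fix e :: real assume "e > 0"
    then have e: "e\<^sup>2 / 9 > 0" by simp
    obtain M where M: "\<And>k. k \<ge> M \<Longrightarrow> \<bar>a k - D\<^sup>2\<bar> < e\<^sup>2 / 9" "\<And>k. k \<ge> M \<Longrightarrow> \<bar>(d k)\<^sup>2 - D\<^sup>2\<bar> < e\<^sup>2 / 9"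
    proof -
      have "\<forall>\<^sub>F k in sequentially. \<bar>a k - D\<^sup>2\<bar> < e\<^sup>2 / 9 \<and> \<bar>(d k)\<^sup>2 - D\<^sup>2\<bar> < e\<^sup>2 / 9"
        using tendstoD[OF a e] tendstoD[OF d2 e] by eventually_elim (auto simp: dist_real_def)
      then show ?thesis using that by (auto simp: eventually_sequentially)
    qed
    have "dist (v m) (v n) < e" if "M \<le> m" "m < n" for m n
    proof -
      have "\<bar>a m - D\<^sup>2\<bar> < e\<^sup>2 / 9" "\<bar>a n - D\<^sup>2\<bar> < e\<^sup>2 / 9" "\<bar>(d m)\<^sup>2 - D\<^sup>2\<bar> < e\<^sup>2 / 9"
        using M that by auto
      then have "(norm (v m - v n))\<^sup>2 < e\<^sup>2"
        using diff[OF less_imp_le[OF that(2)]] e by linarith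
      then show ?thesis using \<open>e > 0\<close> by (simp add: dist_norm power2_less_imp_less)
    qed
    then show "\<exists>M. \<forall>m\<ge>M. \<forall>n>m. dist (v m) (v n) < e" by blast
  qed
  then obtain z where z: "v \<longlonglongrightarrow> z" using Cauchy_convergent convergent_def by blast
  show ?thesis
  proof (intro exI[of _ z] allI impI)
    fix h l assume l: "(\<lambda>n. w n \<bullet> h) \<longlonglongrightarrow> l"
    have vz: "(\<lambda>n. v n \<bullet> h) \<longlonglongrightarrow> z \<bullet> h" by (intro tendsto_intros z)
    have "(\<lambda>n. v n \<bullet> h) \<longlonglongrightarrow> l"
    proof (rule LIMSEQ_I)
      fix e :: real assume "e > 0"
      then obtain M where M: "\<And>n. n \<ge> M \<Longrightarrow> \<bar>w n \<bullet> h - l\<bar> < e"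
        using LIMSEQ_D[OF l] by auto
      have "convex {x. \<bar>x \<bullet> h - l\<bar> < e}"
      proof -
        have "{x. \<bar>x \<bullet> h - l\<bar> < e} = {x. h \<bullet> x < l + e} \<inter> {x. h \<bullet> x > l - e}"
          by (auto simp: inner_commute abs_less_iff)
        then show ?thesis by (simp add: convex_Int convex_halfspace_lt convex_halfspace_gt)
      qed
      then have "C n \<subseteq> {x. \<bar>x \<bullet> h - l\<bar> < e}" if "n \<ge> M" for n
        unfolding C_def using M that by (intro hull_minimal) auto
      then show "\<exists>M. \<forall>n\<ge>M. norm (v n \<bullet> h - l) < e" using v(1) by auto
    qed
    then show "z \<bullet> h = l" using vz LIMSEQ_unique by blast
  qed
qed

theorem bounded_weakly_convergent_subsequence:
  fixes u :: "nat \<Rightarrow> 'a::{real_inner, complete_space}"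
  assumes K: "\<And>n. norm (u n) \<le> K"
  shows "\<exists>r v. strict_mono r \<and> (\<forall>h. (\<lambda>n. u (r n) \<bullet> h) \<longlonglongrightarrow> v \<bullet> h)"
proof -
  have bd: "\<bar>u n \<bullet> h\<bar> \<le> K * norm h" for n h
    using Cauchy_Schwarz_ineq2[of "u n" h] mult_right_mono[OF K[of n], of "norm h"] by simp
  interpret subseqs "\<lambda>m s. convergent (\<lambda>n. u (s n) \<bullet> u m)"
  proof
    fix m and s :: "nat \<Rightarrow> nat"
    have "bounded (range (\<lambda>n. u (s n) \<bullet> u m))" using bd by (auto simp: bounded_iff)
    then obtain l r where "strict_mono r" "((\<lambda>n. u (s n) \<bullet> u m) \<circ> r) \<longlonglongrightarrow> l"
      using bounded_imp_convergent_subsequence by blast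
    then show "\<exists>r. strict_mono r \<and> convergent (\<lambda>n. u ((s \<circ> r) n) \<bullet> u m)"
      by (auto simp: convergent_def o_def)
  qed
  define r where "r = diagseq"
  have r: "strict_mono r" by (simp add: r_def subseq_diagseq)
  have "convergent (\<lambda>n. u (r n) \<bullet> u m)" for m
  proof -
    have "convergent (\<lambda>n. u ((diagseq \<circ> ((+) (Suc m))) n) \<bullet> u m)"
    proof (rule diagseq_holds)
      fix s r :: "nat \<Rightarrow> nat" and n assume "strict_mono r" "convergent (\<lambda>k. u (s k) \<bullet> u n)"
      then show "convergent (\<lambda>k. u ((s \<circ> r) k) \<bullet> u n)"
        using convergent_subseq_convergent[of "\<lambda>k. u (s k) \<bullet> u n" r] by (simp add: o_def)
    qed
    then have "convergent (\<lambda>n. u (r (n + Suc m)) \<bullet> u m)" by (simp add: r_def add.commute)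
    then show ?thesis by (subst (asm) convergent_ignore_initial_segment)
  qed
  then obtain c where c: "\<And>m. (\<lambda>n. u (r n) \<bullet> u m) \<longlonglongrightarrow> c m"
    unfolding convergent_def by metis
  define w where "w n = u (r n)" for n
  have w: "norm (w n) \<le> K" for n using K by (simp add: w_def)
  have wc: "(\<lambda>n. w n \<bullet> w m) \<longlonglongrightarrow> c (r m)" for m unfolding w_def by (rule c)
  obtain v where v: "\<forall>h l. (\<lambda>n. w n \<bullet> h) \<longlonglongrightarrow> l \<longrightarrow> v \<bullet> h = l"
    using weak_limit_candidate[of w K, OF w] by (rule exE)
  have "(\<lambda>n. w n \<bullet> h) \<longlonglongrightarrow> v \<bullet> h" for h
  proof (rule tendsto_if_subseq_limits)
    show "\<bar>w n \<bullet> h\<bar> \<le> K * norm h" for n using bd by (simp add: w_def)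
    fix s l assume s: "strict_mono s" and l: "((\<lambda>n. w n \<bullet> h) \<circ> s) \<longlonglongrightarrow> l"
    obtain v' where v': "\<forall>h l. (\<lambda>n. w (s n) \<bullet> h) \<longlonglongrightarrow> l \<longrightarrow> v' \<bullet> h = l"
      using weak_limit_candidate[of "\<lambda>n. w (s n)" K, OF w] by (rule exE)
    have "v \<bullet> w m = v' \<bullet> w m" for m
      using v[rule_format, OF wc[of m]] v'[rule_format, of "w m" "c (r m)"] LIMSEQ_subseq_LIMSEQ[OF wc[of m] s] by (simp add: o_def)
    then have z: "w m \<bullet> (v - v') = 0" for m by (simp add: inner_diff_right inner_commute)
    have "v \<bullet> (v - v') = 0" "v' \<bullet> (v - v') = 0"
      using v[rule_format, of "v - v'" 0] v'[rule_format, of "v - v'" 0] z by auto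
    then have "(v - v') \<bullet> (v - v') = 0" by (simp add: inner_diff_left)
    then have "v = v'" by simp
    then show "l = v \<bullet> h" using v'[rule_format, of h l] l by (simp add: o_def)
  qed
  then have "\<forall>h. (\<lambda>n. u (r n) \<bullet> h) \<longlonglongrightarrow> v \<bullet> h" by (simp add: w_def)
  with r show ?thesis by (intro exI conjI)
qed

lemma L2_Cauchy_complete:
  fixes f :: "nat \<Rightarrow> real^'n \<Rightarrow> 'b::euclidean_space"
  assumes f: "\<And>n. f n \<in> L2"
    and Cauchy: "\<And>e. e > 0 \<Longrightarrow> \<exists>M. \<forall>m\<ge>M. \<forall>n\<ge>M. (LINT x|lborel. (norm (f m x - f n x))\<^sup>2) < e"
  obtains F where "F \<in> L2" "(\<lambda>n. LINT x|lborel. (norm (f n x - F x))\<^sup>2) \<longlonglongrightarrow> 0"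
proof -
  have [measurable]: "f n \<in> borel_measurable borel" for n using f by (rule L2_measurable)
  have i: "integrable lborel (\<lambda>x. (norm (f m x - f n x))\<^sup>2)" for m n
    using L2_integrable[OF L2_diff[OF f f]] .
  have "\<forall>k. \<exists>M. \<forall>m\<ge>M. \<forall>n\<ge>M. (LINT x|lborel. (norm (f m x - f n x))\<^sup>2) < (1/8)^k"
    using Cauchy by simp
  then obtain M where M: "\<And>k m n. m \<ge> M k \<Longrightarrow> n \<ge> M k \<Longrightarrow> (LINT x|lborel. (norm (f m x - f n x))\<^sup>2) < (1/8)^k"
    by metis
  define r where "r k = (\<Sum>i\<le>k. Suc (M i))" for k
  have r: "strict_mono r" by (intro strict_monoI_Suc) (simp add: r_def)
  have rM: "M k \<le> r k" for k
  proof -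
    have "Suc (M k) \<le> r k" unfolding r_def by (rule member_le_sum) auto
    then show ?thesis by simp
  qed
  define A where "A k = {x. norm (f (r (Suc k)) x - f (r k) x) > (1/2)^k}" for k
  have [measurable]: "A k \<in> sets borel" for k unfolding A_def by measurable
  have emA: "emeasure lborel (A k) \<le> ennreal ((1/2)^k)" for k
  proof -
    have "emeasure lborel (A k) = (\<integral>\<^sup>+x. indicator (A k) x \<partial>lborel)" by simp
    also have "\<dots> \<le> (\<integral>\<^sup>+x. ennreal (4^k * (norm (f (r (Suc k)) x - f (r k) x))\<^sup>2) \<partial>lborel)"
    proof (intro nn_integral_mono)
      fix x
      show "indicator (A k) x \<le> ennreal (4^k * (norm (f (r (Suc k)) x - f (r k) x))\<^sup>2)"
      proof (cases "x \<in> A k")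
        case True
        then have "((1/2)^k)\<^sup>2 \<le> (norm (f (r (Suc k)) x - f (r k) x))\<^sup>2"
          by (intro power_mono) (auto simp: A_def)
        then have "4^k * ((1/2)^k)\<^sup>2 \<le> 4^k * (norm (f (r (Suc k)) x - f (r k) x))\<^sup>2"
          by (intro mult_left_mono) auto
        moreover have "(4::real)^k * ((1/2)^k)\<^sup>2 = 1"
          by (simp add: power2_eq_square flip: power_mult_distrib)
        ultimately show ?thesis using True by (simp add: ennreal_1[symmetric] del: ennreal_1)
      qed simp
    qed
    also have "\<dots> = ennreal (4^k * (LINT x|lborel. (norm (f (r (Suc k)) x - f (r k) x))\<^sup>2))"
      using i by (subst nn_integral_eq_integral) auto
    also have "\<dots> \<le> ennreal (4^k * (1/8)^k)"
      using M[OF order_trans[OF rM[of k]] rM[of k], of "r (Suc k)"] strict_monoD[OF r, of k "Suc k"]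
      by (intro ennreal_leI mult_left_mono) auto
    also have "(4::real)^k * (1/8)^k = (1/2)^k" by (simp flip: power_mult_distrib)
    finally show ?thesis .
  qed
  have "AE x in lborel. \<forall>\<^sub>F k in sequentially. x \<in> space lborel - A k"
  proof (rule borel_cantelli_AE1)
    show "emeasure lborel (A k) < \<infinity>" for k using emA[of k] by (simp add: le_less_trans)
    have "measure lborel (A k) \<le> (1/2)^k" for k
      using emA[of k] by (simp add: measure_def enn2real_leI)
    then show "summable (\<lambda>k. measure lborel (A k))"
      by (intro summable_comparison_test[OF _ summable_geometric[of "1/2"]]) auto
  qed simp
  then have conv: "AE x in lborel. convergent (\<lambda>k. f (r k) x)"
  proof eventually_elim
    case (elim x)
    then obtain N where N: "\<And>k. k \<ge> N \<Longrightarrow> norm (f (r (Suc k)) x - f (r k) x) \<le> (1/2)^k"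
      by (auto simp: eventually_sequentially A_def not_less)
    have "summable (\<lambda>k. f (r (Suc k)) x - f (r k) x)"
      by (rule summable_comparison_test[OF _ summable_geometric[of "1/2"]]) (use N in auto)
    then have "convergent (\<lambda>n. \<Sum>k<n. f (r (Suc k)) x - f (r k) x)"
      by (simp add: summable_iff_convergent)
    then have "convergent (\<lambda>n. (f (r n) x - f (r 0) x) + f (r 0) x)"
      using sum_lessThan_telescope[of "\<lambda>k. f (r k) x"] by (intro convergent_add convergent_const) simp
    then show ?case by simp
  qed
  define F where "F x = lim (\<lambda>k. f (r k) x)" for x
  have [measurable]: "F \<in> borel_measurable borel"
    unfolding F_def[abs_def] by (rule borel_measurable_lim_metric) simp
  have lim: "AE x in lborel. (\<lambda>k. f (r k) x) \<longlonglongrightarrow> F x"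
    using conv by eventually_elim (simp add: F_def convergent_LIMSEQ_iff)
  have Fn: "integrable lborel (\<lambda>x. (norm (f n x - F x))\<^sup>2)"
      "(LINT x|lborel. (norm (f n x - F x))\<^sup>2) \<le> e"
    if e: "\<And>m. m \<ge> n \<Longrightarrow> (LINT x|lborel. (norm (f n x - f m x))\<^sup>2) \<le> e" for n e
  proof -
    have "0 \<le> (LINT x|lborel. (norm (f n x - f n x))\<^sup>2)" by simp
    then have e0: "0 \<le> e" using e[of n] by linarith
    have "(\<integral>\<^sup>+x. ennreal ((norm (f n x - F x))\<^sup>2) \<partial>lborel) =
        (\<integral>\<^sup>+x. liminf (\<lambda>k. ennreal ((norm (f n x - f (r k) x))\<^sup>2)) \<partial>lborel)"
    proof (rule nn_integral_cong_AE, use lim in eventually_elim)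
      case (elim x)
      then have "(\<lambda>k. ennreal ((norm (f n x - f (r k) x))\<^sup>2)) \<longlonglongrightarrow> ennreal ((norm (f n x - F x))\<^sup>2)"
        by (intro tendsto_intros) auto
      then show ?case by (intro lim_imp_Liminf[symmetric]) auto
    qed
    also have "\<dots> \<le> liminf (\<lambda>k. \<integral>\<^sup>+x. ennreal ((norm (f n x - f (r k) x))\<^sup>2) \<partial>lborel)"
      by (intro nn_integral_liminf) simp
    also have "\<dots> \<le> ennreal e"
    proof (rule Liminf_le)
      show "\<forall>\<^sub>F k in sequentially. (\<integral>\<^sup>+x. ennreal ((norm (f n x - f (r k) x))\<^sup>2) \<partial>lborel) \<le> ennreal e"
        using eventually_ge_at_top[of n]
      proof eventually_elim
        case (elim k)
        then have "n \<le> r k" using seq_suble[OF r, of k] by simp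
        then show ?case
          using i e by (subst nn_integral_eq_integral) (auto intro: ennreal_leI)
      qed
    qed simp
    finally have *: "(\<integral>\<^sup>+x. ennreal ((norm (f n x - F x))\<^sup>2) \<partial>lborel) \<le> ennreal e" .
    show "integrable lborel (\<lambda>x. (norm (f n x - F x))\<^sup>2)" "(LINT x|lborel. (norm (f n x - F x))\<^sup>2) \<le> e"
      by (rule integrable_if_nn_integral_le[OF _ _ e0 *]; simp)+
  qed
  have "(\<lambda>x. f (M 0) x - F x) \<in> L2"
    using Fn(1)[of "M 0" 1] M[of 0 "M 0"] by (auto simp: L2_def less_imp_le)
  from L2_diff[OF f[of "M 0"] this] have "F \<in> L2" by simp
  moreover have "(\<lambda>n. LINT x|lborel. (norm (f n x - F x))\<^sup>2) \<longlonglongrightarrow> 0"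
  proof (rule LIMSEQ_I)
    fix e :: real assume "e > 0"
    then obtain N where N: "\<And>m n. m \<ge> N \<Longrightarrow> n \<ge> N \<Longrightarrow> (LINT x|lborel. (norm (f m x - f n x))\<^sup>2) < e / 2"
      using Cauchy[of "e / 2"] by auto
    have "(LINT x|lborel. (norm (f n x - F x))\<^sup>2) \<le> e / 2" if "n \<ge> N" for n
      by (rule Fn(2)) (use N that in \<open>auto simp: less_imp_le\<close>)
    then show "\<exists>N. \<forall>n\<ge>N. norm ((LINT x|lborel. (norm (f n x - F x))\<^sup>2) - 0) < e"
      using \<open>e > 0\<close> by (intro exI[of _ N]) fastforce
  qed
  ultimately show ?thesis using that by blast
qed

definition L2_rel :: "(real^'n \<Rightarrow> 'b::euclidean_space) \<Rightarrow> (real^'n \<Rightarrow> 'b) \<Rightarrow> bool" where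
  "L2_rel f g \<longleftrightarrow> f \<in> L2 \<and> g \<in> L2 \<and> (AE x in lborel. f x = g x)"

lemma part_equivp_L2_rel: "part_equivp (L2_rel :: (real^'n \<Rightarrow> 'b::euclidean_space) \<Rightarrow> _)"
proof (rule part_equivpI)
  show "\<exists>f. L2_rel f (f :: real^'n \<Rightarrow> 'b)" by (intro exI[of _ "\<lambda>_. 0"]) (simp add: L2_rel_def)
  show "symp (L2_rel :: (real^'n \<Rightarrow> 'b) \<Rightarrow> _)" by (auto simp: symp_def L2_rel_def elim: eventually_mono)
  show "transp (L2_rel :: (real^'n \<Rightarrow> 'b) \<Rightarrow> _)"
  proof (rule transpI)
    fix f g h :: "real^'n \<Rightarrow> 'b" assume a: "L2_rel f g" "L2_rel g h"
    then have "AE x in lborel. f x = g x" "AE x in lborel. g x = h x" by (auto simp: L2_rel_def)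
    then have "AE x in lborel. f x = h x" by eventually_elim simp
    with a show "L2_rel f h" by (auto simp: L2_rel_def)
  qed
qed

quotient_type (overloaded) ('n, 'b) L2_space = "real^'n::finite \<Rightarrow> 'b::euclidean_space" / partial: L2_rel
  by (rule part_equivp_L2_rel)

instantiation L2_space :: (finite, euclidean_space) real_vector
begin

lift_definition zero_L2_space :: "('a, 'b) L2_space" is "\<lambda>_. 0"
  by (simp add: L2_rel_def)

lift_definition plus_L2_space :: "('a, 'b) L2_space \<Rightarrow> ('a, 'b) L2_space \<Rightarrow> ('a, 'b) L2_space"
  is "\<lambda>f g x. f x + g x"
  by (auto simp: L2_rel_def L2_add elim: eventually_elim2)

lift_definition uminus_L2_space :: "('a, 'b) L2_space \<Rightarrow> ('a, 'b) L2_space"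
  is "\<lambda>f x. - f x"
  using L2_scaleR[of _ "-1"] by (auto simp: L2_rel_def elim: eventually_mono)

lift_definition minus_L2_space :: "('a, 'b) L2_space \<Rightarrow> ('a, 'b) L2_space \<Rightarrow> ('a, 'b) L2_space"
  is "\<lambda>f g x. f x - g x"
  by (auto simp: L2_rel_def L2_diff elim: eventually_elim2)

lift_definition scaleR_L2_space :: "real \<Rightarrow> ('a, 'b) L2_space \<Rightarrow> ('a, 'b) L2_space"
  is "\<lambda>c f x. c *\<^sub>R f x"
  by (auto simp: L2_rel_def L2_scaleR elim: eventually_mono)

instance
proof
  fix f g h :: "('a, 'b) L2_space" and a b :: real
  show "f + g + h = f + (g + h)"
    by transfer (auto simp: L2_rel_def L2_add add.assoc)
  show "f + g = g + f"
    by transfer (auto simp: L2_rel_def L2_add add.commute)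
  show "0 + f = f"
    by transfer (auto simp: L2_rel_def)
  show "- f + f = 0"
    by transfer (auto simp: L2_rel_def)
  show "f - g = f + - g"
    by transfer (auto simp: L2_rel_def L2_diff)
  show "a *\<^sub>R (f + g) = a *\<^sub>R f + a *\<^sub>R g"
    by transfer (auto simp: L2_rel_def L2_add L2_scaleR scaleR_add_right)
  show "(a + b) *\<^sub>R f = a *\<^sub>R f + b *\<^sub>R f"
    by transfer (auto simp: L2_rel_def L2_add L2_scaleR scaleR_add_left)
  show "a *\<^sub>R b *\<^sub>R f = (a * b) *\<^sub>R f"
    by transfer (auto simp: L2_rel_def L2_scaleR)
  show "1 *\<^sub>R f = f"
    by transfer (auto simp: L2_rel_def)
qed

end

instantiation L2_space :: (finite, euclidean_space) real_inner
begin

lift_definition inner_L2_space :: "('a, 'b) L2_space \<Rightarrow> ('a, 'b) L2_space \<Rightarrow> real"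
  is "\<lambda>f g. LINT x|lborel. f x \<bullet> g x"
proof -
  fix f f' g g' :: "real^'a \<Rightarrow> 'b"
  assume a: "L2_rel f f'" "L2_rel g g'"
  then have [measurable]: "f \<in> borel_measurable borel" "f' \<in> borel_measurable borel"
    "g \<in> borel_measurable borel" "g' \<in> borel_measurable borel"
    by (auto simp: L2_rel_def intro: L2_measurable)
  have "AE x in lborel. f x = f' x" "AE x in lborel. g x = g' x" using a by (auto simp: L2_rel_def)
  then show "(LINT x|lborel. f x \<bullet> g x) = (LINT x|lborel. f' x \<bullet> g' x)"
    by (intro integral_cong_AE) (auto elim: eventually_elim2)
qed

definition norm_L2_space :: "('a, 'b) L2_space \<Rightarrow> real" where
  "norm_L2_space f = sqrt (f \<bullet> f)"

definition sgn_L2_space :: "('a, 'b) L2_space \<Rightarrow> ('a, 'b) L2_space" where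
  "sgn_L2_space f = f /\<^sub>R norm f"

definition dist_L2_space :: "('a, 'b) L2_space \<Rightarrow> ('a, 'b) L2_space \<Rightarrow> real" where
  "dist_L2_space f g = norm (f - g)"

definition uniformity_L2_space :: "(('a, 'b) L2_space \<times> ('a, 'b) L2_space) filter" where
  "uniformity_L2_space = (INF e\<in>{0 <..}. principal {(x, y). dist x y < e})"

definition open_L2_space :: "('a, 'b) L2_space set \<Rightarrow> bool" where
  "open_L2_space U = (\<forall>x\<in>U. \<forall>\<^sub>F (x', y) in uniformity. x' = x \<longrightarrow> y \<in> U)"

instance
proof
  fix f g h :: "('a, 'b) L2_space" and a b :: real
  show "f \<bullet> g = g \<bullet> f"
    by transfer (simp add: inner_commute)
  show "(f + g) \<bullet> h = f \<bullet> h + g \<bullet> h"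
    by transfer (simp add: L2_rel_def inner_add_left L2_inner_integrable)
  show "(a *\<^sub>R f) \<bullet> g = a * (f \<bullet> g)"
    by transfer simp
  show "0 \<le> f \<bullet> f"
    by transfer simp
  show "f \<bullet> f = 0 \<longleftrightarrow> f = 0"
  proof transfer
    fix f :: "real^'a \<Rightarrow> 'b" assume "L2_rel f f"
    then show "((LINT x|lborel. f x \<bullet> f x) = 0) = L2_rel f (\<lambda>_. 0)"
      using L2_inner_integrable[of f f]
      by (subst integral_nonneg_eq_0_iff_AE) (auto simp: L2_rel_def)
  qed
  show "norm f = sqrt (f \<bullet> f)" by (rule norm_L2_space_def)
  show "sgn f = f /\<^sub>R norm f" by (rule sgn_L2_space_def)
  show "dist f g = norm (f - g)" by (rule dist_L2_space_def)
  show "uniformity = (INF e\<in>{0 <..}. principal {(x, y :: ('a, 'b) L2_space). dist x y < e})"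
    by (rule uniformity_L2_space_def)
  show "open U = (\<forall>x\<in>U. \<forall>\<^sub>F (x', y) in uniformity. x' = x \<longrightarrow> y \<in> U)" for U :: "('a, 'b) L2_space set"
    by (rule open_L2_space_def)
qed

end

lemma inner_abs_L2_space:
  "f \<in> L2 \<Longrightarrow> g \<in> L2 \<Longrightarrow> abs_L2_space f \<bullet> abs_L2_space g = (LINT x|lborel. f x \<bullet> g x)"
  by (rule inner_L2_space.abs_eq) (auto simp: L2_rel_def)

lemma diff_abs_L2_space:
  "f \<in> L2 \<Longrightarrow> g \<in> L2 \<Longrightarrow> abs_L2_space f - abs_L2_space g = abs_L2_space (\<lambda>x. f x - g x)"
  by (rule minus_L2_space.abs_eq) (auto simp: L2_rel_def)

lemma L2_space_cases:
  obtains f where "f \<in> L2" "a = abs_L2_space f"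
proof -
  have "L2_rel (rep_L2_space a) (rep_L2_space a)" "abs_L2_space (rep_L2_space a) = a"
    using Quotient_L2_space unfolding Quotient_def by metis+
  then show ?thesis using that by (metis L2_rel_def)
qed

lemma dist_abs_L2_space:
  assumes "f \<in> L2" "g \<in> L2"
  shows "dist (abs_L2_space f) (abs_L2_space g) = sqrt (LINT x|lborel. (norm (f x - g x))\<^sup>2)"
  unfolding dist_norm diff_abs_L2_space[OF assms] norm_L2_space_def
    inner_abs_L2_space[OF L2_diff[OF assms] L2_diff[OF assms]] power2_norm_eq_inner ..

instance L2_space :: (finite, euclidean_space) complete_space
proof
  fix X :: "nat \<Rightarrow> ('a, 'b) L2_space" assume C: "Cauchy X"
  have "\<forall>n. \<exists>f. f \<in> L2 \<and> X n = abs_L2_space f" using L2_space_cases by metis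
  then obtain f where f: "\<And>n. f n \<in> L2" "\<And>n. X n = abs_L2_space (f n)" by metis
  have "\<exists>M. \<forall>m\<ge>M. \<forall>n\<ge>M. (LINT x|lborel. (norm (f m x - f n x))\<^sup>2) < e" if e: "e > 0" for e
  proof -
    have "sqrt e > 0" using e by simp
    then obtain M where "\<And>m n. m \<ge> M \<Longrightarrow> n \<ge> M \<Longrightarrow> dist (X m) (X n) < sqrt e"
      using C unfolding Cauchy_def by blast
    then show ?thesis using f by (intro exI[of _ M]) (simp add: dist_abs_L2_space)
  qed
  then obtain F where F: "F \<in> L2" "(\<lambda>n. LINT x|lborel. (norm (f n x - F x))\<^sup>2) \<longlonglongrightarrow> 0"
    using L2_Cauchy_complete[of f, OF f(1)] by blast
  have "(\<lambda>n. sqrt (LINT x|lborel. (norm (f n x - F x))\<^sup>2)) \<longlonglongrightarrow> sqrt 0"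
    by (intro tendsto_intros F)
  then have "(\<lambda>n. dist (X n) (abs_L2_space F)) \<longlonglongrightarrow> 0"
    using f F(1) by (simp add: dist_abs_L2_space)
  then show "convergent X" using tendsto_dist_iff convergentI by blast
qed

theorem L2_weak_compactness:
  fixes f :: "nat \<Rightarrow> real^'n \<Rightarrow> 'b::euclidean_space"
  assumes f: "\<And>n. f n \<in> L2" and K: "\<And>n. (LINT x|lborel. (norm (f n x))\<^sup>2) \<le> K"
  shows "\<exists>r F. strict_mono (r :: nat \<Rightarrow> nat) \<and> F \<in> L2 \<and>
    (\<forall>h\<in>L2. (\<lambda>n. LINT x|lborel. f (r n) x \<bullet> h x) \<longlonglongrightarrow> (LINT x|lborel. F x \<bullet> h x))"
proof -
  have "norm (abs_L2_space (f n)) \<le> sqrt K" for n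
    unfolding norm_L2_space_def inner_abs_L2_space[OF f f] using K[of n]
    by (simp add: power2_norm_eq_inner)
  then have "\<exists>r v. strict_mono (r :: nat \<Rightarrow> nat) \<and> (\<forall>h. (\<lambda>n. abs_L2_space (f (r n)) \<bullet> h) \<longlonglongrightarrow> v \<bullet> h)"
    by (rule bounded_weakly_convergent_subsequence)
  then obtain r v where r: "strict_mono (r :: nat \<Rightarrow> nat)"
    and v: "\<forall>h. (\<lambda>n. abs_L2_space (f (r n)) \<bullet> h) \<longlonglongrightarrow> v \<bullet> h"
    by (elim exE conjE)
  obtain F where F: "F \<in> L2" "v = abs_L2_space F" by (rule L2_space_cases)
  have "(\<lambda>n. LINT x|lborel. f (r n) x \<bullet> h x) \<longlonglongrightarrow> (LINT x|lborel. F x \<bullet> h x)" if "h \<in> L2" for h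
    using v[rule_format, of "abs_L2_space h"] that f F by (simp add: inner_abs_L2_space)
  with r F(1) show ?thesis by (intro exI conjI ballI)
qed

section \<open>The quadratic and quartic forms\<close>

definition H1_inner :: "real \<Rightarrow> (real^'n \<Rightarrow> real) \<Rightarrow> (real^'n \<Rightarrow> real) \<Rightarrow> real" where
  "H1_inner l u v = (LINT x|lborel. wgrad u x \<bullet> wgrad v x) + l * (LINT x|lborel. u x * v x)"

lemma H1_inner_commute: "H1_inner l u v = H1_inner l v u"
  by (simp add: H1_inner_def inner_commute mult.commute)

lemma H1_inner_cong_wgrad:
  assumes "u \<in> H1" "v \<in> H1" "AE x in lborel. wgrad u x = g x" "g \<in> L2"
  shows "(LINT x|lborel. wgrad u x \<bullet> wgrad v x) = (LINT x|lborel. g x \<bullet> wgrad v x)"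
  using assms L2_measurable[OF wgrad_L2[OF assms(1)]] L2_measurable[OF wgrad_L2[OF assms(2)]] L2_measurable[OF assms(4)]
  by (intro integral_cong_AE) (auto elim: eventually_mono)

lemma H1_inner_add_left:
  assumes "u \<in> H1" "v \<in> H1" "w \<in> H1"
  shows "H1_inner l (\<lambda>x. u x + v x) w = H1_inner l u w + H1_inner l v w"
  unfolding H1_inner_def
  using assms H1_inner_cong_wgrad[OF H1_add[OF assms(1,2)] assms(3) wgrad_add[OF assms(1,2)] L2_add]
  by (simp add: wgrad_L2 H1_L2 inner_add_left distrib_right L2_inner_integrable L2_mult_integrable distrib_left)

lemma H1_inner_cmult_left:
  assumes "u \<in> H1" "w \<in> H1"
  shows "H1_inner l (\<lambda>x. c * u x) w = c * H1_inner l u w"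
  unfolding H1_inner_def
  using assms H1_inner_cong_wgrad[OF H1_cmult[OF assms(1)] assms(2) wgrad_cmult[OF assms(1)] L2_scaleR]
  by (simp add: wgrad_L2 H1_L2 distrib_left mult.assoc)

lemma H1_inner_add_cmult:
  assumes "u \<in> H1" "h \<in> H1"
  shows "H1_inner l (\<lambda>x. u x + t * h x) (\<lambda>x. u x + t * h x) =
    H1_inner l u u + 2 * t * H1_inner l u h + t\<^sup>2 * H1_inner l h h"
proof -
  note th = H1_cmult[OF assms(2), of t]
  note s = H1_add[OF assms(1) th]
  have "H1_inner l (\<lambda>x. u x + t * h x) w = H1_inner l u w + t * H1_inner l h w" if "w \<in> H1" for w
    using assms th that by (simp add: H1_inner_add_left H1_inner_cmult_left)
  from this[OF s] this[OF assms(1)] this[OF assms(2)] show ?thesis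
    by (simp add: H1_inner_commute[of l u "\<lambda>x. u x + t * h x"] H1_inner_commute[of l h "\<lambda>x. u x + t * h x"]
        H1_inner_commute[of l h u] power2_eq_square distrib_left mult.assoc)
qed

lemma H1_inner_self: "H1_inner l u u = (LINT x|lborel. (norm (wgrad u x))\<^sup>2) + l * (LINT x|lborel. (u x)\<^sup>2)"
  unfolding H1_inner_def power2_norm_eq_inner by (simp only: power2_eq_square)

lemma H1_inner_self_LINT:
  assumes "u \<in> H1"
  shows "(LINT x|lborel. (norm (wgrad u x))\<^sup>2 + l * (u x)\<^sup>2) = H1_inner l u u"
  using L2_integrable[OF wgrad_L2[OF assms]] L2_integrable_real[OF H1_L2[OF assms]]
  by (simp add: H1_inner_self)

lemma H1_inner_nonneg: "0 \<le> l \<Longrightarrow> 0 \<le> H1_inner l u u"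
  by (simp add: H1_inner_self)

lemma H1_inner_1_le: "0 < l \<Longrightarrow> H1_inner 1 u u \<le> (1 + 1 / l) * H1_inner l u u"
proof -
  assume l: "0 < l"
  let ?G = "LINT x|lborel. (norm (wgrad u x))\<^sup>2" and ?U = "LINT x|lborel. (u x)\<^sup>2"
  have "0 \<le> ?G" "0 \<le> ?U" by auto
  then have "0 \<le> 1 / l * ?G" "0 \<le> l * ?U" using l by auto
  moreover have "(1 + 1 / l) * (?G + l * ?U) = ?G + 1 / l * ?G + l * ?U + ?U"
    using l by (simp add: field_simps)
  ultimately show ?thesis by (simp add: H1_inner_self)
qed

lemma H1_inner_shift:
  assumes u: "u \<in> H1"
  shows "H1_inner l (\<lambda>x. u (x + a)) (\<lambda>x. u (x + a)) = H1_inner l u u"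
proof -
  have [measurable]: "wgrad u \<in> borel_measurable borel" "u \<in> borel_measurable borel"
    "wgrad (\<lambda>x. u (x + a)) \<in> borel_measurable borel"
    using u by (auto intro: L2_measurable wgrad_L2 H1_L2 H1_shift)
  have "(LINT x|lborel. (norm (wgrad (\<lambda>x. u (x + a)) x))\<^sup>2) = (LINT x|lborel. (norm (wgrad u (x + a)))\<^sup>2)"
    using wgrad_shift[OF u, of a] by (intro integral_cong_AE) (auto elim: eventually_mono)
  also have "\<dots> = (LINT x|lborel. (norm (wgrad u x))\<^sup>2)"
    using integral_shift[of "\<lambda>x. (norm (wgrad u x))\<^sup>2" a] by simp
  finally show ?thesis
    using integral_shift[of "\<lambda>x. (u x)\<^sup>2" a] by (simp add: H1_inner_self)
qed

lemma H1_eq_zero_AE: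
  assumes "u \<in> H1" "H1_inner 1 u u \<le> 0"
  shows "AE x in lborel. u x = 0"
proof -
  have "0 \<le> (LINT x|lborel. (norm (wgrad u x))\<^sup>2)" "0 \<le> (LINT x|lborel. (u x)\<^sup>2)" by auto
  then have "(LINT x|lborel. (u x)\<^sup>2) = 0" using assms(2) unfolding H1_inner_self by linarith
  then show ?thesis
    using L2_integrable_real[OF H1_L2[OF assms(1)]] by (subst (asm) integral_nonneg_eq_0_iff_AE) auto
qed

definition L4 :: "(real^'n \<Rightarrow> real) set" where
  "L4 = {f. f \<in> borel_measurable borel \<and> integrable lborel (\<lambda>x. (f x)^4)}"

lemma L4_measurable [measurable_dest]: "f \<in> L4 \<Longrightarrow> f \<in> borel_measurable borel"
  by (simp add: L4_def)

lemma L4_integrable: "f \<in> L4 \<Longrightarrow> integrable lborel (\<lambda>x. (f x)^4)"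
  by (simp add: L4_def)

lemma L4_add: "f \<in> L4 \<Longrightarrow> g \<in> L4 \<Longrightarrow> (\<lambda>x. f x + g x) \<in> L4"
  using integrable_pow4_add[of f lborel g] by (auto simp: L4_def)

lemma L4_cmult: "f \<in> L4 \<Longrightarrow> (\<lambda>x. c * f x) \<in> L4"
  by (auto simp: L4_def power_mult_distrib)

lemma L4_diff: "f \<in> L4 \<Longrightarrow> g \<in> L4 \<Longrightarrow> (\<lambda>x. f x - g x) \<in> L4"
  using L4_add[of f "\<lambda>x. (-1) * g x"] L4_cmult[of g "-1"] by simp

lemma L4_products_integrable:
  assumes f: "f1 \<in> L4" "f2 \<in> L4" "f3 \<in> L4" "f4 \<in> L4"
  shows "integrable lborel (\<lambda>x. f1 x * f2 x * f3 x * f4 x)"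
proof (rule Bochner_Integration.integrable_bound)
  show "integrable lborel (\<lambda>x. (f1 x)^4 + (f2 x)^4 + (f3 x)^4 + (f4 x)^4)"
    using f by (auto simp: L4_def)
  show "AE x in lborel. norm (f1 x * f2 x * f3 x * f4 x) \<le> norm ((f1 x)^4 + (f2 x)^4 + (f3 x)^4 + (f4 x)^4)"
  proof (rule AE_I2)
    fix x
    have am: "\<bar>a * b\<bar> \<le> a\<^sup>2 + b\<^sup>2" for a b :: real
    proof -
      have "2 * (\<bar>a\<bar> * \<bar>b\<bar>) \<le> a\<^sup>2 + b\<^sup>2" "0 \<le> \<bar>a\<bar> * \<bar>b\<bar>"
        using sum_squares_bound[of "\<bar>a\<bar>" "\<bar>b\<bar>"] by auto
      then show ?thesis unfolding abs_mult by linarith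
    qed
    have "\<bar>f1 x * f2 x * f3 x * f4 x\<bar> \<le> (f1 x * f2 x)\<^sup>2 + (f3 x * f4 x)\<^sup>2"
      using am[of "f1 x * f2 x" "f3 x * f4 x"] by (simp add: mult.assoc)
    also have "\<dots> \<le> ((f1 x)\<^sup>2)\<^sup>2 + ((f2 x)\<^sup>2)\<^sup>2 + (((f3 x)\<^sup>2)\<^sup>2 + ((f4 x)\<^sup>2)\<^sup>2)"
      using am[of "(f1 x)\<^sup>2" "(f2 x)\<^sup>2"] am[of "(f3 x)\<^sup>2" "(f4 x)\<^sup>2"]
      by (intro add_mono) (simp_all add: power_mult_distrib)
    also have "\<dots> = (f1 x)^4 + (f2 x)^4 + (f3 x)^4 + (f4 x)^4" by simp
    finally show "norm (f1 x * f2 x * f3 x * f4 x) \<le> norm ((f1 x)^4 + (f2 x)^4 + (f3 x)^4 + (f4 x)^4)"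
      by (simp add: order_trans[OF _ abs_ge_self])
  qed
qed (use f in measurable)

lemma L4_integrable_squares:
  assumes "f \<in> L4" "g \<in> L4"
  shows "integrable lborel (\<lambda>x. (f x)\<^sup>2 * (g x)\<^sup>2)"
  using L4_products_integrable[OF assms(1,1,2,2)] by (simp add: power2_eq_square mult.assoc)

lemma L4_integrable_mixed:
  assumes "f \<in> L4" "h \<in> L4" "g \<in> L4"
  shows "integrable lborel (\<lambda>x. f x * h x * (g x)\<^sup>2)"
  using L4_products_integrable[OF assms(1,2,3,3)] by (simp add: power2_eq_square mult.assoc)

lemma L4_squares_Cauchy_Schwarz:
  assumes "f \<in> L4" "g \<in> L4"
  shows "(LINT x|lborel. (f x)\<^sup>2 * (g x)\<^sup>2)\<^sup>2 \<le> (LINT x|lborel. (f x)^4) * (LINT x|lborel. (g x)^4)"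
  using Cauchy_Schwarz_integral(2)[of "\<lambda>x. (f x)\<^sup>2" lborel "\<lambda>x. (g x)\<^sup>2"] assms
  by (auto simp: L4_def)

lemma expand_product_squares:
  fixes a c p q :: real
  shows "\<bar>(a + p)\<^sup>2 * (c + q)\<^sup>2 - a\<^sup>2 * c\<^sup>2 - 2 * (a * p * c\<^sup>2) - 2 * (c * q * a\<^sup>2)\<bar>
    \<le> 4 * (p\<^sup>2 * c\<^sup>2) + 4 * (a\<^sup>2 * q\<^sup>2) + 3 * (p\<^sup>2 * q\<^sup>2)"
proof -
  have am: "\<bar>2 * (x * y)\<bar> \<le> x\<^sup>2 + y\<^sup>2" for x y :: real
    using sum_squares_bound[of "\<bar>x\<bar>" "\<bar>y\<bar>"] by (simp add: abs_mult mult.assoc)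
  have eq: "(a + p)\<^sup>2 * (c + q)\<^sup>2 - a\<^sup>2 * c\<^sup>2 - 2 * (a * p * c\<^sup>2) - 2 * (c * q * a\<^sup>2) =
      p\<^sup>2 * c\<^sup>2 + a\<^sup>2 * q\<^sup>2 + p\<^sup>2 * q\<^sup>2 + 2 * (2 * ((p * c) * (a * q))) + 2 * ((p * c) * (p * q)) + 2 * ((a * q) * (p * q))"
    by (simp add: power2_eq_square algebra_simps)
  show ?thesis
    using am[of "p * c" "a * q"] am[of "p * c" "p * q"] am[of "a * q" "p * q"]
    unfolding eq power_mult_distrib abs_le_iff by linarith
qed

definition quadratic_form :: "nat \<Rightarrow> (nat \<Rightarrow> real) \<Rightarrow> (nat \<Rightarrow> real^'n \<Rightarrow> real) \<Rightarrow> (nat \<Rightarrow> real^'n \<Rightarrow> real) \<Rightarrow> real" where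
  "quadratic_form d lam u v = (\<Sum>i\<in>{1..d}. H1_inner (lam i) (u i) (v i))"

definition quartic_form :: "nat \<Rightarrow> (nat \<Rightarrow> nat \<Rightarrow> real) \<Rightarrow> (nat \<Rightarrow> real^'n \<Rightarrow> real) \<Rightarrow> real" where
  "quartic_form d \<beta> u = (\<Sum>i\<in>{1..d}. \<Sum>j\<in>{1..d}. \<beta> i j * (LINT x|lborel. (u i x)\<^sup>2 * (u j x)\<^sup>2))"

definition quartic_derivative ::
  "nat \<Rightarrow> (nat \<Rightarrow> nat \<Rightarrow> real) \<Rightarrow> (nat \<Rightarrow> real^'n \<Rightarrow> real) \<Rightarrow> (nat \<Rightarrow> real^'n \<Rightarrow> real) \<Rightarrow> real" where
  "quartic_derivative d \<beta> u h = (\<Sum>i\<in>{1..d}. \<Sum>j\<in>{1..d}. \<beta> i j * (LINT x|lborel. u i x * h i x * (u j x)\<^sup>2))"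

definition coupling_size :: "nat \<Rightarrow> (nat \<Rightarrow> nat \<Rightarrow> real) \<Rightarrow> real" where
  "coupling_size d \<beta> = (\<Sum>i\<in>{1..d}. \<Sum>j\<in>{1..d}. \<bar>\<beta> i j\<bar>)"

lemma coupling_size_nonneg: "0 \<le> coupling_size d \<beta>"
  by (auto simp: coupling_size_def intro!: sum_nonneg)

abbreviation H1_sq :: "nat \<Rightarrow> (nat \<Rightarrow> real^'n \<Rightarrow> real) \<Rightarrow> real" where
  "H1_sq d u \<equiv> quadratic_form d (\<lambda>_. 1) u u"

lemma H1_vecD: "u \<in> H1_vec d \<Longrightarrow> i \<in> {1..d} \<Longrightarrow> u i \<in> H1"
  by (simp add: H1_vec_def)

lemma H1_vec_add: "u \<in> H1_vec d \<Longrightarrow> v \<in> H1_vec d \<Longrightarrow> (\<lambda>i x. u i x + v i x) \<in> H1_vec d"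
  by (simp add: H1_vec_def H1_add)

lemma H1_vec_diff: "u \<in> H1_vec d \<Longrightarrow> v \<in> H1_vec d \<Longrightarrow> (\<lambda>i x. u i x - v i x) \<in> H1_vec d"
  by (simp add: H1_vec_def H1_diff)

lemma H1_vec_cmult: "u \<in> H1_vec d \<Longrightarrow> (\<lambda>i x. c * u i x) \<in> H1_vec d"
  by (simp add: H1_vec_def H1_cmult)

lemma quadratic_form_add_cmult:
  assumes "u \<in> H1_vec d" "h \<in> H1_vec d"
  shows "quadratic_form d lam (\<lambda>i x. u i x + t * h i x) (\<lambda>i x. u i x + t * h i x) =
    quadratic_form d lam u u + 2 * t * quadratic_form d lam u h + t\<^sup>2 * quadratic_form d lam h h"
proof -
  have "H1_inner (lam i) (\<lambda>x. u i x + t * h i x) (\<lambda>x. u i x + t * h i x) =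
    H1_inner (lam i) (u i) (u i) + 2 * t * H1_inner (lam i) (u i) (h i) + t\<^sup>2 * H1_inner (lam i) (h i) (h i)"
    if "i \<in> {1..d}" for i
    using that assms by (intro H1_inner_add_cmult H1_vecD)
  then show ?thesis
    by (simp add: quadratic_form_def sum.distrib sum_distrib_left)
qed

lemma quadratic_form_cmult:
  assumes "u \<in> H1_vec d" "h \<in> H1_vec d"
  shows "quadratic_form d lam (\<lambda>i x. c * u i x) h = c * quadratic_form d lam u h"
  using assms by (simp add: quadratic_form_def H1_inner_cmult_left H1_vecD sum_distrib_left)

lemma quadratic_form_commute: "quadratic_form d lam u h = quadratic_form d lam h u"
  unfolding quadratic_form_def by (intro sum.cong H1_inner_commute refl)

lemma quadratic_form_cmult_cmult:
  assumes "u \<in> H1_vec d"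
  shows "quadratic_form d lam (\<lambda>i x. c * u i x) (\<lambda>i x. c * u i x) = c\<^sup>2 * quadratic_form d lam u u"
  using quadratic_form_cmult[OF assms H1_vec_cmult[OF assms]] quadratic_form_cmult[OF assms assms]
  by (simp add: quadratic_form_commute[of d lam u "\<lambda>i x. c * u i x"] power2_eq_square)

lemma quartic_form_cmult: "quartic_form d \<beta> (\<lambda>i x. c * u i x) = c^4 * quartic_form d \<beta> u"
  by (simp add: quartic_form_def power_mult_distrib sum_distrib_left mult_ac power4_eq_xxxx power2_eq_square)

lemma quartic_derivative_cmult:
  "quartic_derivative d \<beta> (\<lambda>i x. c * u i x) h = c^3 * quartic_derivative d \<beta> u h"
  by (simp add: quartic_derivative_def power_mult_distrib sum_distrib_left mult_ac power3_eq_cube power2_eq_square)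

lemma quartic_derivative_self: "quartic_derivative d \<beta> u u = quartic_form d \<beta> u"
  by (simp add: quartic_derivative_def quartic_form_def power2_eq_square)

lemma H1_sq_nonneg: "0 \<le> H1_sq d u"
  by (auto simp: quadratic_form_def intro!: sum_nonneg H1_inner_nonneg)

lemma H1_inner_le_H1_sq: "i \<in> {1..d} \<Longrightarrow> H1_inner 1 (u i) (u i) \<le> H1_sq d u"
  unfolding quadratic_form_def by (rule member_le_sum) (auto intro: H1_inner_nonneg)

lemma H1_sq_le:
  assumes "\<And>i. i \<in> {1..d} \<Longrightarrow> lam i > 0"
  shows "H1_sq d u \<le> (1 + (\<Sum>i\<in>{1..d}. 1 / lam i)) * quadratic_form d lam u u"
  unfolding quadratic_form_def sum_distrib_left
proof (rule sum_mono)
  fix i assume i: "i \<in> {1..d}"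
  have "1 / lam i \<le> (\<Sum>i\<in>{1..d}. 1 / lam i)"
    using i assms by (intro member_le_sum) (auto simp: less_imp_le)
  then have "(1 + 1 / lam i) * H1_inner (lam i) (u i) (u i) \<le>
      (1 + (\<Sum>i\<in>{1..d}. 1 / lam i)) * H1_inner (lam i) (u i) (u i)"
    using assms[OF i] by (intro mult_right_mono H1_inner_nonneg) auto
  with H1_inner_1_le[OF assms[OF i]]
  show "H1_inner 1 (u i) (u i) \<le> (1 + (\<Sum>i\<in>{1..d}. 1 / lam i)) * H1_inner (lam i) (u i) (u i)"
    by (rule order_trans)
qed

lemma quadratic_form_le_H1_sq:
  assumes "\<And>i. i \<in> {1..d} \<Longrightarrow> lam i > 0"
  shows "quadratic_form d lam u u \<le> (1 + (\<Sum>i\<in>{1..d}. lam i)) * H1_sq d u"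
  unfolding quadratic_form_def sum_distrib_left
proof (rule sum_mono)
  fix i assume i: "i \<in> {1..d}"
  let ?G = "LINT x|lborel. (norm (wgrad (u i) x))\<^sup>2" and ?U = "LINT x|lborel. (u i x)\<^sup>2"
  have le: "lam i \<le> (\<Sum>i\<in>{1..d}. lam i)"
    using i assms by (intro member_le_sum) (auto simp: less_imp_le)
  have 0: "0 \<le> ?G" "0 \<le> ?U" by auto
  have "?G + lam i * ?U \<le> (1 + lam i) * (?G + ?U)"
    using 0 assms[OF i] by (simp add: algebra_simps)
  also have "\<dots> \<le> (1 + (\<Sum>i\<in>{1..d}. lam i)) * (?G + ?U)"
    using 0 le by (intro mult_right_mono) auto
  finally show "H1_inner (lam i) (u i) (u i) \<le> (1 + (\<Sum>i\<in>{1..d}. lam i)) * H1_inner 1 (u i) (u i)"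
    by (simp add: H1_inner_self)
qed

lemma quadratic_form_nonneg:
  assumes "\<And>i. i \<in> {1..d} \<Longrightarrow> lam i > 0"
  shows "0 \<le> quadratic_form d lam u u"
  using assms by (auto simp: quadratic_form_def less_imp_le intro!: sum_nonneg H1_inner_nonneg)

lemma H1_vec_norm_sq: "u \<in> H1_vec d \<Longrightarrow> (H1_vec_norm d u)\<^sup>2 = H1_sq d u"
proof -
  assume u: "u \<in> H1_vec d"
  have "(\<Sum>i\<in>{1..d}. LINT x|lborel. (norm (wgrad (u i) x))\<^sup>2 + (u i x)\<^sup>2) = H1_sq d u"
    unfolding quadratic_form_def using H1_inner_self_LINT[OF H1_vecD[OF u], of _ 1]
    by (intro sum.cong) simp_all
  then show ?thesis using H1_sq_nonneg[of d u] by (simp add: H1_vec_norm_def)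
qed

lemma H1_vec_norm_nonneg: "0 \<le> H1_vec_norm d u"
  unfolding H1_vec_norm_def by (intro real_sqrt_ge_zero sum_nonneg integral_nonneg_AE) auto

lemma linear_coefficient_zero:
  fixes L C :: real
  assumes "\<And>t. \<bar>t\<bar> \<le> 1 \<Longrightarrow> L * t \<le> C * t\<^sup>2"
  shows "L = 0"
proof (rule ccontr)
  assume L: "L \<noteq> 0"
  define s where "s = min 1 (\<bar>L\<bar> / (2 * (\<bar>C\<bar> + 1)))"
  have s: "0 < s" "s \<le> 1" using L by (auto simp: s_def)
  have "s \<le> \<bar>L\<bar> / (2 * (\<bar>C\<bar> + 1))" by (simp add: s_def)
  then have "2 * (\<bar>C\<bar> + 1) * s \<le> \<bar>L\<bar>" by (simp add: pos_le_divide_eq mult.commute)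
  moreover have "\<bar>L\<bar> * s \<le> C * s\<^sup>2"
    using assms[of "sgn L * s"] L s
    by (auto simp: abs_mult sgn_real_def abs_if split: if_splits)
  then have "\<bar>L\<bar> * s \<le> (C * s) * s" by (simp add: power2_eq_square mult.assoc)
  then have "\<bar>L\<bar> \<le> C * s" using s by (simp add: mult_le_cancel_right)
  moreover have "C * s \<le> \<bar>C\<bar> * s" using s by (intro mult_right_mono) auto
  moreover have "2 * (\<bar>C\<bar> + 1) * s = 2 * (\<bar>C\<bar> * s) + 2 * s" "0 \<le> \<bar>C\<bar> * s"
    using s by (simp_all add: algebra_simps)
  ultimately show False using s by linarith
qed

context
  assumes dim: "CARD('n::finite) \<le> 3"
begin

lemma H1_L4: "(u :: real^'n \<Rightarrow> real) \<in> H1 \<Longrightarrow> u \<in> L4"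
  using H1_sobolev(1)[OF dim H1_L2 H1_wgrad] by (auto simp: L4_def intro: L2_measurable H1_L2)

lemma H1_pow4_le:
  "(u :: real^'n \<Rightarrow> real) \<in> H1 \<Longrightarrow> (LINT x|lborel. (u x)^4) \<le> sobolev_const TYPE('n) * (H1_inner 1 u u)\<^sup>2"
  using H1_sobolev(2)[OF dim H1_L2 H1_wgrad, of u] by (simp add: H1_inner_self add.commute)

lemma H1_squares_le:
  fixes u v :: "real^'n \<Rightarrow> real"
  assumes "u \<in> H1" "v \<in> H1"
  shows "(LINT x|lborel. (u x)\<^sup>2 * (v x)\<^sup>2) \<le> sobolev_const TYPE('n) * (H1_inner 1 u u * H1_inner 1 v v)"
proof (rule power2_le_imp_le)
  let ?S = "sobolev_const TYPE('n)"
  have S: "0 \<le> ?S" using sobolev_const_pos less_imp_le by blast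
  have "(LINT x|lborel. (u x)\<^sup>2 * (v x)\<^sup>2)\<^sup>2 \<le> (LINT x|lborel. (u x)^4) * (LINT x|lborel. (v x)^4)"
    by (intro L4_squares_Cauchy_Schwarz H1_L4 assms)
  also have "\<dots> \<le> (?S * (H1_inner 1 u u)\<^sup>2) * (?S * (H1_inner 1 v v)\<^sup>2)"
    using S by (intro mult_mono H1_pow4_le assms) auto
  also have "\<dots> = (?S * (H1_inner 1 u u * H1_inner 1 v v))\<^sup>2"
    by (simp add: power2_eq_square mult_ac)
  finally show "(LINT x|lborel. (u x)\<^sup>2 * (v x)\<^sup>2)\<^sup>2 \<le> (?S * (H1_inner 1 u u * H1_inner 1 v v))\<^sup>2" .
  show "0 \<le> ?S * (H1_inner 1 u u * H1_inner 1 v v)"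
    using S by (intro mult_nonneg_nonneg H1_inner_nonneg) auto
qed

lemma H1_vec_squares_le:
  fixes u v :: "nat \<Rightarrow> real^'n \<Rightarrow> real"
  assumes "u \<in> H1_vec d" "v \<in> H1_vec d" "i \<in> {1..d}" "j \<in> {1..d}"
  shows "(LINT x|lborel. (u i x)\<^sup>2 * (v j x)\<^sup>2) \<le> sobolev_const TYPE('n) * (H1_sq d u * H1_sq d v)"
proof -
  have "(LINT x|lborel. (u i x)\<^sup>2 * (v j x)\<^sup>2) \<le>
      sobolev_const TYPE('n) * (H1_inner 1 (u i) (u i) * H1_inner 1 (v j) (v j))"
    using assms by (intro H1_squares_le H1_vecD)
  also have "\<dots> \<le> sobolev_const TYPE('n) * (H1_sq d u * H1_sq d v)"
    using assms sobolev_const_pos[of "TYPE('n)"]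
    by (intro mult_left_mono mult_mono H1_inner_le_H1_sq H1_sq_nonneg H1_inner_nonneg) auto
  finally show ?thesis .
qed

lemma quartic_form_le:
  fixes u :: "nat \<Rightarrow> real^'n \<Rightarrow> real"
  assumes "u \<in> H1_vec d"
  shows "\<bar>quartic_form d \<beta> u\<bar> \<le> coupling_size d \<beta> * (sobolev_const TYPE('n) * (H1_sq d u)\<^sup>2)"
proof -
  have "\<bar>quartic_form d \<beta> u\<bar> \<le> (\<Sum>i\<in>{1..d}. \<Sum>j\<in>{1..d}. \<bar>\<beta> i j * (LINT x|lborel. (u i x)\<^sup>2 * (u j x)\<^sup>2)\<bar>)"
    unfolding quartic_form_def by (rule order_trans[OF sum_abs], rule sum_mono, rule sum_abs)
  also have "\<dots> \<le> (\<Sum>i\<in>{1..d}. \<Sum>j\<in>{1..d}. \<bar>\<beta> i j\<bar> * (sobolev_const TYPE('n) * (H1_sq d u)\<^sup>2))"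
    using H1_vec_squares_le[OF assms assms]
    by (intro sum_mono) (auto simp: abs_mult power2_eq_square intro!: mult_left_mono)
  finally show ?thesis by (simp add: coupling_size_def sum_distrib_right)
qed

lemma quartic_form_expand:
  fixes u h :: "nat \<Rightarrow> real^'n \<Rightarrow> real"
  assumes u: "u \<in> H1_vec d" and h: "h \<in> H1_vec d"
    and sym: "\<And>i j. i \<in> {1..d} \<Longrightarrow> j \<in> {1..d} \<Longrightarrow> \<beta> i j = \<beta> j i"
  shows "\<bar>quartic_form d \<beta> (\<lambda>i x. u i x + h i x) - quartic_form d \<beta> u - 4 * quartic_derivative d \<beta> u h\<bar>
    \<le> coupling_size d \<beta> * (sobolev_const TYPE('n) * (8 * (H1_sq d u * H1_sq d h) + 3 * (H1_sq d h)\<^sup>2))"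
proof -
  let ?I = "{1..d}" and ?S = "sobolev_const TYPE('n)"
  let ?B = "?S * (8 * (H1_sq d u * H1_sq d h) + 3 * (H1_sq d h)\<^sup>2)"
  define e where "e i j = (LINT x|lborel. (u i x + h i x)\<^sup>2 * (u j x + h j x)\<^sup>2) - (LINT x|lborel. (u i x)\<^sup>2 * (u j x)\<^sup>2)
      - 2 * (LINT x|lborel. u i x * h i x * (u j x)\<^sup>2) - 2 * (LINT x|lborel. u j x * h j x * (u i x)\<^sup>2)" for i j
  have e: "\<bar>e i j\<bar> \<le> ?B" if ij: "i \<in> ?I" "j \<in> ?I" for i j
  proof -
    have L: "u i \<in> L4" "u j \<in> L4" "h i \<in> L4" "h j \<in> L4" 
      using H1_vecD[OF u ij(1)] H1_vecD[OF u ij(2)] H1_vecD[OF h ij(1)] H1_vecD[OF h ij(2)]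
      by (auto intro: H1_L4)
    note int = L4_integrable_squares[OF L4_add[OF L(1,3)] L4_add[OF L(2,4)]]
      L4_integrable_squares[OF L(1,2)] L4_integrable_mixed[OF L(1,3,2)] L4_integrable_mixed[OF L(2,4,1)]
    note int' = L4_integrable_squares[OF L(3,2)] L4_integrable_squares[OF L(1,4)] L4_integrable_squares[OF L(3,4)]
    have "e i j = (LINT x|lborel. (u i x + h i x)\<^sup>2 * (u j x + h j x)\<^sup>2 - (u i x)\<^sup>2 * (u j x)\<^sup>2
      - 2 * (u i x * h i x * (u j x)\<^sup>2) - 2 * (u j x * h j x * (u i x)\<^sup>2))"
      using int by (simp add: e_def)
    then have "\<bar>e i j\<bar> \<le> (LINT x|lborel. \<bar>(u i x + h i x)\<^sup>2 * (u j x + h j x)\<^sup>2 - (u i x)\<^sup>2 * (u j x)\<^sup>2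
      - 2 * (u i x * h i x * (u j x)\<^sup>2) - 2 * (u j x * h j x * (u i x)\<^sup>2)\<bar>)"
      using integral_norm_bound by simp
    also have "\<dots> \<le> (LINT x|lborel. 4 * ((h i x)\<^sup>2 * (u j x)\<^sup>2) + 4 * ((u i x)\<^sup>2 * (h j x)\<^sup>2) + 3 * ((h i x)\<^sup>2 * (h j x)\<^sup>2))"
    proof (rule integral_mono)
      fix x
      show "\<bar>(u i x + h i x)\<^sup>2 * (u j x + h j x)\<^sup>2 - (u i x)\<^sup>2 * (u j x)\<^sup>2
        - 2 * (u i x * h i x * (u j x)\<^sup>2) - 2 * (u j x * h j x * (u i x)\<^sup>2)\<bar>
        \<le> 4 * ((h i x)\<^sup>2 * (u j x)\<^sup>2) + 4 * ((u i x)\<^sup>2 * (h j x)\<^sup>2) + 3 * ((h i x)\<^sup>2 * (h j x)\<^sup>2)"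
        by (rule expand_product_squares)
    next
      show "integrable lborel (\<lambda>x. \<bar>(u i x + h i x)\<^sup>2 * (u j x + h j x)\<^sup>2 - (u i x)\<^sup>2 * (u j x)\<^sup>2
        - 2 * (u i x * h i x * (u j x)\<^sup>2) - 2 * (u j x * h j x * (u i x)\<^sup>2)\<bar>)"
        by (rule int integrable_abs Bochner_Integration.integrable_diff integrable_mult_right)+
      show "integrable lborel (\<lambda>x. 4 * ((h i x)\<^sup>2 * (u j x)\<^sup>2) + 4 * ((u i x)\<^sup>2 * (h j x)\<^sup>2) + 3 * ((h i x)\<^sup>2 * (h j x)\<^sup>2))"
        by (rule int' Bochner_Integration.integrable_add integrable_mult_right)+
    qed
    also have "\<dots> = 4 * (LINT x|lborel. (h i x)\<^sup>2 * (u j x)\<^sup>2) + 4 * (LINT x|lborel. (u i x)\<^sup>2 * (h j x)\<^sup>2)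
        + 3 * (LINT x|lborel. (h i x)\<^sup>2 * (h j x)\<^sup>2)"
      using int' by simp
    also have "\<dots> \<le> 4 * (?S * (H1_sq d h * H1_sq d u)) + 4 * (?S * (H1_sq d u * H1_sq d h))
        + 3 * (?S * (H1_sq d h * H1_sq d h))"
      using ij by (intro add_mono mult_left_mono H1_vec_squares_le u h) auto
    also have "\<dots> = ?B" by (simp add: power2_eq_square algebra_simps)
    finally show ?thesis .
  qed
  have swap: "(\<Sum>i\<in>?I. \<Sum>j\<in>?I. \<beta> i j * (LINT x|lborel. u j x * h j x * (u i x)\<^sup>2)) = quartic_derivative d \<beta> u h"
    unfolding quartic_derivative_def by (subst sum.swap) (auto intro!: sum.cong simp: sym)
  have "(\<Sum>i\<in>?I. \<Sum>j\<in>?I. \<beta> i j * e i j) =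
      quartic_form d \<beta> (\<lambda>i x. u i x + h i x) - quartic_form d \<beta> u - 2 * quartic_derivative d \<beta> u h
      - 2 * (\<Sum>i\<in>?I. \<Sum>j\<in>?I. \<beta> i j * (LINT x|lborel. u j x * h j x * (u i x)\<^sup>2))"
    unfolding e_def quartic_form_def quartic_derivative_def
    by (simp add: right_diff_distrib sum_subtractf sum_distrib_left mult.left_commute)
  then have "\<bar>quartic_form d \<beta> (\<lambda>i x. u i x + h i x) - quartic_form d \<beta> u - 4 * quartic_derivative d \<beta> u h\<bar>
      = \<bar>\<Sum>i\<in>?I. \<Sum>j\<in>?I. \<beta> i j * e i j\<bar>" unfolding swap by simp
  also have "\<dots> \<le> (\<Sum>i\<in>?I. \<Sum>j\<in>?I. \<bar>\<beta> i j * e i j\<bar>)"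
    by (rule order_trans[OF sum_abs], rule sum_mono, rule sum_abs)
  also have "\<dots> \<le> (\<Sum>i\<in>?I. \<Sum>j\<in>?I. \<bar>\<beta> i j\<bar> * ?B)"
    using e by (intro sum_mono) (auto simp: abs_mult intro!: mult_left_mono)
  finally show ?thesis by (simp add: coupling_size_def sum_distrib_right)
qed

lemma quartic_form_expand_cmult:
  fixes u h :: "nat \<Rightarrow> real^'n \<Rightarrow> real"
  assumes u: "u \<in> H1_vec d" and h: "h \<in> H1_vec d"
    and sym: "\<And>i j. i \<in> {1..d} \<Longrightarrow> j \<in> {1..d} \<Longrightarrow> \<beta> i j = \<beta> j i"
  obtains C where "\<And>t. \<bar>t\<bar> \<le> 1 \<Longrightarrow>
    \<bar>quartic_form d \<beta> (\<lambda>i x. u i x + t * h i x) - quartic_form d \<beta> u - 4 * t * quartic_derivative d \<beta> u h\<bar> \<le> C * t\<^sup>2"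
proof -
  let ?S = "sobolev_const TYPE('n)"
  define C where "C = coupling_size d \<beta> * (?S * (8 * (H1_sq d u * H1_sq d h) + 3 * (H1_sq d h)\<^sup>2))"
  have "\<bar>quartic_form d \<beta> (\<lambda>i x. u i x + t * h i x) - quartic_form d \<beta> u - 4 * t * quartic_derivative d \<beta> u h\<bar> \<le> C * t\<^sup>2"
    if t: "\<bar>t\<bar> \<le> 1" for t
  proof -
    have D: "quartic_derivative d \<beta> u (\<lambda>i x. t * h i x) = t * quartic_derivative d \<beta> u h"
      by (simp add: quartic_derivative_def sum_distrib_left mult_ac)
    have t2: "t\<^sup>2 \<le> 1" using t by (simp add: abs_square_le_1)
    have "t^4 = t\<^sup>2 * t\<^sup>2" by (simp add: power2_eq_square power4_eq_xxxx)
    also have "\<dots> \<le> t\<^sup>2 * 1" using t2 by (intro mult_left_mono) auto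
    finally have t4: "t^4 \<le> t\<^sup>2" by simp
    have "8 * (H1_sq d u * (t\<^sup>2 * H1_sq d h)) + 3 * (t\<^sup>2 * H1_sq d h)\<^sup>2 =
        t\<^sup>2 * (8 * (H1_sq d u * H1_sq d h)) + t^4 * (3 * (H1_sq d h)\<^sup>2)"
      by (simp add: power_mult_distrib algebra_simps)
    also have "\<dots> \<le> t\<^sup>2 * (8 * (H1_sq d u * H1_sq d h)) + t\<^sup>2 * (3 * (H1_sq d h)\<^sup>2)"
      using t4 by (intro add_left_mono mult_right_mono) auto
    finally have le: "8 * (H1_sq d u * (t\<^sup>2 * H1_sq d h)) + 3 * (t\<^sup>2 * H1_sq d h)\<^sup>2 \<le>
        (8 * (H1_sq d u * H1_sq d h) + 3 * (H1_sq d h)\<^sup>2) * t\<^sup>2" by (simp add: algebra_simps)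
    have "\<bar>quartic_form d \<beta> (\<lambda>i x. u i x + t * h i x) - quartic_form d \<beta> u - 4 * t * quartic_derivative d \<beta> u h\<bar>
        \<le> coupling_size d \<beta> * (?S * (8 * (H1_sq d u * (t\<^sup>2 * H1_sq d h)) + 3 * (t\<^sup>2 * H1_sq d h)\<^sup>2))"
      using quartic_form_expand[of u d "\<lambda>i x. t * h i x" \<beta>, OF u H1_vec_cmult[OF h] sym]
      by (simp add: D quadratic_form_cmult_cmult[OF h] mult.assoc)
    also have "\<dots> \<le> coupling_size d \<beta> * (?S * ((8 * (H1_sq d u * H1_sq d h) + 3 * (H1_sq d h)\<^sup>2) * t\<^sup>2))"
      using le sobolev_const_pos[of "TYPE('n)"] coupling_size_nonneg by (intro mult_left_mono) auto
    finally show ?thesis by (simp add: C_def mult.assoc)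
  qed
  then show ?thesis by (rule that)
qed

end

definition coupling :: "(nat \<Rightarrow> real) \<Rightarrow> (nat \<Rightarrow> nat \<Rightarrow> real) \<Rightarrow> nat \<Rightarrow> nat \<Rightarrow> real" where
  "coupling mu b i j = (if i = j then mu i else b i j)"

lemma energy_eq:
  fixes u :: "nat \<Rightarrow> real^'n \<Rightarrow> real"
  assumes u: "u \<in> H1_vec d"
    and sym: "\<And>i j. i \<in> {1..d} \<Longrightarrow> j \<in> {1..d} \<Longrightarrow> i \<noteq> j \<Longrightarrow> b i j = b j i"
  shows "energy d lam mu b u = quadratic_form d lam u u / 2 - quartic_form d (coupling mu b) u / 4"
proof -
  let ?I = "{1..d}" and ?q = "\<lambda>i j. LINT x|lborel. (u i x)\<^sup>2 * (u j x)\<^sup>2"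
  have 1: "(\<Sum>i\<in>?I. LINT x|lborel. (norm (wgrad (u i) x))\<^sup>2 + lam i * (u i x)\<^sup>2) = quadratic_form d lam u u"
    unfolding quadratic_form_def by (intro sum.cong H1_inner_self_LINT H1_vecD[OF u]) auto
  have split: "?I = {1..<i} \<union> {i} \<union> {i<..d}" if "i \<in> ?I" for i using that by auto
  have "(\<Sum>j\<in>?I. coupling mu b i j * ?q i j) =
      (\<Sum>j\<in>{1..<i}. b i j * ?q i j) + mu i * ?q i i + (\<Sum>j\<in>{i<..d}. b i j * ?q i j)" if "i \<in> ?I" for i
    by (subst split[OF that], subst sum.union_disjoint; (simp add: coupling_def)?)
      (auto simp: coupling_def sum.union_disjoint intro!: sum.cong)
  then have "quartic_form d (coupling mu b) u =
      (\<Sum>i\<in>?I. \<Sum>j\<in>{1..<i}. b i j * ?q i j) + (\<Sum>i\<in>?I. mu i * ?q i i) + (\<Sum>i\<in>?I. \<Sum>j\<in>{i<..d}. b i j * ?q i j)"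
    by (simp add: quartic_form_def sum.distrib)
  moreover have "(\<Sum>i\<in>?I. \<Sum>j\<in>{1..<i}. b i j * ?q i j) = (\<Sum>i\<in>?I. \<Sum>j\<in>{i<..d}. b i j * ?q i j)"
  proof -
    have "(\<Sum>i\<in>?I. \<Sum>j\<in>{1..<i}. b i j * ?q i j) = (\<Sum>j\<in>?I. \<Sum>i\<in>{j<..d}. b i j * ?q i j)"
      unfolding sum.Sigma[OF finite_atLeastAtMost ballI[OF finite_atLeastLessThan]]
        sum.Sigma[OF finite_atLeastAtMost ballI[OF finite_greaterThanAtMost]]
      by (rule sum.reindex_bij_witness[of _ "\<lambda>(a, b). (b, a)" "\<lambda>(a, b). (b, a)"]) auto
    also have "\<dots> = (\<Sum>j\<in>?I. \<Sum>i\<in>{j<..d}. b j i * ?q j i)"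
      by (intro sum.cong) (auto simp: sym mult.commute)
    finally show ?thesis .
  qed
  moreover have "?q i i = (LINT x|lborel. (u i x)^4)" for i
    by (simp add: power2_eq_square power4_eq_xxxx mult.assoc)
  ultimately have "quartic_form d (coupling mu b) u =
      (\<Sum>i\<in>?I. mu i * (LINT x|lborel. (u i x)^4)) + 2 * (\<Sum>i\<in>?I. \<Sum>j\<in>{i<..d}. b i j * ?q i j)"
    by simp
  then show ?thesis
    unfolding energy_def 1 by (simp only:) (simp add: field_simps)
qed

section \<open>Weak limits in the Sobolev space\<close>

definition H1_weak :: "(nat \<Rightarrow> real^'n \<Rightarrow> real) \<Rightarrow> (real^'n \<Rightarrow> real) \<Rightarrow> bool" where
  "H1_weak s u \<longleftrightarrow>
    (\<forall>h\<in>L2. (\<lambda>n. LINT x|lborel. s n x * h x) \<longlonglongrightarrow> (LINT x|lborel. u x * h x)) \<and>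
    (\<forall>k\<in>L2. (\<lambda>n. LINT x|lborel. wgrad (s n) x \<bullet> k x) \<longlonglongrightarrow> (LINT x|lborel. wgrad u x \<bullet> k x))"

lemma H1_weak_subseq: "H1_weak s u \<Longrightarrow> strict_mono r \<Longrightarrow> H1_weak (\<lambda>n. s (r n)) u"
  unfolding H1_weak_def using LIMSEQ_subseq_LIMSEQ[of _ _ r] by (fastforce simp: o_def)

lemma L2_dominated:
  fixes f :: "real^'n \<Rightarrow> 'b::euclidean_space" and g :: "real^'n \<Rightarrow> 'c::euclidean_space"
  assumes "f \<in> L2" "g \<in> borel_measurable borel" "\<And>x. norm (g x) \<le> norm (f x)"
  shows "g \<in> L2"
proof -
  have "integrable lborel (\<lambda>x. (norm (g x))\<^sup>2)"
    by (rule Bochner_Integration.integrable_bound[OF L2_integrable[OF assms(1)]])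
      (use assms in \<open>auto intro!: power_mono\<close>)
  then show ?thesis using assms by (simp add: L2_def)
qed

lemma L2_Pair:
  assumes "f \<in> L2" "g \<in> L2"
  shows "(\<lambda>x. (f x, g x)) \<in> L2"
proof -
  have [measurable]: "f \<in> borel_measurable borel" "g \<in> borel_measurable borel"
    using assms by (auto intro: L2_measurable)
  have "integrable lborel (\<lambda>x. (norm (f x))\<^sup>2 + (norm (g x))\<^sup>2)"
    using assms by (auto intro: L2_integrable)
  then show ?thesis by (simp add: L2_def norm_Pair)
qed

lemma H1_weak_compactness:
  fixes s :: "nat \<Rightarrow> real^'n \<Rightarrow> real"
  assumes s: "\<And>n. s n \<in> H1" and K: "\<And>n. H1_inner 1 (s n) (s n) \<le> K"
  shows "\<exists>r u. strict_mono (r :: nat \<Rightarrow> nat) \<and> u \<in> H1 \<and> H1_weak (\<lambda>n. s (r n)) u"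
proof -
  define f where "f n x = (s n x, wgrad (s n) x)" for n x
  have f: "f n \<in> L2" for n
    unfolding f_def using s by (intro L2_Pair) (auto intro: H1_L2 wgrad_L2)
  have "(LINT x|lborel. (norm (f n x))\<^sup>2) \<le> K" for n
    using K[of n] L2_integrable[OF wgrad_L2[OF s]] L2_integrable_real[OF H1_L2[OF s]]
    by (simp add: f_def norm_Pair H1_inner_self add.commute)
  from L2_weak_compactness[of f K, OF f this]
  obtain r F where r: "strict_mono (r :: nat \<Rightarrow> nat)" and F: "F \<in> L2"
    and lim: "\<forall>h\<in>L2. (\<lambda>n. LINT x|lborel. f (r n) x \<bullet> h x) \<longlonglongrightarrow> (LINT x|lborel. F x \<bullet> h x)"
    by (elim exE conjE)
  have [measurable]: "F \<in> borel_measurable borel" using F by (rule L2_measurable)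
  have [measurable]: "(\<lambda>x. fst (F x)) \<in> borel_measurable borel" "(\<lambda>x. snd (F x)) \<in> borel_measurable borel"
    by (rule measurable_compose[OF \<open>F \<in> borel_measurable borel\<close> borel_measurable_continuous_onI],
        intro continuous_intros)+
  define u where "u x = fst (F x)" for x
  define g where "g x = snd (F x)" for x
  have u: "u \<in> L2" unfolding u_def
    by (rule L2_dominated[OF F], measurable) (metis norm_fst_le prod.collapse)
  have g: "g \<in> L2" unfolding g_def
    by (rule L2_dominated[OF F], measurable) (metis norm_snd_le prod.collapse)
  have lu: "(\<lambda>n. LINT x|lborel. s (r n) x * h x) \<longlonglongrightarrow> (LINT x|lborel. u x * h x)" if "h \<in> L2" for h
    using lim[rule_format, OF L2_Pair[OF that L2_zero]] by (simp add: f_def u_def inner_prod_def)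
  have lg: "(\<lambda>n. LINT x|lborel. wgrad (s (r n)) x \<bullet> k x) \<longlonglongrightarrow> (LINT x|lborel. g x \<bullet> k x)" if "k \<in> L2" for k
    using lim[rule_format, OF L2_Pair[OF L2_zero that]] by (simp add: f_def g_def inner_prod_def)
  have wg: "weak_gradient u g"
    unfolding weak_gradient_def
  proof (intro conjI allI impI g)
    fix \<phi> :: "real^'n \<Rightarrow> real" and i assume t: "test_function \<phi>"
    have L: "(\<lambda>x. \<phi> x *\<^sub>R axis i 1 :: real^'n) \<in> L2"
      by (rule L2_dominated[OF test_function_L2[OF t]])
        (use test_function_measurable[OF t] in \<open>auto simp: norm_axis_1\<close>)
    have nth: "y $ i * c = y \<bullet> (c *\<^sub>R axis i 1)" for y :: "real^'n" and c
      by (simp add: cart_eq_inner_axis mult.commute)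
    have "(\<lambda>n. - (LINT x|lborel. wgrad (s (r n)) x \<bullet> (\<phi> x *\<^sub>R axis i 1))) \<longlonglongrightarrow>
        - (LINT x|lborel. g x \<bullet> (\<phi> x *\<^sub>R axis i 1))"
      by (intro tendsto_intros lg L)
    moreover have "- (LINT x|lborel. wgrad (s (r n)) x \<bullet> (\<phi> x *\<^sub>R axis i 1)) =
        (LINT x|lborel. s (r n) x * frechet_derivative \<phi> (at x) (axis i 1))" for n
      using weak_gradientD[OF H1_wgrad[OF s] t, of "r n" i] unfolding nth by simp
    ultimately have "(\<lambda>n. LINT x|lborel. s (r n) x * frechet_derivative \<phi> (at x) (axis i 1)) \<longlonglongrightarrow>
        - (LINT x|lborel. g x \<bullet> (\<phi> x *\<^sub>R axis i 1))" by simp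
    from LIMSEQ_unique[OF lu[OF test_function_L2[OF test_function_partial[OF t]]] this]
    show "(LINT x|lborel. u x * frechet_derivative \<phi> (at x) (axis i 1)) = - (LINT x|lborel. g x $ i * \<phi> x)"
      unfolding nth .
  qed
  have uH: "u \<in> H1" using u wg by (rule H1I)
  have "(LINT x|lborel. wgrad u x \<bullet> k x) = (LINT x|lborel. g x \<bullet> k x)" if "k \<in> L2" for k
    using wgrad_AE[OF u wg] L2_measurable[OF wgrad_L2[OF uH]] L2_measurable[OF g] L2_measurable[OF that]
    by (intro integral_cong_AE) (auto elim: eventually_mono)
  then have "H1_weak (\<lambda>n. s (r n)) u" using lu lg by (simp add: H1_weak_def)
  with r uH show ?thesis by (intro exI conjI)
qed

lemma H1_vec_weak_compactness:
  fixes v :: "nat \<Rightarrow> nat \<Rightarrow> real^'n \<Rightarrow> real"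
  assumes v: "\<And>n. v n \<in> H1_vec d" and K: "\<And>n. H1_sq d (v n) \<le> K"
  shows "\<exists>r u. strict_mono (r :: nat \<Rightarrow> nat) \<and> u \<in> H1_vec d \<and> (\<forall>i\<in>{1..d}. H1_weak (\<lambda>n. v (r n) i) (u i))"
proof -
  have "m \<le> d \<Longrightarrow> \<exists>r u. strict_mono (r :: nat \<Rightarrow> nat) \<and> (\<forall>i\<in>{1..m}. u i \<in> H1 \<and> H1_weak (\<lambda>n. v (r n) i) (u i))" for m
  proof (induction m)
    case 0
    show ?case by (intro exI[of _ "\<lambda>n. n"]) (auto simp: strict_mono_def)
  next
    case (Suc m)
    then obtain r u where r: "strict_mono (r :: nat \<Rightarrow> nat)"
      and u: "\<forall>i\<in>{1..m}. u i \<in> H1 \<and> H1_weak (\<lambda>n. v (r n) i) (u i)" by auto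
    have m: "Suc m \<in> {1..d}" using Suc.prems by simp
    have "\<exists>r' w. strict_mono (r' :: nat \<Rightarrow> nat) \<and> w \<in> H1 \<and> H1_weak (\<lambda>n. v (r (r' n)) (Suc m)) w"
      by (rule H1_weak_compactness[of "\<lambda>n. v (r n) (Suc m)" K])
        (use H1_vecD[OF v m] order_trans[OF H1_inner_le_H1_sq[OF m] K] in auto)
    then obtain r' w where r': "strict_mono (r' :: nat \<Rightarrow> nat)" "w \<in> H1" "H1_weak (\<lambda>n. v (r (r' n)) (Suc m)) w"
      by (elim exE conjE)
    have "(u(Suc m := w)) i \<in> H1 \<and> H1_weak (\<lambda>n. v (r (r' n)) i) ((u(Suc m := w)) i)" if "i \<in> {1..Suc m}" for i
      using that r' u H1_weak_subseq[OF _ r'(1), of "\<lambda>n. v (r n) i"] by (cases "i = Suc m") auto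
    moreover have "strict_mono (\<lambda>n. r (r' n))" using strict_mono_o[OF r r'(1)] by (simp add: o_def)
    ultimately show ?case by (intro exI[of _ "\<lambda>n. r (r' n)"] exI[of _ "u(Suc m := w)"]) blast
  qed
  from this[of d] show ?thesis by (auto simp: H1_vec_def)
qed

lemma H1_weak_inner:
  assumes "H1_weak s u" "u \<in> H1"
  shows "(\<lambda>n. H1_inner l (s n) u) \<longlonglongrightarrow> H1_inner l u u"
  using assms unfolding H1_weak_def H1_inner_def
  by (intro tendsto_intros) (auto intro: H1_L2 wgrad_L2)

lemma cube_average_kernel:
  fixes f :: "real^'n \<Rightarrow> real"
  assumes [measurable]: "f \<in> borel_measurable borel" and r: "r > 0"
  shows "cube_average r f x = (LINT z|lborel. f z * (indicator (cbox x (x + r *\<^sub>R One)) z / r ^ CARD('n)))"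
proof -
  define G where "G z = f z * indicator (cbox x (x + r *\<^sub>R One)) z" for z
  have [measurable]: "G \<in> borel_measurable borel" unfolding G_def[abs_def] by measurable
  have "(LINT z|lborel. G z) = (LINT z|density (distr lborel borel (\<lambda>y. x + r *\<^sub>R y)) (\<lambda>_. \<bar>r\<bar> ^ DIM(real^'n)). G z)"
    using r by (subst lborel_affine[of r x]) auto
  also have "\<dots> = r ^ CARD('n) * (LINT y|lborel. G (x + r *\<^sub>R y))"
    using r by (subst integral_density; simp add: integral_distr)
  also have "(LINT y|lborel. G (x + r *\<^sub>R y)) = (LINT y|lborel. indicator (cbox 0 One) y * f (x + r *\<^sub>R y))"
    using r by (intro Bochner_Integration.integral_cong)
      (auto simp: G_def indicator_def mem_box inner_add_left zero_le_mult_iff)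
  also have "\<dots> = cube_average r f x"
    unfolding cube_average_def by (subst integral_unit_measure) auto
  finally show ?thesis using r by (simp add: G_def mult.assoc[symmetric])
qed

lemma cube_average_weak_tendsto:
  fixes f :: "real^'n \<Rightarrow> real"
  assumes s: "\<And>n. s n \<in> L2" and f: "f \<in> L2" and r: "r > 0"
    and lim: "\<And>h. h \<in> L2 \<Longrightarrow> (\<lambda>n. LINT x|lborel. s n x * h x) \<longlonglongrightarrow> (LINT x|lborel. f x * h x)"
  shows "(\<lambda>n. cube_average r (s n) x) \<longlonglongrightarrow> cube_average r f x"
proof -
  have "(\<lambda>z. indicator (cbox x (x + r *\<^sub>R One)) z / r ^ CARD('n)) \<in> (L2 :: (real^'n \<Rightarrow> real) set)"
    using r by (intro L2_bounded_support[where C = "1 / r ^ CARD('n)" and S = "cbox x (x + r *\<^sub>R One)"])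
      (auto simp: divide_right_mono split: split_indicator)
  from lim[OF this] show ?thesis
    using cube_average_kernel[OF L2_measurable[OF s] r] cube_average_kernel[OF L2_measurable[OF f] r] by simp
qed

context
  assumes dim: "CARD('n::finite) \<le> 3"
begin

lemma squares_weak_vanish:
  fixes f :: "real^'n \<Rightarrow> real" and \<rho> :: "nat \<Rightarrow> real^'n \<Rightarrow> real"
  assumes f: "f \<in> H1" and \<rho>: "\<And>n. \<rho> n \<in> H1" and K: "\<And>n. H1_inner 1 (\<rho> n) (\<rho> n) \<le> K"
    and weak: "\<And>h. h \<in> L2 \<Longrightarrow> (\<lambda>n. LINT x|lborel. \<rho> n x * h x) \<longlonglongrightarrow> 0"
  shows "(\<lambda>n. LINT x|lborel. (f x)\<^sup>2 * (\<rho> n x)\<^sup>2) \<longlonglongrightarrow> 0"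
proof -
  note fL = H1_L2[OF f] and fL4 = H1_L4[OF dim f] and \<rho>L = H1_L2[OF \<rho>] and \<rho>L4 = H1_L4[OF dim \<rho>]
  have K2: "(LINT x|lborel. (\<rho> n x)\<^sup>2) \<le> K" "(LINT x|lborel. (norm (wgrad (\<rho> n) x))\<^sup>2) \<le> K" for n
  proof -
    have "0 \<le> (LINT x|lborel. (\<rho> n x)\<^sup>2)" "0 \<le> (LINT x|lborel. (norm (wgrad (\<rho> n) x))\<^sup>2)" by auto
    then show "(LINT x|lborel. (\<rho> n x)\<^sup>2) \<le> K" "(LINT x|lborel. (norm (wgrad (\<rho> n) x))\<^sup>2) \<le> K"
      using K[of n] unfolding H1_inner_self by linarith+
  qed
  have [measurable]: "f \<in> borel_measurable borel" "\<rho> n \<in> borel_measurable borel" for n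
    using fL \<rho>L by (auto intro: L2_measurable)
  let ?S = "\<lambda>k n. smooth_average k (\<rho> n)"
  have SL4: "?S k n \<in> L4" for k n
    using smooth_average_pow4_integrable[OF \<rho>L] L2_measurable[OF smooth_average_L2(1)[OF \<rho>L]]
    by (auto simp: L4_def)
  have main: "(\<lambda>n. LINT x|lborel. (f x)\<^sup>2 * (?S k n x)\<^sup>2) \<longlonglongrightarrow> 0" for k
  proof -
    define b where "b = sqrt ((1 / (1/2)^k) ^ CARD('n) * K)"
    have avg: "\<bar>cube_average ((1/2)^k) (\<rho> n) z\<bar> \<le> b" for n z
    proof -
      have "(cube_average ((1/2)^k) (\<rho> n) z)\<^sup>2 \<le> (1 / (1/2)^k) ^ CARD('n) * (LINT x|lborel. (\<rho> n x)\<^sup>2)"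
        by (rule cube_average_square_le[OF \<rho>L]) simp
      also have "\<dots> \<le> (1 / (1/2)^k) ^ CARD('n) * K" using K2 by (intro mult_left_mono) auto
      finally show ?thesis unfolding b_def by (simp add: real_le_rsqrt)
    qed
    have avg0: "(\<lambda>n. cube_average ((1/2)^k) (\<rho> n) z) \<longlonglongrightarrow> 0" for z
      using cube_average_weak_tendsto[of \<rho> "\<lambda>_. 0" "(1/2)^k" z, OF \<rho>L L2_zero] weak
      by (simp add: cube_average_def[of _ "\<lambda>_. 0"])
    have S0: "(\<lambda>n. ?S k n x) \<longlonglongrightarrow> 0" for x
    proof -
      have "(\<lambda>n. LINT y|unit_measure. cube_average ((1/2)^k) (\<rho> n) (x + (1/2)^k *\<^sub>R y)) \<longlonglongrightarrow>
          (LINT y|(unit_measure :: (real^'n) measure). 0)"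
        by (rule integral_dominated_convergence[where w = "\<lambda>_. b"]) (use avg avg0 in auto)
      then show ?thesis by (simp add: smooth_average_def cube_average_def[of _ "cube_average _ _"])
    qed
    have Sb: "\<bar>?S k n x\<bar> \<le> b" for n x
      unfolding smooth_average_def by (intro cube_average_bound avg) simp
    have "(\<lambda>n. LINT x|lborel. (f x)\<^sup>2 * (?S k n x)\<^sup>2) \<longlonglongrightarrow> (LINT x|lborel. (f x)\<^sup>2 * 0\<^sup>2)"
    proof (rule integral_dominated_convergence[where w = "\<lambda>x. (f x)\<^sup>2 * b\<^sup>2"])
      show "integrable lborel (\<lambda>x. (f x)\<^sup>2 * b\<^sup>2)" using fL by (simp add: L2_integrable_real)
      show "AE x in lborel. (\<lambda>n. (f x)\<^sup>2 * (?S k n x)\<^sup>2) \<longlonglongrightarrow> (f x)\<^sup>2 * 0\<^sup>2"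
        by (intro AE_I2 tendsto_intros S0)
      show "AE x in lborel. norm ((f x)\<^sup>2 * (?S k n x)\<^sup>2) \<le> (f x)\<^sup>2 * b\<^sup>2" for n
        using power_mono[OF Sb abs_ge_zero, of n _ 2] by (auto simp: abs_mult intro!: AE_I2 mult_left_mono)
    qed (use SL4 in measurable)
    then show ?thesis by simp
  qed
  define F4 where "F4 = (LINT x|lborel. (f x)^4)"
  define \<eta> where "\<eta> k = sqrt (F4 * (2916 * step_const TYPE('n) * (1/2)^k * K\<^sup>2))" for k
  have err: "(LINT x|lborel. (f x)\<^sup>2 * (\<rho> n x - ?S k n x)\<^sup>2) \<le> \<eta> k" for k n
    unfolding \<eta>_def
  proof (rule real_le_rsqrt)
    have "(LINT x|lborel. (f x)\<^sup>2 * (\<rho> n x - ?S k n x)\<^sup>2)\<^sup>2 \<le> F4 * (LINT x|lborel. (\<rho> n x - ?S k n x)^4)"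
      unfolding F4_def by (rule L4_squares_Cauchy_Schwarz[OF fL4 L4_diff[OF \<rho>L4 SL4]])
    also have "\<dots> \<le> F4 * (2916 * step_const TYPE('n) * (1/2)^k * (LINT x|lborel. (norm (wgrad (\<rho> n) x))\<^sup>2)\<^sup>2)"
      by (intro mult_left_mono smooth_average_error dim \<rho>L H1_wgrad \<rho>) (simp add: F4_def)
    also have "\<dots> \<le> F4 * (2916 * step_const TYPE('n) * (1/2)^k * K\<^sup>2)"
      using K2 by (intro mult_left_mono power_mono) (auto simp: F4_def step_const_def)
    finally show "(LINT x|lborel. (f x)\<^sup>2 * (\<rho> n x - ?S k n x)\<^sup>2)\<^sup>2 \<le> F4 * (2916 * step_const TYPE('n) * (1/2)^k * K\<^sup>2)" .
  qed
  have "\<eta> \<longlonglongrightarrow> sqrt (F4 * (2916 * step_const TYPE('n) * 0 * K\<^sup>2))"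
    unfolding \<eta>_def by (intro tendsto_intros LIMSEQ_power_zero) auto
  then have \<eta>0: "\<eta> \<longlonglongrightarrow> 0" by simp
  have split: "(LINT x|lborel. (f x)\<^sup>2 * (\<rho> n x)\<^sup>2) \<le> 2 * (LINT x|lborel. (f x)\<^sup>2 * (?S k n x)\<^sup>2) + 2 * \<eta> k" for n k
  proof -
    have i: "integrable lborel (\<lambda>x. (f x)\<^sup>2 * (\<rho> n x)\<^sup>2)" "integrable lborel (\<lambda>x. (f x)\<^sup>2 * (?S k n x)\<^sup>2)"
      "integrable lborel (\<lambda>x. (f x)\<^sup>2 * (\<rho> n x - ?S k n x)\<^sup>2)"
      by (intro L4_integrable_squares fL4 \<rho>L4 SL4 L4_diff)+
    have "(LINT x|lborel. (f x)\<^sup>2 * (\<rho> n x)\<^sup>2) \<le>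
        (LINT x|lborel. 2 * ((f x)\<^sup>2 * (?S k n x)\<^sup>2) + 2 * ((f x)\<^sup>2 * (\<rho> n x - ?S k n x)\<^sup>2))"
    proof (rule integral_mono)
      fix x
      have "(f x)\<^sup>2 * (\<rho> n x)\<^sup>2 \<le> (f x)\<^sup>2 * (2 * (?S k n x)\<^sup>2 + 2 * (\<rho> n x - ?S k n x)\<^sup>2)"
        using square_add_le[of "?S k n x" "\<rho> n x - ?S k n x"] by (intro mult_left_mono) auto
      then show "(f x)\<^sup>2 * (\<rho> n x)\<^sup>2 \<le> 2 * ((f x)\<^sup>2 * (?S k n x)\<^sup>2) + 2 * ((f x)\<^sup>2 * (\<rho> n x - ?S k n x)\<^sup>2)"
        by (simp add: distrib_left)
    qed (use i in auto)
    also have "\<dots> = 2 * (LINT x|lborel. (f x)\<^sup>2 * (?S k n x)\<^sup>2) + 2 * (LINT x|lborel. (f x)\<^sup>2 * (\<rho> n x - ?S k n x)\<^sup>2)"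
      using i by simp
    finally show ?thesis using err[of n k] by linarith
  qed
  show ?thesis
  proof (rule LIMSEQ_I)
    fix e :: real assume "e > 0"
    then obtain k where k: "\<eta> k < e / 4"
      using order_tendstoD(2)[OF \<eta>0, of "e / 4"] by (auto simp: eventually_sequentially)
    obtain M where M: "\<And>n. n \<ge> M \<Longrightarrow> (LINT x|lborel. (f x)\<^sup>2 * (?S k n x)\<^sup>2) < e / 4"
      using order_tendstoD(2)[OF main[of k], of "e / 4"] \<open>e > 0\<close> by (auto simp: eventually_sequentially)
    have "norm ((LINT x|lborel. (f x)\<^sup>2 * (\<rho> n x)\<^sup>2) - 0) < e" if "n \<ge> M" for n
      using split[of n k] M[OF that] k by simp
    then show "\<exists>M. \<forall>n\<ge>M. norm ((LINT x|lborel. (f x)\<^sup>2 * (\<rho> n x)\<^sup>2) - 0) < e" by blast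
  qed
qed

end

lemma mixed_terms_le:
  fixes a c p q e :: real
  assumes e: "e > 0"
  shows "\<bar>(a + p)\<^sup>2 * (c + q)\<^sup>2 - a\<^sup>2 * c\<^sup>2 - p\<^sup>2 * q\<^sup>2\<bar>
    \<le> e * (a^4 + c^4 + p^4 + q^4) + (3 + 2 / e) * (a\<^sup>2 * p\<^sup>2 + a\<^sup>2 * q\<^sup>2 + c\<^sup>2 * p\<^sup>2 + c\<^sup>2 * q\<^sup>2)"
proof -
  have am: "\<bar>2 * (x * y)\<bar> \<le> x\<^sup>2 + y\<^sup>2" for x y :: real
    using sum_squares_bound[of "\<bar>x\<bar>" "\<bar>y\<bar>"] by (simp add: abs_mult mult.assoc)
  have am_e: "\<bar>2 * (x * y\<^sup>2)\<bar> \<le> 1 / e * x\<^sup>2 + e * y^4" for x y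
  proof -
    have "x * y\<^sup>2 = (x / sqrt e) * (sqrt e * y\<^sup>2)" using e by simp
    then have "\<bar>2 * (x * y\<^sup>2)\<bar> \<le> (x / sqrt e)\<^sup>2 + (sqrt e * y\<^sup>2)\<^sup>2" by (simp only: am)
    then show ?thesis using e by (simp add: power_mult_distrib power_divide)
  qed
  have eq: "(a + p)\<^sup>2 * (c + q)\<^sup>2 - a\<^sup>2 * c\<^sup>2 - p\<^sup>2 * q\<^sup>2 =
      c\<^sup>2 * p\<^sup>2 + a\<^sup>2 * q\<^sup>2 + 2 * (2 * ((a * p) * (c * q))) + 2 * ((a * p) * c\<^sup>2) + 2 * ((c * q) * a\<^sup>2)
      + 2 * ((c * q) * p\<^sup>2) + 2 * ((a * p) * q\<^sup>2)"
    by (simp add: power2_eq_square algebra_simps)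
  have rhs: "(3 + 2 / e) * (a\<^sup>2 * p\<^sup>2 + a\<^sup>2 * q\<^sup>2 + c\<^sup>2 * p\<^sup>2 + c\<^sup>2 * q\<^sup>2) =
      3 * (a\<^sup>2 * p\<^sup>2) + 3 * (a\<^sup>2 * q\<^sup>2) + 3 * (c\<^sup>2 * p\<^sup>2) + 3 * (c\<^sup>2 * q\<^sup>2)
      + 2 * (1 / e * (a\<^sup>2 * p\<^sup>2)) + 2 * (1 / e * (a\<^sup>2 * q\<^sup>2)) + 2 * (1 / e * (c\<^sup>2 * p\<^sup>2)) + 2 * (1 / e * (c\<^sup>2 * q\<^sup>2))"
    by (simp add: distrib_right distrib_left)
  have nn: "0 \<le> a\<^sup>2 * p\<^sup>2" "0 \<le> a\<^sup>2 * q\<^sup>2" "0 \<le> c\<^sup>2 * p\<^sup>2" "0 \<le> c\<^sup>2 * q\<^sup>2" by auto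
  have nn': "0 \<le> 1 / e * (a\<^sup>2 * q\<^sup>2)" "0 \<le> 1 / e * (c\<^sup>2 * p\<^sup>2)" using e by auto
  have e4: "e * (a^4 + c^4 + p^4 + q^4) = e * a^4 + e * c^4 + e * p^4 + e * q^4"
    by (simp add: distrib_left)
  show ?thesis
    using am[of "a * p" "c * q"] am_e[of "a * p" c] am_e[of "c * q" a] am_e[of "c * q" p] am_e[of "a * p" q] nn nn'
    unfolding eq rhs e4 power_mult_distrib abs_le_iff by linarith
qed

lemma product_squares_split:
  fixes a c :: "real^'n \<Rightarrow> real" and p q :: "nat \<Rightarrow> real^'n \<Rightarrow> real"
  assumes L: "a \<in> L4" "c \<in> L4" "\<And>n. p n \<in> L4" "\<And>n. q n \<in> L4"
    and K: "\<And>n. (LINT x|lborel. (p n x)^4) \<le> K" "\<And>n. (LINT x|lborel. (q n x)^4) \<le> K"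
    and lim: "(\<lambda>n. LINT x|lborel. (a x)\<^sup>2 * (p n x)\<^sup>2) \<longlonglongrightarrow> 0" "(\<lambda>n. LINT x|lborel. (a x)\<^sup>2 * (q n x)\<^sup>2) \<longlonglongrightarrow> 0"
      "(\<lambda>n. LINT x|lborel. (c x)\<^sup>2 * (p n x)\<^sup>2) \<longlonglongrightarrow> 0" "(\<lambda>n. LINT x|lborel. (c x)\<^sup>2 * (q n x)\<^sup>2) \<longlonglongrightarrow> 0"
  shows "(\<lambda>n. (LINT x|lborel. (a x + p n x)\<^sup>2 * (c x + q n x)\<^sup>2) - (LINT x|lborel. (a x)\<^sup>2 * (c x)\<^sup>2)
    - (LINT x|lborel. (p n x)\<^sup>2 * (q n x)\<^sup>2)) \<longlonglongrightarrow> 0" (is "?D \<longlonglongrightarrow> 0")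
proof (rule LIMSEQ_I)
  fix \<epsilon> :: real assume \<epsilon>: "\<epsilon> > 0"
  let ?A = "LINT x|lborel. (a x)^4" and ?C = "LINT x|lborel. (c x)^4"
  have "0 \<le> (LINT x|lborel. (p 0 x)^4)" by simp
  then have K0: "0 \<le> K" using K(1)[of 0] by linarith
  define T where "T = ?A + ?C + 2 * K"
  have T: "0 \<le> T" using K0 by (simp add: T_def)
  define e where "e = \<epsilon> / (2 * (T + 1))"
  have e: "e > 0" using \<epsilon> T by (simp add: e_def)
  have eT: "e * T < \<epsilon> / 2"
    using \<epsilon> T by (simp add: e_def divide_simps)
  let ?M = "\<lambda>n. (LINT x|lborel. (a x)\<^sup>2 * (p n x)\<^sup>2) + (LINT x|lborel. (a x)\<^sup>2 * (q n x)\<^sup>2)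
    + (LINT x|lborel. (c x)\<^sup>2 * (p n x)\<^sup>2) + (LINT x|lborel. (c x)\<^sup>2 * (q n x)\<^sup>2)"
  have bound: "\<bar>?D n\<bar> \<le> e * T + (3 + 2 / e) * ?M n" for n
  proof -
    have i: "integrable lborel (\<lambda>x. (a x + p n x)\<^sup>2 * (c x + q n x)\<^sup>2)" "integrable lborel (\<lambda>x. (a x)\<^sup>2 * (c x)\<^sup>2)"
      "integrable lborel (\<lambda>x. (p n x)\<^sup>2 * (q n x)\<^sup>2)" "integrable lborel (\<lambda>x. (a x)\<^sup>2 * (p n x)\<^sup>2)"
      "integrable lborel (\<lambda>x. (a x)\<^sup>2 * (q n x)\<^sup>2)" "integrable lborel (\<lambda>x. (c x)\<^sup>2 * (p n x)\<^sup>2)"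
      "integrable lborel (\<lambda>x. (c x)\<^sup>2 * (q n x)\<^sup>2)"
      by (intro L4_integrable_squares L L4_add)+
    note i4 = L4_integrable[OF L(1)] L4_integrable[OF L(2)] L4_integrable[OF L(3)[of n]] L4_integrable[OF L(4)[of n]]
    let ?d = "\<lambda>x. (a x + p n x)\<^sup>2 * (c x + q n x)\<^sup>2 - (a x)\<^sup>2 * (c x)\<^sup>2 - (p n x)\<^sup>2 * (q n x)\<^sup>2"
    have D: "?D n = (LINT x|lborel. ?d x)" using i by simp
    have id: "integrable lborel (\<lambda>x. \<bar>?d x\<bar>)"
      by (rule i integrable_abs Bochner_Integration.integrable_diff)+
    have "\<bar>?D n\<bar> \<le> (LINT x|lborel. \<bar>?d x\<bar>)"
      unfolding D using integral_norm_bound[of lborel ?d] by simp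
    moreover have "(LINT x|lborel. \<bar>?d x\<bar>) \<le> (LINT x|lborel. e * ((a x)^4 + (c x)^4 + (p n x)^4 + (q n x)^4)
      + (3 + 2 / e) * ((a x)\<^sup>2 * (p n x)\<^sup>2 + (a x)\<^sup>2 * (q n x)\<^sup>2 + (c x)\<^sup>2 * (p n x)\<^sup>2 + (c x)\<^sup>2 * (q n x)\<^sup>2))"
    proof (rule integral_mono[OF id])
      show "integrable lborel (\<lambda>x. e * ((a x)^4 + (c x)^4 + (p n x)^4 + (q n x)^4)
        + (3 + 2 / e) * ((a x)\<^sup>2 * (p n x)\<^sup>2 + (a x)\<^sup>2 * (q n x)\<^sup>2 + (c x)\<^sup>2 * (p n x)\<^sup>2 + (c x)\<^sup>2 * (q n x)\<^sup>2))"
        by (rule i i4 Bochner_Integration.integrable_add integrable_mult_right)+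
    qed (rule mixed_terms_le[OF e])
    moreover have "(LINT x|lborel. e * ((a x)^4 + (c x)^4 + (p n x)^4 + (q n x)^4)
      + (3 + 2 / e) * ((a x)\<^sup>2 * (p n x)\<^sup>2 + (a x)\<^sup>2 * (q n x)\<^sup>2 + (c x)\<^sup>2 * (p n x)\<^sup>2 + (c x)\<^sup>2 * (q n x)\<^sup>2)) =
      e * (?A + ?C + (LINT x|lborel. (p n x)^4) + (LINT x|lborel. (q n x)^4)) + (3 + 2 / e) * ?M n"
      using i i4 by simp
    moreover have "e * (?A + ?C + (LINT x|lborel. (p n x)^4) + (LINT x|lborel. (q n x)^4)) \<le> e * T"
      using K[of n] e by (intro mult_left_mono) (auto simp: T_def)
    ultimately show ?thesis by linarith
  qed
  have "(\<lambda>n. (3 + 2 / e) * ?M n) \<longlonglongrightarrow> (3 + 2 / e) * (0 + 0 + 0 + 0)"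
    by (intro tendsto_intros lim)
  then have "\<forall>\<^sub>F n in sequentially. (3 + 2 / e) * ?M n < \<epsilon> / 2"
    using \<epsilon> by (intro order_tendstoD(2)[of _ 0]) auto
  then obtain N where N: "\<And>n. n \<ge> N \<Longrightarrow> (3 + 2 / e) * ?M n < \<epsilon> / 2"
    by (auto simp: eventually_sequentially)
  have "norm (?D n - 0) < \<epsilon>" if "n \<ge> N" for n
    using bound[of n] N[OF that] eT by simp
  then show "\<exists>N. \<forall>n\<ge>N. norm (?D n - 0) < \<epsilon>" by blast
qed

section \<open>Existence of maximizers\<close>

lemma quartic_form_shift:
  fixes u :: "nat \<Rightarrow> real^'n \<Rightarrow> real"
  assumes "u \<in> H1_vec d"
  shows "quartic_form d \<beta> (\<lambda>i x. u i (x + a)) = quartic_form d \<beta> u"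
  unfolding quartic_form_def
proof (intro sum.cong refl arg_cong[where f = "(*) (\<beta> _ _)"])
  fix i j assume ij: "i \<in> {1..d}" "j \<in> {1..d}"
  have [measurable]: "u i \<in> borel_measurable borel" "u j \<in> borel_measurable borel"
    using H1_vecD[OF assms ij(1)] H1_vecD[OF assms ij(2)] by (auto intro: L2_measurable H1_L2)
  show "(LINT x|lborel. (u i (x + a))\<^sup>2 * (u j (x + a))\<^sup>2) = (LINT x|lborel. (u i x)\<^sup>2 * (u j x)\<^sup>2)"
    using integral_shift[of "\<lambda>x. (u i x)\<^sup>2 * (u j x)\<^sup>2" a] by simp
qed

lemma quadratic_form_shift:
  assumes "u \<in> H1_vec d"
  shows "quadratic_form d lam (\<lambda>i x. u i (x + a)) (\<lambda>i x. u i (x + a)) = quadratic_form d lam u u"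
  unfolding quadratic_form_def by (intro sum.cong refl H1_inner_shift H1_vecD[OF assms])

lemma H1_vec_shift: "u \<in> H1_vec d \<Longrightarrow> (\<lambda>i x. u i (x + a)) \<in> H1_vec d"
  by (simp add: H1_vec_def H1_shift)

context
  assumes dim: "CARD('n::finite) \<le> 3"
begin

lemma quartic_form_nonvanishing:
  fixes d :: nat
  assumes "\<eta> > 0" "K \<ge> 0"
  shows "\<exists>k \<delta>. \<delta> > 0 \<and> (\<forall>u::nat \<Rightarrow> real^'n \<Rightarrow> real. u \<in> H1_vec d \<longrightarrow> H1_sq d u \<le> K \<longrightarrow> quartic_form d \<beta> u \<ge> \<eta> \<longrightarrow>
    (\<exists>x. \<exists>i\<in>{1..d}. \<bar>cube_average ((1/2)^k) (u i) x\<bar> > \<delta>))"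
proof -
  let ?S = "sobolev_const TYPE('n)" and ?B = "coupling_size d \<beta>"
  have S: "0 \<le> ?S" using sobolev_const_pos less_imp_le by blast
  have B: "0 \<le> ?B" by (rule coupling_size_nonneg)
  define \<delta> where "\<delta> = sqrt (\<eta> / (2 * (8 * ?B * K + 1)))"
  have \<delta>: "\<delta> > 0" using assms B by (simp add: \<delta>_def add_nonneg_pos)
  have \<delta>2: "?B * (8 * \<delta>\<^sup>2 * K) < \<eta> / 2"
  proof -
    have nn: "0 \<le> 8 * ?B * K" using assms B by simp
    then have "2 * (8 * ?B * K + 1) > 0" by (simp add: add_nonneg_pos)
    moreover have "\<delta>\<^sup>2 = \<eta> / (2 * (8 * ?B * K + 1))" using assms B by (simp add: \<delta>_def)
    ultimately have "\<delta>\<^sup>2 * (2 * (8 * ?B * K + 1)) = \<eta>" by (metis less_irrefl nonzero_eq_divide_eq)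
    then have "2 * (?B * (8 * \<delta>\<^sup>2 * K)) + 2 * \<delta>\<^sup>2 = \<eta>" by (simp add: algebra_simps)
    moreover have "0 < \<delta>\<^sup>2" using \<delta> by simp
    ultimately show ?thesis by linarith
  qed
  have "\<eta> / (2 * (?B * ?S * K\<^sup>2 + 1)) > 0" using assms B S by (simp add: add_nonneg_pos)
  then obtain k where k: "(1/2::real)^k < \<eta> / (2 * (?B * ?S * K\<^sup>2 + 1))"
    using real_arch_pow_inv[of _ "1/2::real"] by auto
  have k2: "?B * (?S * (1/2)^k * K\<^sup>2) < \<eta> / 2"
  proof -
    have 0: "0 \<le> ?B * ?S * K\<^sup>2" using B S by simp
    then have "(1/2)^k * (2 * (?B * ?S * K\<^sup>2 + 1)) < \<eta>" using k by (simp add: pos_less_divide_eq)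
    moreover have "(1/2)^k * (2 * (?B * ?S * K\<^sup>2 + 1)) = 2 * (?B * (?S * (1/2)^k * K\<^sup>2)) + 2 * (1/2)^k"
      by (simp only: algebra_simps)
    moreover have "0 < (1/2::real)^k" by simp
    ultimately show ?thesis by linarith
  qed
  have "\<exists>x. \<exists>i\<in>{1..d}. \<bar>cube_average ((1/2)^k) (u i) x\<bar> > \<delta>"
    if u: "u \<in> H1_vec d" "H1_sq d u \<le> K" "quartic_form d \<beta> u \<ge> \<eta>" for u :: "nat \<Rightarrow> real^'n \<Rightarrow> real"
  proof (rule ccontr)
    assume "\<not> ?thesis"
    then have small: "\<bar>cube_average ((1/2)^k) (u i) x\<bar> \<le> \<delta>" if "i \<in> {1..d}" for i x
      using that by (auto simp: not_less)
    define T where "T = 8 * \<delta>\<^sup>2 * K + ?S * (1/2)^k * K\<^sup>2"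
    have uL4: "u i \<in> L4" if "i \<in> {1..d}" for i using H1_vecD[OF u(1) that] by (rule H1_L4[OF dim])
    have p4: "(LINT x|lborel. (u i x)^4) \<le> T" if i: "i \<in> {1..d}" for i
    proof -
      have "H1_inner 1 (u i) (u i) \<le> K" using H1_inner_le_H1_sq[OF i] u(2) by (rule order_trans)
      moreover have nn: "0 \<le> (LINT x|lborel. (norm (wgrad (u i) x))\<^sup>2)" "0 \<le> (LINT x|lborel. (u i x)\<^sup>2)" by auto
      ultimately have le: "(LINT x|lborel. (norm (wgrad (u i) x))\<^sup>2) \<le> K" "(LINT x|lborel. (u i x)\<^sup>2) \<le> K"
        unfolding H1_inner_self by linarith+
      have "(LINT x|lborel. (u i x)^4) \<le> 8 * \<delta>\<^sup>2 * (LINT x|lborel. (u i x)\<^sup>2)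
          + ?S * (1/2)^k * (LINT x|lborel. (norm (wgrad (u i) x))\<^sup>2)\<^sup>2"
        by (rule H1_pow4(2)[OF dim H1_L2 H1_wgrad small[OF i]]) (rule H1_vecD[OF u(1) i])+
      also have "\<dots> \<le> T"
        unfolding T_def using le nn S by (intro add_mono mult_left_mono power_mono) auto
      finally show ?thesis .
    qed
    have q: "(LINT x|lborel. (u i x)\<^sup>2 * (u j x)\<^sup>2) \<le> T" if "i \<in> {1..d}" "j \<in> {1..d}" for i j
    proof -
      have "(LINT x|lborel. (u i x)\<^sup>2 * (u j x)\<^sup>2) \<le> (LINT x|lborel. 1/2 * (u i x)^4 + 1/2 * (u j x)^4)"
      proof (rule integral_mono)
        fix x
        have "2 * (u i x)\<^sup>2 * (u j x)\<^sup>2 \<le> ((u i x)\<^sup>2)\<^sup>2 + ((u j x)\<^sup>2)\<^sup>2" by (rule sum_squares_bound)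
        then show "(u i x)\<^sup>2 * (u j x)\<^sup>2 \<le> 1/2 * (u i x)^4 + 1/2 * (u j x)^4" by simp
      qed (use L4_integrable[OF uL4] L4_integrable_squares[OF uL4 uL4] that in auto)
      also have "\<dots> = 1/2 * (LINT x|lborel. (u i x)^4) + 1/2 * (LINT x|lborel. (u j x)^4)"
        using L4_integrable[OF uL4] that by simp
      finally show ?thesis using p4[OF that(1)] p4[OF that(2)] by linarith
    qed
    have "quartic_form d \<beta> u \<le> (\<Sum>i\<in>{1..d}. \<Sum>j\<in>{1..d}. \<bar>\<beta> i j\<bar> * T)"
      unfolding quartic_form_def
    proof (intro sum_mono)
      fix i j assume ij: "i \<in> {1..d}" "j \<in> {1..d}"
      have "\<beta> i j * (LINT x|lborel. (u i x)\<^sup>2 * (u j x)\<^sup>2) \<le> \<bar>\<beta> i j\<bar> * (LINT x|lborel. (u i x)\<^sup>2 * (u j x)\<^sup>2)"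
        by (intro mult_right_mono) auto
      also have "\<dots> \<le> \<bar>\<beta> i j\<bar> * T" using q[OF ij] by (intro mult_left_mono) auto
      finally show "\<beta> i j * (LINT x|lborel. (u i x)\<^sup>2 * (u j x)\<^sup>2) \<le> \<bar>\<beta> i j\<bar> * T" .
    qed
    also have "\<dots> = ?B * T" by (simp add: coupling_size_def sum_distrib_right)
    also have "\<dots> < \<eta>" using \<delta>2 k2 by (simp add: T_def distrib_left)
    finally show False using u(3) by simp
  qed
  then show ?thesis using \<delta> by blast
qed

text \<open>
  Compactness modulo translations: with \<open>t\<close> the squared norm of the weak limit, the splitting of
  the norm and of the quartic form gives \<open>M \<le> M t\<^sup>2 + M (1 - t)\<^sup>2\<close>, which forces \<open>t = 1\<close> as
  soon as \<open>t > 0\<close>.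
\<close>
theorem quartic_maximizer:
  fixes w :: "nat \<Rightarrow> real^'n \<Rightarrow> real"
  assumes lam: "\<And>i. i \<in> {1..d} \<Longrightarrow> lam i > 0"
    and w: "w \<in> H1_vec d" "quartic_form d \<beta> w > 0"
  shows "\<exists>u::nat \<Rightarrow> real^'n \<Rightarrow> real. u \<in> H1_vec d \<and> quadratic_form d lam u u = 1 \<and>
    (\<forall>v::nat \<Rightarrow> real^'n \<Rightarrow> real. v \<in> H1_vec d \<longrightarrow> quartic_form d \<beta> v \<le> quartic_form d \<beta> u * (quadratic_form d lam v v)\<^sup>2)"
proof -
  let ?Q = "\<lambda>u::nat \<Rightarrow> real^'n \<Rightarrow> real. quadratic_form d lam u u"
  let ?F = "\<lambda>u::nat \<Rightarrow> real^'n \<Rightarrow> real. quartic_form d \<beta> u"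
  let ?S = "sobolev_const TYPE('n)" and ?B = "coupling_size d \<beta>"
  define K where "K = 1 + (\<Sum>i\<in>{1..d}. 1 / lam i)"
  have "0 \<le> (\<Sum>i\<in>{1..d}. 1 / lam i)" using lam by (intro sum_nonneg) (auto simp: less_imp_le)
  then have K: "K > 0" by (simp add: K_def)
  have Q0: "0 \<le> ?Q u" for u using lam by (rule quadratic_form_nonneg)
  have sqK: "H1_sq d u \<le> K * ?Q u" for u :: "nat \<Rightarrow> real^'n \<Rightarrow> real" unfolding K_def using lam by (rule H1_sq_le)
  have FQ: "?F u \<le> ?B * (?S * (K * ?Q u)\<^sup>2)" if "u \<in> H1_vec d" for u
  proof -
    have "?F u \<le> ?B * (?S * (H1_sq d u)\<^sup>2)" using quartic_form_le[OF dim that, of \<beta>] by linarith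
    also have "\<dots> \<le> ?B * (?S * (K * ?Q u)\<^sup>2)"
      using sqK sobolev_const_pos[of "TYPE('n)"] coupling_size_nonneg H1_sq_nonneg
      by (intro mult_left_mono power_mono) auto
    finally show ?thesis .
  qed
  define A where "A = ?F ` {u. u \<in> H1_vec d \<and> ?Q u = 1}"
  define M where "M = Sup A"
  have bdd: "bdd_above A"
    unfolding A_def by (rule bdd_aboveI2[where M = "?B * (?S * (K * 1)\<^sup>2)"]) (use FQ in fastforce)
  have normalize: "(\<lambda>i x. (1 / sqrt (?Q v)) * v i x) \<in> {u. u \<in> H1_vec d \<and> ?Q u = 1}"
      "?F (\<lambda>i x. (1 / sqrt (?Q v)) * v i x) = ?F v / (?Q v)\<^sup>2" if v: "v \<in> H1_vec d" "?Q v > 0" for v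
  proof -
    show "(\<lambda>i x. (1 / sqrt (?Q v)) * v i x) \<in> {u. u \<in> H1_vec d \<and> ?Q u = 1}"
      using v(2) unfolding mem_Collect_eq quadratic_form_cmult_cmult[OF v(1)]
      by (intro conjI H1_vec_cmult v(1)) (simp add: power_divide)
    have "(sqrt (?Q v))^4 = ((sqrt (?Q v))\<^sup>2)\<^sup>2" by (simp only: power_mult[symmetric]) simp
    also have "\<dots> = (?Q v)\<^sup>2" using v by simp
    finally show "?F (\<lambda>i x. (1 / sqrt (?Q v)) * v i x) = ?F v / (?Q v)\<^sup>2"
      unfolding quartic_form_cmult by (simp add: power_divide)
  qed
  have FM: "?F v \<le> M * (?Q v)\<^sup>2" if v: "v \<in> H1_vec d" for v
  proof (cases "?Q v = 0")
    case True
    then show ?thesis using FQ[OF v] by simp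
  next
    case False
    then have Qp: "?Q v > 0" using Q0[of v] by linarith
    have "?F v / (?Q v)\<^sup>2 \<le> M"
      unfolding M_def normalize(2)[OF v Qp, symmetric] A_def
      by (rule cSup_upper[OF imageI bdd[unfolded A_def]]) (rule normalize(1)[OF v Qp])
    then show ?thesis using Qp by (simp add: pos_divide_le_eq)
  qed
  have M0: "M > 0"
  proof (rule ccontr)
    assume "\<not> M > 0"
    then have "M * (?Q w)\<^sup>2 \<le> 0" by (simp add: mult_nonpos_nonneg)
    then show False using FM[OF w(1)] w(2) by linarith
  qed
  have "?Q w > 0" using FQ[OF w(1)] w(2) Q0[of w] by (cases "?Q w = 0") auto
  then have ne: "A \<noteq> {}" unfolding A_def using normalize(1)[OF w(1)] by blast
  have "\<exists>u. u \<in> H1_vec d \<and> ?Q u = 1 \<and> M - M / 2 * (1/2)^n < ?F u" for n :: nat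
  proof -
    have "M - M / 2 * (1/2)^n < Sup A" using M0 by (simp add: M_def[symmetric])
    then obtain y where "y \<in> A" "M - M / 2 * (1/2)^n < y" using less_cSupD[OF ne] by blast
    then show ?thesis by (auto simp: A_def)
  qed
  then obtain s :: "nat \<Rightarrow> nat \<Rightarrow> real^'n \<Rightarrow> real" where s: "\<And>n. s n \<in> H1_vec d" "\<And>n. ?Q (s n) = 1"
    "\<And>n. M - M / 2 * (1/2)^n < ?F (s n)" by metis
  have sM: "?F (s n) \<le> M" for n using FM[OF s(1)[of n]] s(2)[of n] by simp
  have sM2: "M / 2 \<le> ?F (s n)" for n
  proof -
    have "M / 2 * (1/2)^n \<le> M / 2 * 1" using M0 by (intro mult_left_mono) (auto simp: power_le_one)
    then show ?thesis using s(3)[of n] by linarith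
  qed
  have sK: "H1_sq d (s n) \<le> K" for n using sqK[of "s n"] s(2)[of n] by simp
  obtain k \<delta> where \<delta>: "\<delta> > 0" and nonvan: "\<And>u::nat \<Rightarrow> real^'n \<Rightarrow> real. u \<in> H1_vec d \<Longrightarrow> H1_sq d u \<le> K \<Longrightarrow> ?F u \<ge> M / 2 \<Longrightarrow>
      \<exists>x. \<exists>i\<in>{1..d}. \<bar>cube_average ((1/2)^k) (u i) x\<bar> > \<delta>"
    using quartic_form_nonvanishing[of "M / 2" K d \<beta>] M0 K by auto
  have "\<forall>n. \<exists>x. \<exists>i\<in>{1..d}. \<bar>cube_average ((1/2)^k) (s n i) x\<bar> > \<delta>"
    using nonvan s(1) sK sM2 by blast
  then obtain X where X: "\<And>n. \<exists>i\<in>{1..d}. \<bar>cube_average ((1/2)^k) (s n i) (X n)\<bar> > \<delta>" by metis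
  define v where "v n i x = s n i (x + X n)" for n i x
  have v: "v n \<in> H1_vec d" "?Q (v n) = 1" "?F (v n) = ?F (s n)" "H1_sq d (v n) \<le> K" for n
    using H1_vec_shift[OF s(1)] quadratic_form_shift[OF s(1)[of n], of _ "X n"] quartic_form_shift[OF s(1)[of n], of \<beta> "X n"] s(2) sK[of n]
    by (simp_all add: v_def[abs_def])
  have v\<delta>: "\<delta> \<le> (\<Sum>i\<in>{1..d}. \<bar>cube_average ((1/2)^k) (v n i) 0\<bar>)" for n
  proof -
    obtain i where i: "i \<in> {1..d}" "\<bar>cube_average ((1/2)^k) (s n i) (X n)\<bar> > \<delta>" using X by blast
    have "cube_average ((1/2)^k) (v n i) 0 = cube_average ((1/2)^k) (s n i) (X n)"
      by (simp add: cube_average_def v_def add.commute)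
    moreover have "\<bar>cube_average ((1/2)^k) (v n i) 0\<bar> \<le> (\<Sum>i\<in>{1..d}. \<bar>cube_average ((1/2)^k) (v n i) 0\<bar>)"
      using i by (intro member_le_sum) auto
    ultimately show ?thesis using i by linarith
  qed
  obtain r u where r: "strict_mono (r :: nat \<Rightarrow> nat)" and u: "u \<in> H1_vec d"
    and weak: "\<forall>i\<in>{1..d}. H1_weak (\<lambda>n. v (r n) i) (u i)"
    using H1_vec_weak_compactness[of v d K, OF v(1) v(4)] by (elim exE conjE)
  define \<rho> where "\<rho> n i x = v (r n) i x - u i x" for n i x
  have \<rho>: "\<rho> n \<in> H1_vec d" for n unfolding \<rho>_def[abs_def] by (intro H1_vec_diff v u)
  have uL: "u i \<in> L2" and vL: "v n i \<in> L2" if "i \<in> {1..d}" for i n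
    using H1_vecD[OF u that] H1_vecD[OF v(1) that] by (auto intro: H1_L2)
  define t where "t = ?Q u"
  have lim_bil: "(\<lambda>n. quadratic_form d l (v (r n)) u) \<longlonglongrightarrow> quadratic_form d l u u" for l
    unfolding quadratic_form_def by (intro tendsto_sum H1_weak_inner) (use weak H1_vecD[OF u] in auto)
  have \<rho>Q: "quadratic_form d l (\<rho> n) (\<rho> n) =
      quadratic_form d l (v (r n)) (v (r n)) - 2 * quadratic_form d l (v (r n)) u + quadratic_form d l u u" for l n
    using quadratic_form_add_cmult[OF v(1)[of "r n"] u, of l "-1"] by (simp add: \<rho>_def[abs_def])
  have lim\<rho>: "(\<lambda>n. ?Q (\<rho> n)) \<longlonglongrightarrow> 1 - t"
  proof -
    have "(\<lambda>n. 1 - 2 * quadratic_form d lam (v (r n)) u + t) \<longlonglongrightarrow> 1 - 2 * t + t"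
      unfolding t_def by (intro tendsto_intros lim_bil)
    then show ?thesis by (simp add: \<rho>Q v(2) t_def)
  qed
  have t1: "t \<le> 1"
    using tendsto_lowerbound[OF lim\<rho>, of 0] Q0 by simp
  have t0: "t > 0"
  proof (rule ccontr)
    assume "\<not> t > 0"
    then have "H1_sq d u \<le> 0" using sqK[of u] Q0[of u] by (simp add: t_def)
    then have "H1_inner 1 (u i) (u i) \<le> 0" if "i \<in> {1..d}" for i
      using H1_inner_le_H1_sq[OF that, of u] by linarith
    then have "AE x in lborel. u i x = 0" if "i \<in> {1..d}" for i
      using that H1_eq_zero_AE[OF H1_vecD[OF u that]] by blast
    then have "(LINT x|lborel. (u i x)\<^sup>2) = 0" if "i \<in> {1..d}" for i
      using that by (intro integral_eq_zero_AE) (auto elim: eventually_mono)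
    then have zero: "cube_average ((1/2)^k) (u i) 0 = 0" if "i \<in> {1..d}" for i
      using cube_average_square_le[OF uL[OF that], of "(1/2)^k" 0] that by simp
    have "(\<lambda>n. \<Sum>i\<in>{1..d}. \<bar>cube_average ((1/2)^k) (v (r n) i) 0\<bar>) \<longlonglongrightarrow>
        (\<Sum>i\<in>{1..d}. \<bar>cube_average ((1/2)^k) (u i) 0\<bar>)"
    proof (intro tendsto_sum tendsto_rabs cube_average_weak_tendsto)
      fix i and h :: "real^'n \<Rightarrow> real" assume "i \<in> {1..d}" "h \<in> L2"
      then show "(\<lambda>n. LINT x|lborel. v (r n) i x * h x) \<longlonglongrightarrow> (LINT x|lborel. u i x * h x)"
        using weak by (auto simp: H1_weak_def)
    qed (use uL vL in auto)
    then have "\<delta> \<le> (\<Sum>i\<in>{1..d}. \<bar>cube_average ((1/2)^k) (u i) 0\<bar>)"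
      using v\<delta> by (intro tendsto_lowerbound[where F = sequentially]) auto
    then show False using zero \<delta> by simp
  qed
  have split: "(\<lambda>n. ?F (v (r n)) - ?F u - ?F (\<rho> n)) \<longlonglongrightarrow> 0"
  proof -
    define K' where "K' = 2 * K + 2 * H1_sq d u"
    have \<rho>K: "H1_sq d (\<rho> n) \<le> K'" for n
    proof -
      have "0 \<le> H1_sq d (\<lambda>i x. v (r n) i x + 1 * u i x)" by (rule H1_sq_nonneg)
      then have "0 \<le> H1_sq d (v (r n)) + 2 * quadratic_form d (\<lambda>_. 1) (v (r n)) u + H1_sq d u"
        unfolding quadratic_form_add_cmult[OF v(1)[of "r n"] u] by simp
      then show ?thesis using v(4)[of "r n"] unfolding \<rho>Q K'_def by linarith
    qed
    have \<rho>K': "H1_inner 1 (\<rho> n i) (\<rho> n i) \<le> K'" if "i \<in> {1..d}" for n i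
      using H1_inner_le_H1_sq[OF that] \<rho>K order_trans by blast
    have \<rho>4: "(LINT x|lborel. (\<rho> n i x)^4) \<le> ?S * K'\<^sup>2" if "i \<in> {1..d}" for n i
    proof -
      have "(LINT x|lborel. (\<rho> n i x)^4) \<le> ?S * (H1_inner 1 (\<rho> n i) (\<rho> n i))\<^sup>2"
        by (rule H1_pow4_le[OF dim H1_vecD[OF \<rho> that]])
      also have "\<dots> \<le> ?S * K'\<^sup>2"
        using \<rho>K'[OF that] sobolev_const_pos[of "TYPE('n)"]
        by (intro mult_left_mono power_mono H1_inner_nonneg) auto
      finally show ?thesis .
    qed
    have van: "(\<lambda>n. LINT x|lborel. (u i x)\<^sup>2 * (\<rho> n j x)\<^sup>2) \<longlonglongrightarrow> 0" if ij: "i \<in> {1..d}" "j \<in> {1..d}" for i j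
    proof (rule squares_weak_vanish[OF dim H1_vecD[OF u ij(1)] H1_vecD[OF \<rho> ij(2)] \<rho>K'[OF ij(2)]])
      fix h :: "real^'n \<Rightarrow> real" assume h: "h \<in> L2"
      have "(\<lambda>n. (LINT x|lborel. v (r n) j x * h x) - (LINT x|lborel. u j x * h x)) \<longlonglongrightarrow>
          (LINT x|lborel. u j x * h x) - (LINT x|lborel. u j x * h x)"
        using weak ij h by (intro tendsto_intros) (auto simp: H1_weak_def)
      then show "(\<lambda>n. LINT x|lborel. \<rho> n j x * h x) \<longlonglongrightarrow> 0"
        using L2_mult_integrable[OF uL[OF ij(2)] h] L2_mult_integrable[OF vL[OF ij(2)] h]
        by (simp add: \<rho>_def left_diff_distrib)
    qed
    have "(\<lambda>n. \<Sum>i\<in>{1..d}. \<Sum>j\<in>{1..d}. \<beta> i j * ((LINT x|lborel. (u i x + \<rho> n i x)\<^sup>2 * (u j x + \<rho> n j x)\<^sup>2)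
        - (LINT x|lborel. (u i x)\<^sup>2 * (u j x)\<^sup>2) - (LINT x|lborel. (\<rho> n i x)\<^sup>2 * (\<rho> n j x)\<^sup>2))) \<longlonglongrightarrow>
        (\<Sum>i\<in>{1..d}. \<Sum>j\<in>{1..d}. \<beta> i j * 0)"
      by (intro tendsto_sum tendsto_mult tendsto_const product_squares_split[where K = "?S * K'\<^sup>2"])
        (use van \<rho>4 H1_L4[OF dim H1_vecD[OF u]] H1_L4[OF dim H1_vecD[OF \<rho>]] in auto)
    moreover have "(\<Sum>i\<in>{1..d}. \<Sum>j\<in>{1..d}. \<beta> i j * ((LINT x|lborel. (u i x + \<rho> n i x)\<^sup>2 * (u j x + \<rho> n j x)\<^sup>2)
        - (LINT x|lborel. (u i x)\<^sup>2 * (u j x)\<^sup>2) - (LINT x|lborel. (\<rho> n i x)\<^sup>2 * (\<rho> n j x)\<^sup>2))) =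
        ?F (v (r n)) - ?F u - ?F (\<rho> n)" for n
    proof -
      have "u i x + \<rho> n i x = v (r n) i x" for i x by (simp add: \<rho>_def)
      then show ?thesis by (simp add: quartic_form_def right_diff_distrib sum_subtractf)
    qed
    ultimately show ?thesis by simp
  qed
  have limF: "(\<lambda>n. ?F (s n)) \<longlonglongrightarrow> M"
  proof (rule tendsto_sandwich[OF _ _ _ tendsto_const])
    show "\<forall>\<^sub>F n in sequentially. M - M / 2 * (1/2)^n \<le> ?F (s n)" using s(3) by (simp add: less_imp_le)
    show "\<forall>\<^sub>F n in sequentially. ?F (s n) \<le> M" using sM by simp
    have "(\<lambda>n. M - M / 2 * (1/2)^n) \<longlonglongrightarrow> M - M / 2 * 0"
      by (intro tendsto_intros LIMSEQ_power_zero) auto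
    then show "(\<lambda>n. M - M / 2 * (1/2)^n) \<longlonglongrightarrow> M" by simp
  qed
  have "(\<lambda>n. ?F (v (r n)) - (?F (v (r n)) - ?F u - ?F (\<rho> n))) \<longlonglongrightarrow> M - 0"
    using LIMSEQ_subseq_LIMSEQ[OF limF r] by (intro tendsto_diff split) (simp add: v(3) o_def)
  moreover have "?F (v (r n)) - (?F (v (r n)) - ?F u - ?F (\<rho> n)) \<le> ?F u + M * (?Q (\<rho> n))\<^sup>2" for n
    using FM[OF \<rho>[of n]] by simp
  moreover have "(\<lambda>n. ?F u + M * (?Q (\<rho> n))\<^sup>2) \<longlonglongrightarrow> ?F u + M * (1 - t)\<^sup>2"
    by (intro tendsto_intros lim\<rho>)
  ultimately have Mle: "M \<le> ?F u + M * (1 - t)\<^sup>2"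
    by (intro tendsto_le[OF _ _ ]) auto
  have "?F u \<le> M * t\<^sup>2" using FM[OF u] by (simp add: t_def)
  with Mle have "M * 1 \<le> M * (t\<^sup>2 + (1 - t)\<^sup>2)" by (simp add: distrib_left)
  then have "1 \<le> t\<^sup>2 + (1 - t)\<^sup>2" using M0 by (simp only: mult_le_cancel_left_pos)
  then have "0 \<le> t * (t - 1)" by (simp add: power2_eq_square algebra_simps)
  then have t: "t = 1" using t0 t1 by (simp add: zero_le_mult_iff)
  have "M \<le> ?F u" using Mle t by simp
  moreover have "?F u \<le> M" using FM[OF u] t by (simp add: t_def)
  ultimately have "?F u = M" by simp
  then show ?thesis using u t FM by (intro exI[of _ u] conjI allI impI) (simp_all add: t_def)
qed

end

section \<open>Critical points\<close>

context
  assumes dim: "CARD('n::finite) \<le> 3"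
begin

lemma critical_point_equation:
  fixes u h :: "nat \<Rightarrow> real^'n \<Rightarrow> real"
  assumes u: "u \<in> H1_vec d" and h: "h \<in> H1_vec d"
    and sym: "\<And>i j. i \<in> {1..d} \<Longrightarrow> j \<in> {1..d} \<Longrightarrow> i \<noteq> j \<Longrightarrow> b i j = b j i"
    and crit: "has_H1_derivative d (energy d lam mu b) (\<lambda>h. 0) u"
  shows "quadratic_form d lam u h = quartic_derivative d (coupling mu b) u h"
proof -
  let ?E = "energy d lam mu b" and ?\<beta> = "coupling mu b"
  have sym': "?\<beta> i j = ?\<beta> j i" if "i \<in> {1..d}" "j \<in> {1..d}" for i j
    using sym[OF that] by (auto simp: coupling_def)
  have E: "?E z = quadratic_form d lam z z / 2 - quartic_form d ?\<beta> z / 4" if "z \<in> H1_vec d" for z :: "nat \<Rightarrow> real^'n \<Rightarrow> real"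
    using that sym by (rule energy_eq)
  define L where "L = quadratic_form d lam u h - quartic_derivative d ?\<beta> u h"
  obtain C where C: "\<And>t. \<bar>t\<bar> \<le> 1 \<Longrightarrow> \<bar>quartic_form d ?\<beta> (\<lambda>i x. u i x + t * h i x) - quartic_form d ?\<beta> u
      - 4 * t * quartic_derivative d ?\<beta> u h\<bar> \<le> C * t\<^sup>2"
    using quartic_form_expand_cmult[where \<beta> = ?\<beta>, OF dim u h sym'] by blast
  define C1 where "C1 = \<bar>quadratic_form d lam h h\<bar> / 2 + \<bar>C\<bar> / 4"
  have C10: "0 \<le> C1" by (simp add: C1_def)
  have expand: "\<bar>?E (\<lambda>i x. u i x + t * h i x) - ?E u - t * L\<bar> \<le> C1 * t\<^sup>2" if t: "\<bar>t\<bar> \<le> 1" for t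
  proof -
    let ?R = "quartic_form d ?\<beta> (\<lambda>i x. u i x + t * h i x) - quartic_form d ?\<beta> u - 4 * t * quartic_derivative d ?\<beta> u h"
    have "?E (\<lambda>i x. u i x + t * h i x) - ?E u - t * L = quadratic_form d lam h h / 2 * t\<^sup>2 - ?R / 4"
      unfolding E[OF H1_vec_add[OF u H1_vec_cmult[OF h]]] E[OF u]
        quadratic_form_add_cmult[OF u h] L_def by (simp add: field_simps)
    moreover have "\<bar>quadratic_form d lam h h / 2 * t\<^sup>2\<bar> = \<bar>quadratic_form d lam h h\<bar> / 2 * t\<^sup>2"
      by (simp add: abs_mult)
    moreover have "\<bar>?R / 4\<bar> \<le> \<bar>C\<bar> / 4 * t\<^sup>2"
      using C[OF t] mult_right_mono[OF abs_ge_self[of C], of "t\<^sup>2"] by simp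
    moreover have "C1 * t\<^sup>2 = \<bar>quadratic_form d lam h h\<bar> / 2 * t\<^sup>2 + \<bar>C\<bar> / 4 * t\<^sup>2"
      by (simp add: C1_def distrib_right)
    ultimately show ?thesis by linarith
  qed
  have "L = 0"
  proof (rule ccontr)
    assume L: "L \<noteq> 0"
    define n where "n = H1_vec_norm d h"
    have n: "0 \<le> n" by (simp add: n_def H1_vec_norm_nonneg)
    have nt: "H1_vec_norm d (\<lambda>i x. t * h i x) = \<bar>t\<bar> * n" for t
    proof -
      have "(H1_vec_norm d (\<lambda>i x. t * h i x))\<^sup>2 = (\<bar>t\<bar> * n)\<^sup>2"
        unfolding H1_vec_norm_sq[OF H1_vec_cmult[OF h]] quadratic_form_cmult_cmult[OF h] n_def
          power_mult_distrib H1_vec_norm_sq[OF h] by simp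
      then show ?thesis
        by (rule power2_eq_imp_eq) (use n in \<open>auto intro: H1_vec_norm_nonneg\<close>)
    qed
    define e where "e = \<bar>L\<bar> / (2 * (n + 1))"
    have e: "e > 0" using L n by (simp add: e_def)
    have en: "e * n \<le> \<bar>L\<bar> / 2" using n by (simp add: e_def divide_simps) (simp add: algebra_simps)
    obtain \<delta> where \<delta>: "\<delta> > 0" and small: "\<And>k. k \<in> H1_vec d \<Longrightarrow> H1_vec_norm d k < \<delta> \<Longrightarrow>
        \<bar>?E (\<lambda>i x. u i x + k i x) - ?E u - 0\<bar> \<le> e * H1_vec_norm d k"
      using crit e unfolding has_H1_derivative_def by blast
    define t where "t = min 1 (min (\<delta> / (2 * (n + 1))) (\<bar>L\<bar> / (4 * (C1 + 1))))"
    have t: "0 < t" "t \<le> 1" using \<delta> n L C10 by (auto simp: t_def)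
    have "t \<le> \<delta> / (2 * (n + 1))" by (simp add: t_def)
    then have "t * (2 * (n + 1)) \<le> \<delta>" using n by (simp add: pos_le_divide_eq)
    moreover have "t * (2 * (n + 1)) = 2 * (t * n) + 2 * t" by (simp add: algebra_simps)
    ultimately have "t * n < \<delta>" using t mult_nonneg_nonneg[of t n] n by linarith
    then have "\<bar>?E (\<lambda>i x. u i x + t * h i x) - ?E u\<bar> \<le> e * (t * n)"
      using small[OF H1_vec_cmult[OF h, of t]] t by (simp add: nt)
    then have "\<bar>t * L\<bar> \<le> e * (t * n) + C1 * t\<^sup>2"
      using expand[of t] t by linarith
    then have "t * \<bar>L\<bar> \<le> t * (e * n + C1 * t)"
      using t by (simp add: abs_mult power2_eq_square algebra_simps)
    then have "\<bar>L\<bar> \<le> e * n + C1 * t" using t by simp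
    moreover have "t \<le> \<bar>L\<bar> / (4 * (C1 + 1))" by (simp add: t_def)
    then have "t * (4 * (C1 + 1)) \<le> \<bar>L\<bar>" using C10 by (simp add: pos_le_divide_eq)
    moreover have "t * (4 * (C1 + 1)) = 4 * (C1 * t) + 4 * t" by (simp add: algebra_simps)
    ultimately show False using en t L by linarith
  qed
  then show ?thesis by (simp add: L_def)
qed

lemma critical_point_if_equation:
  fixes u :: "nat \<Rightarrow> real^'n \<Rightarrow> real"
  assumes u: "u \<in> H1_vec d"
    and lam: "\<And>i. i \<in> {1..d} \<Longrightarrow> lam i > 0"
    and sym: "\<And>i j. i \<in> {1..d} \<Longrightarrow> j \<in> {1..d} \<Longrightarrow> i \<noteq> j \<Longrightarrow> b i j = b j i"
    and eq: "\<And>h. h \<in> H1_vec d \<Longrightarrow> quadratic_form d lam u h = quartic_derivative d (coupling mu b) u h"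
  shows "has_H1_derivative d (energy d lam mu b) (\<lambda>h. 0) u"
proof -
  let ?E = "energy d lam mu b" and ?\<beta> = "coupling mu b" and ?S = "sobolev_const TYPE('n)"
  have sym': "?\<beta> i j = ?\<beta> j i" if "i \<in> {1..d}" "j \<in> {1..d}" for i j
    using sym[OF that] by (auto simp: coupling_def)
  have E: "?E z = quadratic_form d lam z z / 2 - quartic_form d ?\<beta> z / 4" if "z \<in> H1_vec d" for z :: "nat \<Rightarrow> real^'n \<Rightarrow> real"
    using that sym by (rule energy_eq)
  define q where "q = 1 + (\<Sum>i\<in>{1..d}. lam i)"
  define B where "B = coupling_size d ?\<beta> * ?S"
  define C where "C = q / 2 + B * (8 * H1_sq d u + 3) / 4"
  have "0 \<le> (\<Sum>i\<in>{1..d}. lam i)" using lam by (intro sum_nonneg) (auto simp: less_imp_le)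
  then have q: "0 \<le> q" by (simp add: q_def)
  have B: "0 \<le> B" using sobolev_const_pos[of "TYPE('n)"] coupling_size_nonneg[of d ?\<beta>] by (simp add: B_def)
  have C: "0 \<le> C" using q B H1_sq_nonneg[of d u] by (simp add: C_def)
  have bound: "\<bar>?E (\<lambda>i x. u i x + h i x) - ?E u\<bar> \<le> C * (H1_vec_norm d h)\<^sup>2"
    if h: "h \<in> H1_vec d" and h1: "H1_vec_norm d h \<le> 1" for h
  proof -
    have sq: "(H1_vec_norm d h)\<^sup>2 = H1_sq d h" by (rule H1_vec_norm_sq[OF h])
    have sq1: "H1_sq d h \<le> 1" using h1 H1_vec_norm_nonneg[of d h] by (simp add: power_le_one flip: sq)
    let ?R = "quartic_form d ?\<beta> (\<lambda>i x. u i x + h i x) - quartic_form d ?\<beta> u - 4 * quartic_derivative d ?\<beta> u h"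
    have "quadratic_form d lam (\<lambda>i x. u i x + h i x) (\<lambda>i x. u i x + h i x) =
        quadratic_form d lam u u + 2 * quadratic_form d lam u h + quadratic_form d lam h h"
      using quadratic_form_add_cmult[OF u h, of lam 1] by simp
    then have "?E (\<lambda>i x. u i x + h i x) - ?E u = quadratic_form d lam h h / 2 - ?R / 4"
      unfolding E[OF H1_vec_add[OF u h]] E[OF u] using eq[OF h] by (simp add: field_simps)
    moreover have "\<bar>?R\<bar> \<le> B * (8 * (H1_sq d u * H1_sq d h) + 3 * (H1_sq d h)\<^sup>2)"
      using quartic_form_expand[where \<beta> = ?\<beta>, OF dim u h sym'] by (simp add: B_def mult.assoc)
    moreover have "B * (8 * (H1_sq d u * H1_sq d h) + 3 * (H1_sq d h)\<^sup>2) \<le> B * (8 * H1_sq d u + 3) * H1_sq d h"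
    proof -
      have "(H1_sq d h)\<^sup>2 \<le> H1_sq d h"
        using sq1 H1_sq_nonneg[of d h] by (simp add: power2_eq_square mult_left_le)
      then have "B * (8 * (H1_sq d u * H1_sq d h) + 3 * (H1_sq d h)\<^sup>2) \<le> B * (8 * (H1_sq d u * H1_sq d h) + 3 * H1_sq d h)"
        using B by (intro mult_left_mono) auto
      then show ?thesis by (simp add: algebra_simps)
    qed
    moreover have "quadratic_form d lam h h \<le> q * H1_sq d h"
      unfolding q_def using lam by (rule quadratic_form_le_H1_sq)
    moreover have "0 \<le> quadratic_form d lam h h" using lam by (rule quadratic_form_nonneg)
    moreover have "C * H1_sq d h = q * H1_sq d h / 2 + B * (8 * H1_sq d u + 3) * H1_sq d h / 4"
      by (simp add: C_def distrib_right)
    moreover have "\<bar>E\<bar> \<le> X" if "E = Q / 2 - R / 4" "\<bar>R\<bar> \<le> r" "r \<le> s" "Q \<le> p" "0 \<le> Q" "X = p / 2 + s / 4"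
      for E Q R r s p X :: real
      using that by linarith
    ultimately show ?thesis unfolding sq by blast
  qed
  have "\<exists>\<delta>>0. \<forall>h\<in>H1_vec d. H1_vec_norm d h < \<delta> \<longrightarrow>
      \<bar>?E (\<lambda>i x. u i x + h i x) - ?E u - 0\<bar> \<le> e * H1_vec_norm d h" if e: "e > 0" for e
  proof (intro exI conjI ballI impI)
    show "min 1 (e / (C + 1)) > 0" using e C by simp
    fix h :: "nat \<Rightarrow> real^'n \<Rightarrow> real" assume h: "h \<in> H1_vec d" "H1_vec_norm d h < min 1 (e / (C + 1))"
    let ?n = "H1_vec_norm d h"
    have n: "0 \<le> ?n" by (rule H1_vec_norm_nonneg)
    have "?n * (C + 1) \<le> e" using h C by (simp add: pos_less_divide_eq less_imp_le)
    moreover have "?n * (C + 1) = C * ?n + ?n" by (simp add: algebra_simps)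
    ultimately have "C * ?n \<le> e" using n by linarith
    then have "C * ?n * ?n \<le> e * ?n" using n by (rule mult_right_mono)
    then show "\<bar>?E (\<lambda>i x. u i x + h i x) - ?E u - 0\<bar> \<le> e * ?n"
      using bound[OF h(1)] h(2) by (simp add: power2_eq_square mult.assoc)
  qed
  then show ?thesis
    unfolding has_H1_derivative_def by (auto intro: exI[of _ 0])
qed

lemma critical_point_energy:
  fixes u :: "nat \<Rightarrow> real^'n \<Rightarrow> real"
  assumes u: "u \<in> H1_vec d"
    and sym: "\<And>i j. i \<in> {1..d} \<Longrightarrow> j \<in> {1..d} \<Longrightarrow> i \<noteq> j \<Longrightarrow> b i j = b j i"
    and crit: "has_H1_derivative d (energy d lam mu b) (\<lambda>h. 0) u"
  shows "energy d lam mu b u = quadratic_form d lam u u / 4"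
proof -
  have "quadratic_form d lam u u = quartic_form d (coupling mu b) u"
    using critical_point_equation[OF u u sym crit] by (simp add: quartic_derivative_self)
  moreover have "energy d lam mu b u = quadratic_form d lam u u / 2 - quartic_form d (coupling mu b) u / 4"
    using u sym by (rule energy_eq)
  ultimately show ?thesis by simp
qed

lemma low_energy_solution:
  fixes w :: "nat \<Rightarrow> real^'n \<Rightarrow> real"
  assumes lam: "\<And>i. i \<in> {1..d} \<Longrightarrow> lam i > 0"
    and sym: "\<And>i j. i \<in> {1..d} \<Longrightarrow> j \<in> {1..d} \<Longrightarrow> i \<noteq> j \<Longrightarrow> b i j = b j i"
    and w: "w \<in> H1_vec d" "quartic_form d (coupling mu b) w > 0"
  shows "\<exists>u \<in> (nontrivial_solutions d lam mu b :: (nat \<Rightarrow> real^'n \<Rightarrow> real) set).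
    quartic_form d (coupling mu b) w * quadratic_form d lam u u \<le> (quadratic_form d lam w w)\<^sup>2"
proof -
  let ?\<beta> = "coupling mu b"
  let ?Q = "\<lambda>u::nat \<Rightarrow> real^'n \<Rightarrow> real. quadratic_form d lam u u"
  have sym': "?\<beta> i j = ?\<beta> j i" if "i \<in> {1..d}" "j \<in> {1..d}" for i j
    using sym[OF that] by (auto simp: coupling_def)
  obtain v :: "nat \<Rightarrow> real^'n \<Rightarrow> real" where v: "v \<in> H1_vec d" "?Q v = 1"
    and max: "\<forall>u::nat \<Rightarrow> real^'n \<Rightarrow> real. u \<in> H1_vec d \<longrightarrow> quartic_form d ?\<beta> u \<le> quartic_form d ?\<beta> v * (?Q u)\<^sup>2"
    using quartic_maximizer[where lam = lam, OF dim lam w] by blast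
  define M where "M = quartic_form d ?\<beta> v"
  have M: "M > 0"
  proof (rule ccontr)
    assume "\<not> M > 0"
    then have "M * (?Q w)\<^sup>2 \<le> 0" by (simp add: mult_nonpos_nonneg)
    then show False using max w unfolding M_def by fastforce
  qed
  have el: "quartic_derivative d ?\<beta> v h = M * quadratic_form d lam v h" if h: "h \<in> H1_vec d" for h
  proof -
    obtain C where C: "\<And>t. \<bar>t\<bar> \<le> 1 \<Longrightarrow> \<bar>quartic_form d ?\<beta> (\<lambda>i x. v i x + t * h i x) - quartic_form d ?\<beta> v
        - 4 * t * quartic_derivative d ?\<beta> v h\<bar> \<le> C * t\<^sup>2"
      using quartic_form_expand_cmult[where \<beta> = ?\<beta>, OF dim v(1) h sym'] by blast
    let ?b = "quadratic_form d lam v h" and ?q = "?Q h" and ?D = "quartic_derivative d ?\<beta> v h"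
    define C' where "C' = C + M * (4 * \<bar>?b\<bar>\<^sup>2 + \<bar>?q\<bar>\<^sup>2 + 2 * \<bar>?q\<bar> + 4 * \<bar>?b\<bar> * \<bar>?q\<bar>)"
    have "(4 * (?D - M * ?b)) * t \<le> C' * t\<^sup>2" if t: "\<bar>t\<bar> \<le> 1" for t
    proof -
      have "quartic_form d ?\<beta> v + 4 * t * ?D - C * t\<^sup>2 \<le> quartic_form d ?\<beta> (\<lambda>i x. v i x + t * h i x)"
        using C[OF t] by linarith
      also have "\<dots> \<le> M * (1 + 2 * t * ?b + t\<^sup>2 * ?q)\<^sup>2"
        using max[rule_format, OF H1_vec_add[OF v(1) H1_vec_cmult[OF h, of t]]]
        unfolding quadratic_form_add_cmult[OF v(1) h] v(2) M_def .
      also have "(1 + 2 * t * ?b + t\<^sup>2 * ?q)\<^sup>2 =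
          1 + 4 * t * ?b + t\<^sup>2 * (4 * ?b\<^sup>2 + t\<^sup>2 * ?q\<^sup>2 + 2 * ?q + 4 * t * ?b * ?q)"
        by (simp add: power2_eq_square algebra_simps)
      finally have 1: "M + 4 * t * ?D - C * t\<^sup>2 \<le>
          M * (1 + 4 * t * ?b + t\<^sup>2 * (4 * ?b\<^sup>2 + t\<^sup>2 * ?q\<^sup>2 + 2 * ?q + 4 * t * ?b * ?q))"
        by (simp add: M_def)
      have "t\<^sup>2 \<le> 1" using t by (simp add: abs_square_le_1)
      then have "t\<^sup>2 * ?q\<^sup>2 \<le> 1 * ?q\<^sup>2" by (intro mult_right_mono) auto
      moreover have "4 * t * ?b * ?q \<le> 4 * \<bar>?b\<bar> * \<bar>?q\<bar>"
      proof -
        have "t * (?b * ?q) \<le> \<bar>t\<bar> * \<bar>?b * ?q\<bar>" by (metis abs_ge_self abs_mult)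
        also have "\<dots> \<le> 1 * \<bar>?b * ?q\<bar>" using t by (intro mult_right_mono) auto
        finally show ?thesis by (simp add: abs_mult mult.assoc)
      qed
      ultimately have "4 * ?b\<^sup>2 + t\<^sup>2 * ?q\<^sup>2 + 2 * ?q + 4 * t * ?b * ?q \<le>
          4 * \<bar>?b\<bar>\<^sup>2 + \<bar>?q\<bar>\<^sup>2 + 2 * \<bar>?q\<bar> + 4 * \<bar>?b\<bar> * \<bar>?q\<bar>"
        using abs_ge_self[of ?q] unfolding power2_abs by linarith
      then have "M * (t\<^sup>2 * (4 * ?b\<^sup>2 + t\<^sup>2 * ?q\<^sup>2 + 2 * ?q + 4 * t * ?b * ?q)) \<le>
          M * (t\<^sup>2 * (4 * \<bar>?b\<bar>\<^sup>2 + \<bar>?q\<bar>\<^sup>2 + 2 * \<bar>?q\<bar> + 4 * \<bar>?b\<bar> * \<bar>?q\<bar>))"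
        using M by (intro mult_left_mono) auto
      with 1 show ?thesis by (simp add: C'_def algebra_simps)
    qed
    then have "4 * (?D - M * ?b) = 0" by (rule linear_coefficient_zero)
    then show ?thesis by simp
  qed
  define c where "c = 1 / sqrt M"
  define u where "u i x = c * v i x" for i x
  have c2: "c\<^sup>2 * M = 1" using M by (simp add: c_def power_divide)
  have u: "u \<in> H1_vec d" unfolding u_def[abs_def] by (rule H1_vec_cmult[OF v(1)])
  have Qu: "?Q u = 1 / M"
    unfolding u_def[abs_def] quadratic_form_cmult_cmult[OF v(1)] v(2) using M by (simp add: c_def power_divide)
  have "quadratic_form d lam u h = quartic_derivative d ?\<beta> u h" if h: "h \<in> H1_vec d" for h
  proof -
    have "quartic_derivative d ?\<beta> u h = c * (c\<^sup>2 * M) * quadratic_form d lam v h"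
      unfolding u_def[abs_def] quartic_derivative_cmult el[OF h] by (simp add: power3_eq_cube power2_eq_square)
    then show ?thesis
      unfolding c2 by (simp add: u_def[abs_def] quadratic_form_cmult[OF v(1) h])
  qed
  then have "has_H1_derivative d (energy d lam mu b) (\<lambda>h. 0) u"
    by (intro critical_point_if_equation u lam sym)
  moreover have "\<not> (\<forall>i\<in>{1..d}. AE x in lborel. u i x = 0)"
  proof
    assume z: "\<forall>i\<in>{1..d}. AE x in lborel. u i x = 0"
    have "(LINT x|lborel. (u i x)\<^sup>2 * (u j x)\<^sup>2) = 0" if "i \<in> {1..d}" for i j
      using z that by (intro integral_eq_zero_AE) (auto elim: eventually_mono)
    then have "quartic_form d ?\<beta> u = 0" by (simp add: quartic_form_def)
    moreover have "c \<noteq> 0" using M by (simp add: c_def)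
    ultimately show False using M unfolding u_def[abs_def] quartic_form_cmult M_def by simp
  qed
  ultimately have "u \<in> nontrivial_solutions d lam mu b" using u by (simp add: nontrivial_solutions_def)
  moreover have "quartic_form d ?\<beta> w * ?Q u \<le> (?Q w)\<^sup>2"
  proof -
    have "quartic_form d ?\<beta> w \<le> M * (?Q w)\<^sup>2" using max w(1) by (simp add: M_def)
    then show ?thesis unfolding Qu using M by (simp add: pos_divide_le_eq mult.commute)
  qed
  ultimately show ?thesis by blast
qed

end

theorem theorem1p5:
  fixes d :: nat and P :: "nat set"
    and lam mu :: "nat \<Rightarrow> real" and b0 :: "nat \<Rightarrow> nat \<Rightarrow> real"
  assumes "CARD('n::finite) \<in> {1, 2, 3}"
    and "P \<subset> {1..d}" and "card P \<ge> 2"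
    and "\<forall>i\<in>{1..d}. lam i > 0 \<and> mu i > 0"
    and "\<forall>i\<in>{1..d}. \<forall>j\<in>{1..d}. i \<noteq> j \<and> (i, j) \<notin> P \<times> P \<longrightarrow> b0 i j = b0 j i \<and> b0 i j > 0"
  shows "\<exists>B::real. \<forall>b :: nat \<Rightarrow> nat \<Rightarrow> real.
    (\<forall>i\<in>{1..d}. \<forall>j\<in>{1..d}. i \<noteq> j \<and> (i, j) \<notin> P \<times> P \<longrightarrow> b i j = b0 i j) \<longrightarrow>
    (\<forall>i\<in>P. \<forall>j\<in>P. i \<noteq> j \<longrightarrow> b i j = b j i \<and> b i j > 0) \<longrightarrow>
    Min {b i j | i j. (i, j) \<in> P \<times> P \<and> i \<noteq> j} > B \<longrightarrow>
      (\<forall>u \<in> (ground_states d lam mu b :: (nat \<Rightarrow> real^'n \<Rightarrow> real) set).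
         \<forall>i0 \<in> {1..d} - P. AE x in lborel. u i0 x = 0) \<and>
      (fully_nontrivial_ground_states d lam mu b :: (nat \<Rightarrow> real^'n \<Rightarrow> real) set) = {}"
proof -
  have dim: "CARD('n) \<le> 3" using assms(1) by auto
  have lam: "\<And>i. i \<in> {1..d} \<Longrightarrow> lam i > 0" and mu: "\<And>i. i \<in> {1..d} \<Longrightarrow> mu i > 0" using assms(4) by auto
  have fP: "finite P" using assms(2) finite_subset by blast
  obtain p q where pq: "p \<in> P" "q \<in> P" "p \<noteq> q"
    using assms(3) fP by (metis card_le_Suc0_iff_eq not_less_eq_eq numeral_2_eq_2)
  have pqd: "p \<in> {1..d}" "q \<in> {1..d}" using pq assms(2) by auto
  let ?S = "sobolev_const TYPE('n)"
  have S: "0 < ?S" by (rule sobolev_const_pos)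
  define K where "K = 1 + (\<Sum>i\<in>{1..d}. 1 / lam i)"
  have "0 \<le> (\<Sum>i\<in>{1..d}. 1 / lam i)" using lam by (intro sum_nonneg) (auto simp: less_imp_le)
  then have K: "K > 0" by (simp add: K_def)
  define C0 where "C0 = coupling_size d (coupling mu b0) * (?S * K\<^sup>2)"
  have C0: "0 \<le> C0" using S coupling_size_nonneg by (simp add: C0_def)
  show ?thesis
  proof (cases "\<exists>f::real^'n \<Rightarrow> real. f \<in> H1 \<and> \<not> (AE x in lborel. f x = 0)")
    case False
    then have "(nontrivial_solutions d lam mu b :: (nat \<Rightarrow> real^'n \<Rightarrow> real) set) = {}" for b
      by (auto simp: nontrivial_solutions_def H1_vec_def)
    then show ?thesis by (simp add: ground_states_def fully_nontrivial_ground_states_def)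
  next
    case True
    then obtain f :: "real^'n \<Rightarrow> real" where f: "f \<in> H1" "\<not> (AE x in lborel. f x = 0)" by blast
    define w where "w i = (if i = p \<or> i = q then f else (\<lambda>x. 0))" for i
    have w: "w \<in> H1_vec d" using f by (auto simp: w_def H1_vec_def H1_zero)
    define F where "F = (LINT x|lborel. (f x)^4)"
    have F: "F > 0"
    proof -
      have "F \<noteq> 0"
        unfolding F_def using f(2) L4_integrable[OF H1_L4[OF dim f(1)]]
        by (subst integral_nonneg_eq_0_iff_AE) auto
      moreover have "0 \<le> F" by (simp add: F_def)
      ultimately show ?thesis by linarith
    qed
    define W where "W = quadratic_form d lam w w"
    define B where "B = C0 * W\<^sup>2 / F"
    have B: "0 \<le> B" using C0 F by (simp add: B_def)
    show ?thesis
    proof (intro exI[of _ B] allI impI)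
      fix b :: "nat \<Rightarrow> nat \<Rightarrow> real"
      assume b1: "\<forall>i\<in>{1..d}. \<forall>j\<in>{1..d}. i \<noteq> j \<and> (i, j) \<notin> P \<times> P \<longrightarrow> b i j = b0 i j"
        and b2: "\<forall>i\<in>P. \<forall>j\<in>P. i \<noteq> j \<longrightarrow> b i j = b j i \<and> b i j > 0"
        and Min: "Min {b i j | i j. (i, j) \<in> P \<times> P \<and> i \<noteq> j} > B"
      let ?\<beta> = "coupling mu b" and ?E = "energy d lam mu b"
      have "{b i j | i j. (i, j) \<in> P \<times> P \<and> i \<noteq> j} \<subseteq> (\<lambda>(i, j). b i j) ` (P \<times> P)" by auto
      then have "finite {b i j | i j. (i, j) \<in> P \<times> P \<and> i \<noteq> j}"
        by (rule finite_subset) (use fP in auto)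
      then have "Min {b i j | i j. (i, j) \<in> P \<times> P \<and> i \<noteq> j} \<le> b p q" using pq by (intro Min_le) auto
      then have bpq: "b p q > B" using Min by linarith
      have bpos: "b i j = b j i \<and> b i j > 0" if "i \<in> {1..d}" "j \<in> {1..d}" "i \<noteq> j" for i j
      proof (cases "(i, j) \<in> P \<times> P")
        case False
        then have "(j, i) \<notin> P \<times> P" by auto
        then show ?thesis using False b1 assms(5) that by auto
      qed (use b2 that in auto)
      have sym: "\<And>i j. i \<in> {1..d} \<Longrightarrow> j \<in> {1..d} \<Longrightarrow> i \<noteq> j \<Longrightarrow> b i j = b j i" using bpos by blast
      have \<beta>pos: "0 < ?\<beta> i j" if "i \<in> {1..d}" "j \<in> {1..d}" for i j
        using bpos[of i j] mu that by (auto simp: coupling_def)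
      have Fw: "b p q * F \<le> quartic_form d ?\<beta> w"
      proof -
        have nn: "0 \<le> ?\<beta> i j * (LINT x|lborel. (w i x)\<^sup>2 * (w j x)\<^sup>2)" if "i \<in> {1..d}" "j \<in> {1..d}" for i j
          using \<beta>pos[OF that] by (intro mult_nonneg_nonneg) auto
        have "b p q * F = ?\<beta> p q * (LINT x|lborel. (w p x)\<^sup>2 * (w q x)\<^sup>2)"
          using pq by (simp add: coupling_def w_def F_def power2_eq_square power4_eq_xxxx mult.assoc)
        also have "\<dots> \<le> (\<Sum>j\<in>{1..d}. ?\<beta> p j * (LINT x|lborel. (w p x)\<^sup>2 * (w j x)\<^sup>2))"
          using pqd nn by (intro member_le_sum[where f = "\<lambda>j. ?\<beta> p j * (LINT x|lborel. (w p x)\<^sup>2 * (w j x)\<^sup>2)"]) auto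
        also have "\<dots> \<le> quartic_form d ?\<beta> w"
          unfolding quartic_form_def
          using pqd nn by (intro member_le_sum[where f = "\<lambda>i. \<Sum>j\<in>{1..d}. ?\<beta> i j * (LINT x|lborel. (w i x)\<^sup>2 * (w j x)\<^sup>2)"])
            (auto intro!: sum_nonneg)
        finally show ?thesis .
      qed
      have Fw0: "quartic_form d ?\<beta> w > 0" using Fw bpq B F mult_pos_pos[of "b p q" F] by linarith
      obtain v :: "nat \<Rightarrow> real^'n \<Rightarrow> real" where v: "v \<in> nontrivial_solutions d lam mu b"
        and vW: "quartic_form d ?\<beta> w * quadratic_form d lam v v \<le> W\<^sup>2"
        using low_energy_solution[where lam = lam and b = b, OF dim lam sym w Fw0] unfolding W_def by blast
      have energy: "?E u = quadratic_form d lam u u / 4" if "u \<in> nontrivial_solutions d lam mu b" for u :: "nat \<Rightarrow> real^'n \<Rightarrow> real"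
        using that by (intro critical_point_energy[where b = b, OF dim] sym) (auto simp: nontrivial_solutions_def)
      have main: "AE x in lborel. u i0 x = 0"
        if u: "u \<in> ground_states d lam mu b" and i0: "i0 \<in> {1..d} - P" for u :: "nat \<Rightarrow> real^'n \<Rightarrow> real" and i0
      proof (rule ccontr)
        assume nz: "\<not> (AE x in lborel. u i0 x = 0)"
        have us: "u \<in> nontrivial_solutions d lam mu b" using u by (simp add: ground_states_def)
        have uH: "u \<in> H1_vec d" and crit: "has_H1_derivative d ?E (\<lambda>h. 0) u"
          using us by (auto simp: nontrivial_solutions_def)
        have i0d: "i0 \<in> {1..d}" using i0 by simp
        let ?Q = "quadratic_form d lam u u"
        have Qnn: "0 \<le> quadratic_form d lam z z" for z :: "nat \<Rightarrow> real^'n \<Rightarrow> real"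
          using lam by (rule quadratic_form_nonneg)
        have "bdd_below (?E ` (nontrivial_solutions d lam mu b :: (nat \<Rightarrow> real^'n \<Rightarrow> real) set))"
          by (rule bdd_belowI2[of _ 0]) (simp add: energy Qnn)
        then have "?E u \<le> ?E v"
          using u v unfolding ground_states_def by (auto intro: cInf_lower)
        then have Qle: "?Q \<le> quadratic_form d lam v v" using energy[OF us] energy[OF v] by simp
        note Q0 = Qnn[of u]
        define h where "h i = (if i = i0 then u i0 else (\<lambda>x. 0))" for i
        have h: "h \<in> H1_vec d" using H1_vecD[OF uH i0d] by (auto simp: h_def H1_vec_def H1_zero)
        define y where "y = H1_inner 1 (u i0) (u i0)"
        have y: "y > 0" using nz H1_eq_zero_AE[OF H1_vecD[OF uH i0d]] unfolding y_def by force
        have "quadratic_form d lam u h = (\<Sum>i\<in>{1..d}. if i = i0 then H1_inner (lam i0) (u i0) (u i0) else 0)"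
        proof -
          have "H1_inner (lam i) (u i) (\<lambda>x. 0) = 0" if "i \<in> {1..d}" for i
            using H1_inner_cmult_left[OF H1_zero H1_vecD[OF uH that], of "lam i" 0]
            by (simp add: H1_inner_commute[of _ "u i"])
          then show ?thesis unfolding quadratic_form_def by (intro sum.cong) (auto simp: h_def)
        qed
        then have l: "quadratic_form d lam u h = H1_inner (lam i0) (u i0) (u i0)" using i0d by simp
        have "quartic_derivative d ?\<beta> u h =
            (\<Sum>i\<in>{1..d}. if i = i0 then \<Sum>j\<in>{1..d}. ?\<beta> i0 j * (LINT x|lborel. (u i0 x)\<^sup>2 * (u j x)\<^sup>2) else 0)"
          unfolding quartic_derivative_def by (intro sum.cong) (auto simp: h_def power2_eq_square)
        then have "H1_inner (lam i0) (u i0) (u i0) = (\<Sum>j\<in>{1..d}. ?\<beta> i0 j * (LINT x|lborel. (u i0 x)\<^sup>2 * (u j x)\<^sup>2))"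
          using critical_point_equation[where b = b, OF dim uH h sym crit] i0d unfolding l by simp
        also have "\<dots> \<le> (\<Sum>j\<in>{1..d}. \<bar>coupling mu b0 i0 j\<bar> * (?S * (y * (K * ?Q))))"
        proof (rule sum_mono)
          fix j assume j: "j \<in> {1..d}"
          have "?\<beta> i0 j = coupling mu b0 i0 j" using b1 i0 j by (auto simp: coupling_def)
          moreover have "(LINT x|lborel. (u i0 x)\<^sup>2 * (u j x)\<^sup>2) \<le> ?S * (y * (K * ?Q))"
          proof -
            have "(LINT x|lborel. (u i0 x)\<^sup>2 * (u j x)\<^sup>2) \<le> ?S * (y * H1_inner 1 (u j) (u j))"
              unfolding y_def by (intro H1_squares_le dim H1_vecD[OF uH] i0d j)
            also have "\<dots> \<le> ?S * (y * (K * ?Q))"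
              using S y order_trans[OF H1_inner_le_H1_sq[OF j, of u] H1_sq_le[where lam = lam and d = d and u = u, OF lam]]
              by (intro mult_left_mono) (auto simp: K_def)
            finally show ?thesis .
          qed
          ultimately show "?\<beta> i0 j * (LINT x|lborel. (u i0 x)\<^sup>2 * (u j x)\<^sup>2) \<le> \<bar>coupling mu b0 i0 j\<bar> * (?S * (y * (K * ?Q)))"
            by (intro mult_mono) auto
        qed
        also have "\<dots> = (\<Sum>j\<in>{1..d}. \<bar>coupling mu b0 i0 j\<bar>) * (?S * (y * (K * ?Q)))"
          by (simp add: sum_distrib_right)
        also have "\<dots> \<le> coupling_size d (coupling mu b0) * (?S * (y * (K * ?Q)))"
        proof (rule mult_right_mono)
          show "(\<Sum>j\<in>{1..d}. \<bar>coupling mu b0 i0 j\<bar>) \<le> coupling_size d (coupling mu b0)"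
            unfolding coupling_size_def
            using i0d by (intro member_le_sum[where f = "\<lambda>i. \<Sum>j\<in>{1..d}. \<bar>coupling mu b0 i j\<bar>"]) (auto intro: sum_nonneg)
          show "0 \<le> ?S * (y * (K * ?Q))" using S y K Q0 by simp
        qed
        finally have up: "H1_inner (lam i0) (u i0) (u i0) \<le> coupling_size d (coupling mu b0) * (?S * (y * (K * ?Q)))" .
        have "y \<le> (1 + 1 / lam i0) * H1_inner (lam i0) (u i0) (u i0)"
          unfolding y_def by (rule H1_inner_1_le[OF lam[OF i0d]])
        also have "\<dots> \<le> K * H1_inner (lam i0) (u i0) (u i0)"
        proof (rule mult_right_mono)
          have "1 / lam i0 \<le> (\<Sum>i\<in>{1..d}. 1 / lam i)"
            using i0d lam by (intro member_le_sum) (auto simp: less_imp_le)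
          then show "1 + 1 / lam i0 \<le> K" by (simp add: K_def)
          show "0 \<le> H1_inner (lam i0) (u i0) (u i0)" using lam[OF i0d] by (intro H1_inner_nonneg) simp
        qed
        also have "\<dots> \<le> K * (coupling_size d (coupling mu b0) * (?S * (y * (K * ?Q))))"
          using K up by (intro mult_left_mono) auto
        also have "\<dots> = y * (C0 * ?Q)" by (simp add: C0_def power2_eq_square mult_ac)
        finally have "y * 1 \<le> y * (C0 * ?Q)" by simp
        then have one: "1 \<le> C0 * ?Q" using y by (simp only: mult_le_cancel_left_pos)
        have "b p q * F * ?Q \<le> quartic_form d ?\<beta> w * quadratic_form d lam v v"
          using Fw Qle Q0 Fw0 by (intro mult_mono) auto
        then have le: "b p q * F * ?Q \<le> W\<^sup>2" using vW by linarith
        have "?Q \<noteq> 0" using one by auto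
        then have "?Q > 0" using Q0 by linarith
        then have "B * F * ?Q < b p q * F * ?Q" using bpq F by simp
        also have "B * F = C0 * W\<^sup>2" using F by (simp add: B_def)
        finally have "C0 * ?Q * W\<^sup>2 < W\<^sup>2" using le by (simp add: mult_ac)
        moreover have "1 * W\<^sup>2 \<le> C0 * ?Q * W\<^sup>2" using one by (intro mult_right_mono) auto
        ultimately show False by linarith
      qed
      have "fully_nontrivial_ground_states d lam mu b = ({} :: (nat \<Rightarrow> real^'n \<Rightarrow> real) set)"
        using main assms(2) unfolding fully_nontrivial_ground_states_def by fast
      with main show "(\<forall>u \<in> (ground_states d lam mu b :: (nat \<Rightarrow> real^'n \<Rightarrow> real) set).
           \<forall>i0 \<in> {1..d} - P. AE x in lborel. u i0 x = 0) \<and>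
        (fully_nontrivial_ground_states d lam mu b :: (nat \<Rightarrow> real^'n \<Rightarrow> real) set) = {}"
        by blast
    qed
  qed
qed

end
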